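(* Let $d\in\mathbb{N}$ and suppose $f$ is an nc rational function in $d$ variables such that $$1-f(\underline{Z})^*f(\underline{Z})\ge0\quad\text{for all }\underline{Z}\in\mathbb{D}^d_{\rm nc}.$$ Then there exist a finite-dimensional Hilbert space $\mathcal{M}$, with $N=\dim\mathcal{M}$ and $\mathcal{M}$ identified with $\mathbb{C}^N$ via an orthonormal basis, a contraction $$T=\begin{bmatrix}A&B\\ C&D\end{bmatrix}:\mathbb{C}\oplus\mathcal{M}\to\mathbb{C}\oplus\mathcal{M},$$ and indices $k(1),\dots,k(N)\in\{1,\dots,d\}$ such that, with the block diagonal matrix $$\Delta(\underline{Z})=\mathrm{diag}\bigl(Z_{k(1)},\dots,Z_{k(N)}\bigr),$$ for every $n\in\mathbb{N}$ and every $\underline{Z}\in\mathbb{D}^d_{\rm nc}\cap\mathbb{M}_n^d$, $$f(\underline{Z})=A\otimes I_{\mathbb{C}^n}+(B\otimes I_{\mathbb{C}^n})\,\Delta(\underline{Z})\,\bigl(I_{\mathcal{M}}\otimes I_{\mathbb{C}^n}-(D\otimes I_{\mathbb{C}^n})\Delta(\underline{Z})\bigr)^{-1}(C\otimes I_{\mathbb{C}^n}).$$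
   Context: For $n\in\mathbb{N}$, $\mathbb{M}_n$ is the space of $n\times n$ complex matrices with the operator norm, $\mathbb{M}_n^d$ is the set of $d$-tuples $\underline{Z}=(Z_1,\dots,Z_d)$ of such matrices, $\mathbb{M}^d=\bigsqcup_{n\ge1}\mathbb{M}_n^d$, and $\|\underline{Z}\|=\max_i\|Z_i\|$. The noncommutative polydisc is $\mathbb{D}^d_{\rm nc}=\{\underline{Z}\in\mathbb{M}^d:\|\underline{Z}\|<1\}$. An nc rational expression is an expression built from noncommuting symbols $Z_1,\dots,Z_d$ using addition, multiplication, scalar multiplication and inverses; it is evaluated at tuples of matrices of any size where all the inverses occurring exist. An nc rational function is an equivalence class of nc rational expressions with nonempty domains, two expressions being identified if they agree on the intersection of their domains. The hypothesis on $f$ includes that $f$ is defined on $\mathbb{D}^d_{\rm nc}$; the inequality is in the sense of positive semidefinite matrices, at every matrix size. For $\underline{Z}\in\mathbb{M}_n^d$, $\Delta(\underline{Z})$ is an $N\times N$ block matrix with $n\times n$ blocks, acting on $\mathcal{M}\otimes\mathbb{C}^n\cong(\mathbb{C}^n)^N$; and $\mathbb{C}\otimes\mathbb{C}^n$ is identified with $\mathbb{C}^n$, so that $I_{\mathbb{C}}\otimes f(\underline{Z})=f(\underline{Z})$. A contraction is an operator of norm at most $1$. *)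

theory Defs
  imports
    "Jordan_Normal_Form.Gauss_Jordan_Elimination"
    "Jordan_Normal_Form.Schur_Decomposition"
begin

definition l2_norm :: "complex vec \<Rightarrow> real" where
  "l2_norm v = sqrt (\<Sum>i<dim_vec v. (cmod (v $ i))\<^sup>2)"

definition op_norm :: "complex mat \<Rightarrow> real" where
  "op_norm A = Sup {l2_norm (A *\<^sub>v v) | v. v \<in> carrier_vec (dim_col A) \<and> l2_norm v \<le> 1}"

definition contraction :: "complex mat \<Rightarrow> bool" where
  "contraction A \<longleftrightarrow> op_norm A \<le> 1"

text \<open>The order on \<^typ>\<open>complex\<close> is the one of \<^theory>\<open>HOL-Library.Complex_Order\<close>: \<open>0 \<le> z\<close> means
  that \<open>z\<close> is real and nonnegative.\<close>

definition psd :: "complex mat \<Rightarrow> bool" where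
  "psd A \<longleftrightarrow> square_mat A \<and> (\<forall>v \<in> carrier_vec (dim_row A). 0 \<le> (A *\<^sub>v v) \<bullet>c v)"

text \<open>Kronecker product. The second factor is the inner one, so \<open>kron A (1\<^sub>m n)\<close> consists of the
  \<open>n \<times> n\<close> blocks \<open>A $$ (i, j) \<cdot> I\<^sub>n\<close>, in accordance with the identification of
  \<open>\<complex>\<^sup>N \<otimes> \<complex>\<^sup>n\<close> with \<open>(\<complex>\<^sup>n)\<^sup>N\<close>.\<close>

definition kron :: "complex mat \<Rightarrow> complex mat \<Rightarrow> complex mat" where
  "kron A B = mat (dim_row A * dim_row B) (dim_col A * dim_col B)
     (\<lambda>(i, j). A $$ (i div dim_row B, j div dim_col B) * B $$ (i mod dim_row B, j mod dim_col B))"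

text \<open>Indices run over \<open>{0..<d}\<close> instead of \<open>{1..d}\<close>. The graded sets are given level by level;
  matrix sizes \<open>n\<close> are always at least 1.\<close>

definition mat_tuples :: "nat \<Rightarrow> nat \<Rightarrow> complex mat list set" where
  "mat_tuples d n = {Z. length Z = d \<and> set Z \<subseteq> carrier_mat n n}"

definition tuple_norm :: "complex mat list \<Rightarrow> real" where
  "tuple_norm Z = Max (op_norm ` set Z)"

definition nc_polydisc :: "nat \<Rightarrow> nat \<Rightarrow> complex mat list set" where
  "nc_polydisc d n = {Z \<in> mat_tuples d n. tuple_norm Z < 1}"

datatype (nc_vars: 'v) nc_expr =
    Var 'v
  | One
  | Add "'v nc_expr" "'v nc_expr"
  | Mult "'v nc_expr" "'v nc_expr"
  | Scale complex "'v nc_expr"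
  | Inv "'v nc_expr"

text \<open>Evaluation at a tuple of \<open>n \<times> n\<close> matrices; the value is \<^const>\<open>None\<close> iff some inverse
  occurring in the expression does not exist.\<close>

primrec nc_eval :: "nat \<Rightarrow> complex mat list \<Rightarrow> nat nc_expr \<Rightarrow> complex mat option" where
  "nc_eval n Z (Var i) = Some (Z ! i)"
| "nc_eval n Z One = Some (1\<^sub>m n)"
| "nc_eval n Z (Add r s) =
     Option.bind (nc_eval n Z r) (\<lambda>X. Option.bind (nc_eval n Z s) (\<lambda>Y. Some (X + Y)))"
| "nc_eval n Z (Mult r s) =
     Option.bind (nc_eval n Z r) (\<lambda>X. Option.bind (nc_eval n Z s) (\<lambda>Y. Some (X * Y)))"
| "nc_eval n Z (Scale c r) = map_option (\<lambda>X. c \<cdot>\<^sub>m X) (nc_eval n Z r)"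
| "nc_eval n Z (Inv r) = Option.bind (nc_eval n Z r) mat_inverse"

definition nc_dom :: "nat \<Rightarrow> nat \<Rightarrow> nat nc_expr \<Rightarrow> complex mat list set" where
  "nc_dom d n r = {Z \<in> mat_tuples d n. nc_eval n Z r \<noteq> None}"

definition nc_exprs :: "nat \<Rightarrow> nat nc_expr set" where
  "nc_exprs d = {r. nc_vars r \<subseteq> {..<d} \<and> (\<exists>n\<ge>1. nc_dom d n r \<noteq> {})}"

definition nc_equiv :: "nat \<Rightarrow> (nat nc_expr \<times> nat nc_expr) set" where
  "nc_equiv d = {(r, s). r \<in> nc_exprs d \<and> s \<in> nc_exprs d \<and>
     (\<forall>n\<ge>1. \<forall>Z \<in> nc_dom d n r \<inter> nc_dom d n s. nc_eval n Z r = nc_eval n Z s)}"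

definition nc_rational_functions :: "nat \<Rightarrow> nat nc_expr set set" where
  "nc_rational_functions d = nc_exprs d // nc_equiv d"

text \<open>The domain of an nc rational function is the union of the domains of its representatives.
  Its value at a point of the domain does not depend on the representative: this, like the
  transitivity of \<^const>\<open>nc_equiv\<close>, holds because the domains of two expressions in
  \<^const>\<open>nc_exprs\<close> are Zariski open at every matrix size and both nonempty, hence dense, at all
  common multiples of two sizes where they are nonempty.\<close>

definition nc_fun_dom :: "nat \<Rightarrow> nat \<Rightarrow> nat nc_expr set \<Rightarrow> complex mat list set" where
  "nc_fun_dom d n f = (\<Union>r\<in>f. nc_dom d n r)"

definition nc_fun_eval :: "nat \<Rightarrow> nat \<Rightarrow> nat nc_expr set \<Rightarrow> complex mat list \<Rightarrow> complex mat" where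
  "nc_fun_eval d n f Z = (THE W. \<exists>r\<in>f. Z \<in> nc_dom d n r \<and> nc_eval n Z r = Some W)"

end

theory Submission
  imports Defs
begin

text \<open>Why the theorem holds. Near the origin, \<open>f\<close> is the transfer function of a finite system: a matrix
  \<open>T\<close> whose index \<open>0\<close> is the external channel and whose other indices are states, each state \<open>a\<close>
  carrying the number \<open>k a\<close> of a variable (its colour). A signal \<open>X\<close> that satisfies
  \<open>X a = Z (k a) (T X) a\<close> at all states has \<open>(T X) 0 = f(Z) (X 0)\<close>. Such a system is built by structural
  induction from any expression for \<open>f\<close> that is defined at \<open>0\<close> (\<open>realization_exists\<close>). It assigns a
  number \<open>word_coeff w\<close> to every word \<open>w\<close> in the variables, the coefficient of \<open>Z\<^sup>w\<close> in the power series
  of \<open>f\<close>. Two systems with the same coefficients have the same output for small \<open>Z\<close>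
  (\<open>output_series\<close>), hence wherever both sides are defined, as everything is rational along the line
  \<open>t Z\<close> (\<open>value_equals_output\<close>). So the task is to find a contractive matrix with prescribed
  coefficients.

  Take a system with these coefficients and the least number of states. Suppose that there is a
  positive semidefinite form \<open>E = L\<^sup>* L\<close>, block diagonal for the colours and equal to \<open>1\<close> on the
  external channel, with \<open>T\<^sup>* E T \<le> E\<close>. Then \<open>L T = T' L\<close> for a contraction \<open>T'\<close>
  (\<open>contraction_from_gram_inequality\<close>), and \<open>T'\<close> has the same coefficients because \<open>L\<close> respects the
  colours. The existence of \<open>E\<close> is a linear matrix inequality. If it fails, separation of convex
  sets gives a positive semidefinite \<open>P\<close>, the Gram matrix of a signal \<open>x\<close>, for which each coloured
  block of \<open>T x\<close> dominates the one of \<open>x\<close> while the energy in the external channel grows.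
  Domination of Gram matrices is exactly what is needed for contractions \<open>Z c\<close> that send
  \<open>(T x) a\<close> to \<open>x a\<close> for all states \<open>a\<close> of colour \<open>c\<close>.

  At this tuple \<open>f\<close> need not be given by the system. Therefore the signal is unrolled in time:
  starting from \<open>0\<close>, it is steered to \<open>x\<close> in finitely many steps, and \<open>x\<close> is then repeated
  \<open>m\<close> times. The contractions become the blocks next to the diagonal of a nilpotent tuple, at which
  the solution of the system is explicit. As \<open>f\<close> is contractive there, \<open>m\<close> times the gain of energy
  is at most the cost of steering, for every \<open>m\<close>; so there is no gain
  (\<open>finite_horizon\<close>, \<open>stationary_form_contractive\<close>). Steering is possible because a system with the least
  number of states is reachable (\<open>minimal_system_reachability_estimate\<close>). Reachability also bounds
  \<open>E\<close>, which turns approximate solutions of the inequality into an exact one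
  (\<open>exact_storage_form\<close>).

  Finally, contractivity of \<open>T'\<close> makes \<open>I - (D \<otimes> I) \<Delta>(Z)\<close> invertible on the whole polydisc, and
  rationality along \<open>t Z\<close> carries the formula from small \<open>t\<close> to \<open>t = 1\<close>. The values of \<open>f\<close> at a point do
  not depend on the representative, because any two points, brought to a common size, lie on a line
  along which all expressions are rational (\<open>nc_class_values_agree\<close>).\<close>

section \<open>Compactness and separation in finite dimensions\<close>

text \<open>Vectors are functions, and a finite set of indices stands for the dimension, so that dimensions can
  be chosen inside a proof.\<close>

lemma finite_family_convergent_subsequence:
  fixes x :: "nat \<Rightarrow> 'j \<Rightarrow> complex"
  assumes "finite J" and "\<And>j n. j \<in> J \<Longrightarrow> cmod (x n j) \<le> B j"
  shows "\<exists>r l. strict_mono (r :: nat \<Rightarrow> nat) \<and> (\<forall>j\<in>J. (\<lambda>n. x (r n) j) \<longlonglongrightarrow> l j)"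
  using assms
proof (induction J rule: finite_induct)
  case empty
  show ?case using strict_mono_id by auto
next
  case (insert i J)
  have "\<exists>r l. strict_mono (r :: nat \<Rightarrow> nat) \<and> (\<forall>j\<in>J. (\<lambda>n. x (r n) j) \<longlonglongrightarrow> l j)"
    using insert.IH insert.prems by simp
  then obtain r l where r: "strict_mono (r :: nat \<Rightarrow> nat)"
    and l: "\<And>j. j \<in> J \<Longrightarrow> (\<lambda>n. x (r n) j) \<longlonglongrightarrow> l j" by blast
  have "\<forall>n. cmod (x (r n) i) \<le> B i" using insert.prems by auto
  from Bolzano_Weierstrass_complex_disc[OF this]
  obtain s z where s: "strict_mono (s :: nat \<Rightarrow> nat)"
    and z: "\<forall>e>0. \<exists>N. \<forall>n\<ge>N. cmod (x (r (s n)) i - z) < e" by blast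
  have zl: "(\<lambda>n. x (r (s n)) i) \<longlonglongrightarrow> z" using z by (auto simp: LIMSEQ_iff)
  have "(\<lambda>n. x ((r \<circ> s) n) j) \<longlonglongrightarrow> (l(i := z)) j" if "j \<in> insert i J" for j
  proof (cases "j = i")
    case True then show ?thesis using zl by simp
  next
    case False
    then have "(\<lambda>n. x (r n) j) \<longlonglongrightarrow> l j" using l that by simp
    from LIMSEQ_subseq_LIMSEQ[OF this s] False show ?thesis by (simp add: o_def)
  qed
  then show ?case using strict_mono_o[OF r s] by blast
qed

text \<open>The functional is \<open>p\<close> itself, the point of least norm in the closure of \<open>C\<close>, found as a limit of a
  minimizing sequence: moving from \<open>p\<close> towards a point of \<open>C\<close> cannot decrease the norm.\<close>

lemma convex_separation_from_zero:
  fixes C :: "('j \<Rightarrow> complex) set"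
  assumes J: "finite J" and ne: "C \<noteq> {}"
    and conv: "\<And>c c' t. c \<in> C \<Longrightarrow> c' \<in> C \<Longrightarrow> 0 \<le> t \<Longrightarrow> t \<le> 1 \<Longrightarrow>
      (\<lambda>j. complex_of_real (1 - t) * c j + complex_of_real t * c' j) \<in> C"
    and dist: "\<And>c. c \<in> C \<Longrightarrow> m \<le> (\<Sum>j\<in>J. (cmod (c j))\<^sup>2)"
  shows "\<exists>p. \<forall>c\<in>C. m \<le> (\<Sum>j\<in>J. Re (cnj (p j) * c j))"
proof -
  define F where "F = (\<lambda>c :: 'j \<Rightarrow> complex. \<Sum>j\<in>J. (cmod (c j))\<^sup>2)"
  define \<mu> where "\<mu> = Inf (F ` C)"
  have F0: "F c \<ge> 0" for c unfolding F_def by (simp add: sum_nonneg)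
  have bdd: "bdd_below (F ` C)" using F0 by (meson bdd_belowI2)
  have mulow: "\<mu> \<le> F c" if "c \<in> C" for c unfolding \<mu>_def using bdd that by (simp add: cINF_lower)
  have mum: "m \<le> \<mu>" unfolding \<mu>_def using ne dist by (simp add: cINF_greatest F_def)
  have mu0: "0 \<le> \<mu>" unfolding \<mu>_def using ne F0 by (simp add: cINF_greatest)
  have "\<exists>c. c \<in> C \<and> F c < \<mu> + 1 / (real n + 1)" for n
  proof -
    have "Inf (F ` C) < \<mu> + 1 / (real n + 1)" unfolding \<mu>_def by simp
    then show ?thesis using cInf_lessD[of "F ` C"] ne by auto
  qed
  then obtain c where cC: "\<And>n. c n \<in> C" and cF: "\<And>n. F (c n) < \<mu> + 1 / (real n + 1)" by metis
  have "cmod (c n j) \<le> \<mu> + 2" if "j \<in> J" for n j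
  proof -
    have "(cmod (c n j))\<^sup>2 \<le> F (c n)" unfolding F_def using that J by (intro member_le_sum) auto
    also have "\<dots> \<le> \<mu> + 1" using cF[of n] by (smt (verit) divide_le_eq_1 of_nat_0_le_iff)
    also have "\<dots> \<le> (\<mu> + 2)\<^sup>2" using mu0 by (simp add: power2_eq_square algebra_simps)
    finally show ?thesis using mu0 by (simp add: power2_le_iff_abs_le)
  qed
  from finite_family_convergent_subsequence[OF J, of c, OF this]
  obtain r p where r: "strict_mono (r :: nat \<Rightarrow> nat)" and p: "\<And>j. j \<in> J \<Longrightarrow> (\<lambda>n. c (r n) j) \<longlonglongrightarrow> p j"
    by blast
  have limF: "(\<lambda>n. F (c (r n))) \<longlonglongrightarrow> F p"
    unfolding F_def by (intro tendsto_sum tendsto_power tendsto_norm p)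
  have "(\<lambda>n. \<mu> + 1 / (real n + 1)) \<longlonglongrightarrow> \<mu> + 0"
    by (intro tendsto_intros LIMSEQ_inverse_real_of_nat[unfolded inverse_eq_divide of_nat_Suc, simplified])
       (use LIMSEQ_inverse_real_of_nat in \<open>simp add: inverse_eq_divide add.commute\<close>)
  then have "(\<lambda>n. \<mu> + 1 / (real (r n) + 1)) \<longlonglongrightarrow> \<mu>"
    using LIMSEQ_subseq_LIMSEQ[OF _ r, of "\<lambda>n. \<mu> + 1 / (real n + 1)"] by (simp add: o_def)
  then have Fp: "F p \<le> \<mu>" using limF cF by (intro LIMSEQ_le[OF limF]) (auto intro: less_imp_le)
  have "m \<le> (\<Sum>j\<in>J. Re (cnj (p j) * d j))" if d: "d \<in> C" for d
  proof -
    define D where "D = (\<Sum>j\<in>J. Re (cnj (p j) * (d j - p j)))"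
    have D1: "D = (\<Sum>j\<in>J. Re (cnj (p j) * d j)) - F p"
      unfolding D_def F_def sum_subtractf[symmetric]
      by (intro sum.cong refl) (simp only: cmod_power2, simp add: power2_eq_square algebra_simps)
    have key: "0 \<le> 2 * D + t * F (\<lambda>j. d j - p j)" if t: "0 < t" "t \<le> 1" for t
    proof -
      have "\<mu> \<le> F (\<lambda>j. of_real (1 - t) * c (r n) j + of_real t * d j)" for n
        using conv[OF cC d] t by (intro mulow) auto
      moreover have "(\<lambda>n. F (\<lambda>j. of_real (1 - t) * c (r n) j + of_real t * d j)) \<longlonglongrightarrow>
          F (\<lambda>j. of_real (1 - t) * p j + of_real t * d j)"
        unfolding F_def by (intro tendsto_intros p)
      ultimately have "\<mu> \<le> F (\<lambda>j. of_real (1 - t) * p j + of_real t * d j)"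
        by (intro LIMSEQ_le_const) auto
      also have "\<dots> = F p + 2 * t * D + t\<^sup>2 * F (\<lambda>j. d j - p j)"
        unfolding F_def D_def sum_distrib_left sum.distrib[symmetric]
        by (intro sum.cong refl) (simp only: cmod_power2, simp add: power2_eq_square algebra_simps)
      finally have "0 \<le> t * (2 * D + t * F (\<lambda>j. d j - p j))"
        using Fp by (simp add: algebra_simps power2_eq_square)
      then show ?thesis using t by (simp add: zero_le_mult_iff)
    qed
    have "0 \<le> D"
    proof (rule ccontr)
      assume "\<not> 0 \<le> D"
      define K where "K = F (\<lambda>j. d j - p j)"
      have K: "K \<ge> 0" using F0 K_def by simp
      define t where "t = min 1 (- D / (K + 1))"
      have "D / (K + 1) < 0" using \<open>\<not> 0 \<le> D\<close> K by (intro divide_neg_pos) auto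
      then have t: "0 < t" "t \<le> 1" unfolding t_def by auto
      have "t * K \<le> - D / (K + 1) * K" using K unfolding t_def by (intro mult_right_mono) auto
      also have "\<dots> \<le> - D" using K \<open>\<not> 0 \<le> D\<close> by (simp add: field_simps)
      finally show False using key[OF t] \<open>\<not> 0 \<le> D\<close> unfolding K_def by linarith
    qed
    moreover have "F p \<ge> \<mu>" by (rule LIMSEQ_le_const[OF limF]) (use mulow cC in auto)
    ultimately show ?thesis using D1 mum by linarith
  qed
  then show ?thesis by blast
qed

section \<open>Positive semidefinite forms\<close>

definition herm_form :: "'i set \<Rightarrow> ('i \<Rightarrow> 'i \<Rightarrow> complex) \<Rightarrow> ('i \<Rightarrow> complex) \<Rightarrow> real" where
  "herm_form I P \<xi> = Re (\<Sum>a\<in>I. \<Sum>b\<in>I. \<xi> a * P a b * cnj (\<xi> b))"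

definition psd_form :: "'i set \<Rightarrow> ('i \<Rightarrow> 'i \<Rightarrow> complex) \<Rightarrow> bool" where
  "psd_form I P \<longleftrightarrow> (\<forall>a\<in>I. \<forall>b\<in>I. P b a = cnj (P a b)) \<and> (\<forall>\<xi>. 0 \<le> herm_form I P \<xi>)"

lemma herm_form_cong:
  "(\<And>a b. a \<in> I \<Longrightarrow> b \<in> I \<Longrightarrow> P a b = P' a b) \<Longrightarrow> (\<And>a. a \<in> I \<Longrightarrow> x a = x' a) \<Longrightarrow>
    herm_form I P x = herm_form I P' x'"
  unfolding herm_form_def by (intro arg_cong[where f = Re] sum.cong refl) simp

lemma herm_form_gram:
  assumes "\<And>a b. a \<in> I \<Longrightarrow> b \<in> I \<Longrightarrow> P a b = (\<Sum>c\<in>K. x a c * cnj (x b c))"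
  shows "herm_form I P \<xi> = (\<Sum>c\<in>K. (cmod (\<Sum>a\<in>I. \<xi> a * x a c))\<^sup>2)"
proof -
  have "(\<Sum>a\<in>I. \<Sum>b\<in>I. \<xi> a * P a b * cnj (\<xi> b)) = 
      (\<Sum>a\<in>I. \<Sum>b\<in>I. \<Sum>c\<in>K. (\<xi> a * x a c) * cnj (\<xi> b * x b c))"
    by (intro sum.cong refl) (simp add: assms sum_distrib_left sum_distrib_right ac_simps)
  also have "\<dots> = (\<Sum>a\<in>I. \<Sum>c\<in>K. \<Sum>b\<in>I. (\<xi> a * x a c) * cnj (\<xi> b * x b c))"
    by (intro sum.cong refl sum.swap)
  also have "\<dots> = (\<Sum>c\<in>K. \<Sum>a\<in>I. \<Sum>b\<in>I. (\<xi> a * x a c) * cnj (\<xi> b * x b c))"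
    by (rule sum.swap)
  also have "\<dots> = (\<Sum>c\<in>K. (\<Sum>a\<in>I. \<xi> a * x a c) * cnj (\<Sum>a\<in>I. \<xi> a * x a c))"
    by (simp add: sum_product)
  also have "\<dots> = of_real (\<Sum>c\<in>K. (cmod (\<Sum>a\<in>I. \<xi> a * x a c))\<^sup>2)"
    by (simp only: complex_norm_square of_real_sum)
  finally show ?thesis unfolding herm_form_def by simp
qed

lemma psd_form_gram:
  assumes "\<And>a b. a \<in> I \<Longrightarrow> b \<in> I \<Longrightarrow> P a b = (\<Sum>c\<in>K. x a c * cnj (x b c))"
  shows "psd_form I P"
proof -
  have "herm_form I P \<xi> \<ge> 0" for \<xi>
    by (subst herm_form_gram[of I P x K]) (auto simp: assms intro!: sum_nonneg)
  moreover have "P b a = cnj (P a b)" if "a \<in> I" "b \<in> I" for a b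
    using that by (simp add: assms mult.commute)
  ultimately show ?thesis unfolding psd_form_def by blast
qed

lemma herm_form_insert:
  assumes "finite I" "i \<notin> I" and herm: "\<And>b. b \<in> I \<Longrightarrow> P i b = cnj (P b i)"
  shows "herm_form (insert i I) P \<xi> = Re (P i i) * (cmod (\<xi> i))\<^sup>2
    + 2 * Re (cnj (\<xi> i) * (\<Sum>b\<in>I. \<xi> b * P b i)) + herm_form I P \<xi>"
proof -
  define g where "g = (\<Sum>b\<in>I. \<xi> b * P b i)"
  have g: "(\<Sum>b\<in>I. \<xi> i * P i b * cnj (\<xi> b)) = \<xi> i * cnj g"
    unfolding g_def by (simp add: sum_distrib_left herm ac_simps)
  have "(\<Sum>a\<in>insert i I. \<Sum>b\<in>insert i I. \<xi> a * P a b * cnj (\<xi> b)) =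
    \<xi> i * P i i * cnj (\<xi> i) + \<xi> i * cnj g + (g * cnj (\<xi> i) + (\<Sum>a\<in>I. \<Sum>b\<in>I. \<xi> a * P a b * cnj (\<xi> b)))"
    using assms(1,2) by (simp add: sum.distrib g sum_distrib_right g_def)
  moreover have "Re (\<xi> i * P i i * cnj (\<xi> i)) = Re (P i i) * (cmod (\<xi> i))\<^sup>2"
    by (simp only: cmod_power2, simp add: power2_eq_square algebra_simps)
  moreover have "Re (\<xi> i * cnj g) + Re (g * cnj (\<xi> i)) = 2 * Re (cnj (\<xi> i) * g)" by simp
  ultimately show ?thesis unfolding herm_form_def g_def by simp
qed

text \<open>Otherwise a large multiple of the basis vector \<open>i\<close>, added to the basis vector \<open>b\<close>, makes the form
  negative.\<close>

lemma psd_form_pivot_zero: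
  assumes "finite I" "i \<notin> I" and psd: "psd_form (insert i I) P" and z: "P i i = 0" and b: "b \<in> I"
  shows "P b i = 0"
proof (rule ccontr)
  assume nz: "P b i \<noteq> 0"
  define q where "q = herm_form I P (\<lambda>a. if a = b then 1 else 0)"
  define s where "s = (\<bar>q\<bar> + 1) / (cmod (P b i))\<^sup>2"
  define \<xi> where "\<xi> = (\<lambda>a. if a = i then - of_real s * P b i else if a = b then 1 else 0)"
  have bi: "b \<noteq> i" using assms by auto
  have "herm_form I P \<xi> = q" unfolding q_def using assms(2) by (intro herm_form_cong) (auto simp: \<xi>_def)
  moreover have "(\<Sum>c\<in>I. \<xi> c * P c i) = P b i"
  proof -
    have "(\<Sum>c\<in>I. \<xi> c * P c i) = (\<Sum>c\<in>I. if c = b then P b i else 0)"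
      using assms(2) by (intro sum.cong) (auto simp: \<xi>_def)
    then show ?thesis using b assms(1) by simp
  qed
  moreover have "herm_form (insert i I) P \<xi> \<ge> 0" using psd unfolding psd_form_def by blast
  moreover have "\<And>c. c \<in> I \<Longrightarrow> P i c = cnj (P c i)" using psd unfolding psd_form_def by blast
  then have "herm_form (insert i I) P \<xi> = Re (P i i) * (cmod (\<xi> i))\<^sup>2
      + 2 * Re (cnj (\<xi> i) * (\<Sum>b\<in>I. \<xi> b * P b i)) + herm_form I P \<xi>"
    by (rule herm_form_insert[OF assms(1,2)])
  ultimately have "0 \<le> 2 * Re (cnj (\<xi> i) * P b i) + q" using z by simp
  moreover have "Re (cnj (\<xi> i) * P b i) = - s * (cmod (P b i))\<^sup>2"
    unfolding \<xi>_def by (simp only: cmod_power2, simp add: power2_eq_square algebra_simps)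
  moreover have "s * (cmod (P b i))\<^sup>2 = \<bar>q\<bar> + 1" unfolding s_def using nz by simp
  ultimately show False by linarith
qed

text \<open>Cholesky factorization: eliminate one index and pass to the Schur complement. The factor inherits the
  block structure given by \<open>\<kappa>\<close> because every pivot row does. A zero pivot is harmless since
  division by \<open>0\<close> gives \<open>0\<close> and its row vanishes anyway.\<close>

lemma psd_form_factorization:
  fixes \<kappa> :: "'i \<Rightarrow> 'k"
  assumes "finite I" and "psd_form I P"
    and "\<And>a b. a \<in> I \<Longrightarrow> b \<in> I \<Longrightarrow> \<kappa> a \<noteq> \<kappa> b \<Longrightarrow> P a b = 0"
  shows "\<exists>x. (\<forall>a\<in>I. \<forall>b\<in>I. P a b = (\<Sum>c\<in>I. x a c * cnj (x b c))) \<and>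
    (\<forall>a\<in>I. \<forall>c\<in>I. \<kappa> a \<noteq> \<kappa> c \<longrightarrow> x a c = 0)"
  using assms
proof (induction I arbitrary: P rule: finite_induct)
  case empty
  then show ?case by simp
next
  case (insert i I)
  have herm: "P b a = cnj (P a b)" if "a \<in> insert i I" "b \<in> insert i I" for a b
    using insert.prems(1) that unfolding psd_form_def by blast
  have split_form: "herm_form (insert i I) P \<xi> = Re (P i i) * (cmod (\<xi> i))\<^sup>2
      + 2 * Re (cnj (\<xi> i) * (\<Sum>b\<in>I. \<xi> b * P b i)) + herm_form I P \<xi>" for \<xi>
    by (rule herm_form_insert[OF insert.hyps(1,2)], rule herm) auto
  have "cnj (P i i) = P i i" by (rule herm[symmetric]) auto
  then have Im0: "Im (P i i) = 0" by (metis complex_is_Real_iff Reals_cnj_iff)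
  define \<rho> where "\<rho> = Re (P i i)"
  have Pii: "P i i = of_real \<rho>" using Im0 by (simp add: \<rho>_def complex_eq_iff)
  have "0 \<le> herm_form (insert i I) P (\<lambda>a. if a = i then 1 else 0)"
    using insert.prems(1) unfolding psd_form_def by blast
  also have "\<dots> = \<rho> + herm_form I P (\<lambda>a. if a = i then 1 else 0)"
    using insert.hyps by (simp add: split_form \<rho>_def) (auto intro!: sum.neutral)
  also have "herm_form I P (\<lambda>a. if a = i then 1 else 0) = herm_form I P (\<lambda>a. 0)"
    using insert.hyps by (intro herm_form_cong) auto
  finally have \<rho>0: "\<rho> \<ge> 0" by (simp add: herm_form_def)
  define u where "u = (\<lambda>b. P b i / of_real (sqrt \<rho>))"
  have uu: "u b * cnj (u c) = P b i * P i c / of_real \<rho>" if "b \<in> insert i I" "c \<in> insert i I" for b c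
  proof -
    have "of_real (sqrt \<rho>) * of_real (sqrt \<rho>) = complex_of_real \<rho>"
      using \<rho>0 by (simp flip: of_real_mult)
    then show ?thesis using herm[of c i] that by (simp add: u_def)
  qed
  define P' where "P' = (\<lambda>b c. P b c - u b * cnj (u c))"
  have "psd_form I P'"
    unfolding psd_form_def
  proof (intro conjI ballI allI)
    fix a b assume "a \<in> I" "b \<in> I"
    then show "P' b a = cnj (P' a b)" using herm[of a b] by (simp add: P'_def)
  next
    fix \<xi>
    define g where "g = (\<Sum>b\<in>I. \<xi> b * P b i)"
    have "herm_form I P' \<xi> = herm_form I P \<xi> - herm_form I (\<lambda>b c. u b * cnj (u c)) \<xi>"
      unfolding herm_form_def P'_def by (simp add: algebra_simps sum_subtractf)
    also have "herm_form I (\<lambda>b c. u b * cnj (u c)) \<xi> = (cmod (\<Sum>b\<in>I. \<xi> b * u b))\<^sup>2"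
      using herm_form_gram[of I "\<lambda>b c. u b * cnj (u c)" "\<lambda>b _. u b" "{()}"] by simp
    also have "(\<Sum>b\<in>I. \<xi> b * u b) = g / of_real (sqrt \<rho>)"
      unfolding u_def g_def by (simp add: sum_divide_distrib)
    also have "(cmod (g / of_real (sqrt \<rho>)))\<^sup>2 = (cmod g)\<^sup>2 / \<rho>"
      using \<rho>0 by (simp add: norm_divide power_divide)
    finally have 1: "herm_form I P' \<xi> = herm_form I P \<xi> - (cmod g)\<^sup>2 / \<rho>" .
    show "0 \<le> herm_form I P' \<xi>"
    proof (cases "\<rho> = 0")
      case True
      have "0 \<le> herm_form (insert i I) P (\<xi>(i := 0))"
        using insert.prems(1) unfolding psd_form_def by blast
      also have "\<dots> = herm_form I P (\<xi>(i := 0))"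
        by (simp add: split_form)
      also have "\<dots> = herm_form I P \<xi>" using insert.hyps by (intro herm_form_cong) auto
      finally show ?thesis using 1 True by simp
    next
      case False
      define \<eta> where "\<eta> = \<xi>(i := - g / of_real \<rho>)"
      have e: "herm_form I P \<eta> = herm_form I P \<xi>"
        using insert.hyps by (intro herm_form_cong) (auto simp: \<eta>_def)
      have g': "(\<Sum>b\<in>I. \<eta> b * P b i) = g"
        unfolding g_def using insert.hyps by (intro sum.cong) (auto simp: \<eta>_def)
      have c1: "(cmod (\<eta> i))\<^sup>2 = (cmod g)\<^sup>2 / \<rho>\<^sup>2" by (simp add: \<eta>_def norm_divide power_divide)
      have c2: "Re (cnj (\<eta> i) * g) = - (cmod g)\<^sup>2 / \<rho>"
        by (simp only: cmod_power2, simp add: \<eta>_def power2_eq_square diff_divide_distrib add_divide_distrib)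
      have "0 \<le> herm_form (insert i I) P \<eta>"
        using insert.prems(1) unfolding psd_form_def by blast
      also have "\<dots> = \<rho> * ((cmod g)\<^sup>2 / \<rho>\<^sup>2) + 2 * (- (cmod g)\<^sup>2 / \<rho>) + herm_form I P \<xi>"
        by (simp only: split_form e g' c1 c2 \<rho>_def)
      also have "\<dots> = herm_form I P \<xi> - (cmod g)\<^sup>2 / \<rho>"
        using False by (simp add: power2_eq_square)
      finally show ?thesis using 1 by simp
    qed
  qed
  moreover have "P' a b = 0" if "a \<in> I" "b \<in> I" "\<kappa> a \<noteq> \<kappa> b" for a b
  proof -
    have "u a = 0 \<or> u b = 0" using insert.prems(2)[of a i] insert.prems(2)[of b i] that
      by (cases "\<kappa> a = \<kappa> i") (auto simp: u_def)
    then show ?thesis using insert.prems(2)[of a b] that by (auto simp: P'_def)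
  qed
  ultimately obtain x where x: "\<And>a b. a \<in> I \<Longrightarrow> b \<in> I \<Longrightarrow> P' a b = (\<Sum>c\<in>I. x a c * cnj (x b c))"
    and xk: "\<And>a c. a \<in> I \<Longrightarrow> c \<in> I \<Longrightarrow> \<kappa> a \<noteq> \<kappa> c \<Longrightarrow> x a c = 0"
    using insert.IH[of P'] by blast
  define y where "y = (\<lambda>a c. if c = i then u a else if a = i then 0 else x a c)"
  have Pu: "P a i = u a * cnj (u i)" if "a \<in> insert i I" for a
  proof (cases "\<rho> = 0")
    case True
    then have "P a i = 0"
      using that psd_form_pivot_zero[OF insert.hyps insert.prems(1)] Pii by auto
    then show ?thesis by (simp add: u_def)
  next
    case False
    then show ?thesis using uu[OF that, of i] Pii by simp
  qed
  have "P a b = (\<Sum>c\<in>insert i I. y a c * cnj (y b c))" if ab: "a \<in> insert i I" "b \<in> insert i I" for a b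
  proof -
    have split: "(\<Sum>c\<in>insert i I. y a c * cnj (y b c)) = u a * cnj (u b) + (\<Sum>c\<in>I. y a c * cnj (y b c))"
      using insert.hyps by (simp add: y_def)
    show ?thesis
    proof (cases "a = i \<or> b = i")
      case True
      then have "(\<Sum>c\<in>I. y a c * cnj (y b c)) = 0"
        using insert.hyps by (intro sum.neutral) (auto simp: y_def)
      moreover have "P a b = u a * cnj (u b)"
        using True Pu[OF ab(1)] Pu[OF ab(2)] herm[OF ab(2) ab(1)] by (auto simp: mult.commute)
      ultimately show ?thesis using split by simp
    next
      case False
      then have "(\<Sum>c\<in>I. y a c * cnj (y b c)) = P' a b"
        using ab x[of a b] insert.hyps by (auto simp: y_def intro!: sum.cong)
      then show ?thesis using split by (simp add: P'_def)
    qed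
  qed
  moreover have "y a c = 0" if "a \<in> insert i I" "c \<in> insert i I" "\<kappa> a \<noteq> \<kappa> c" for a c
    using that xk[of a c] insert.prems(2)[of a i] by (auto simp: y_def u_def)
  ultimately show ?case by (intro exI[of _ y]) blast
qed

section \<open>Contractions from Gram matrices\<close>

definition inner_on :: "'j set \<Rightarrow> ('j \<Rightarrow> complex) \<Rightarrow> ('j \<Rightarrow> complex) \<Rightarrow> complex" where
  "inner_on J x y = (\<Sum>j\<in>J. x j * cnj (y j))"

definition sqnorm :: "'j set \<Rightarrow> ('j \<Rightarrow> complex) \<Rightarrow> real" where
  "sqnorm J x = (\<Sum>j\<in>J. (cmod (x j))\<^sup>2)"

lemma sqnorm_nonneg: "0 \<le> sqnorm J x"
  unfolding sqnorm_def by (simp add: sum_nonneg)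

lemma sqnorm_cong: "(\<And>j. j \<in> J \<Longrightarrow> x j = y j) \<Longrightarrow> sqnorm J x = sqnorm J y"
  unfolding sqnorm_def by simp

lemma sqnorm_eq_0_iff: "finite J \<Longrightarrow> sqnorm J x = 0 \<longleftrightarrow> (\<forall>j\<in>J. x j = 0)"
  unfolding sqnorm_def by (simp add: sum_nonneg_eq_0_iff)

lemma sqnorm_scale: "sqnorm J (\<lambda>j. c * x j) = (cmod c)\<^sup>2 * sqnorm J x"
  unfolding sqnorm_def by (simp add: norm_mult power_mult_distrib sum_distrib_left)

lemma inner_on_self: "inner_on J x x = of_real (sqnorm J x)"
  unfolding inner_on_def sqnorm_def by (simp only: complex_norm_square of_real_sum)

lemma inner_on_commute: "inner_on J y x = cnj (inner_on J x y)"
  unfolding inner_on_def by (simp add: mult.commute)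

lemma inner_on_cong: "(\<And>j. j \<in> J \<Longrightarrow> x j = x' j) \<Longrightarrow> (\<And>j. j \<in> J \<Longrightarrow> y j = y' j) \<Longrightarrow> inner_on J x y = inner_on J x' y'"
  unfolding inner_on_def by simp

lemma inner_on_sum_left: "inner_on J (\<lambda>j. \<Sum>l\<in>L. \<beta> l * x l j) y = (\<Sum>l\<in>L. \<beta> l * inner_on J (x l) y)"
  unfolding inner_on_def by (simp add: sum_distrib_left sum_distrib_right mult.assoc sum.swap[of _ L J])

lemma inner_on_diff_left: "inner_on J (\<lambda>j. x j - z j) y = inner_on J x y - inner_on J z y"
  unfolding inner_on_def by (simp add: left_diff_distrib sum_subtractf)

lemma inner_on_scale: "inner_on J (\<lambda>j. c * x j) y = c * inner_on J x y" "inner_on J x (\<lambda>j. c * y j) = cnj c * inner_on J x y"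
  unfolding inner_on_def by (simp_all add: sum_distrib_left ac_simps)

lemma sum_kronecker_lessThan:
  "(l :: nat) < m \<Longrightarrow> (\<Sum>i<m. f i * (if i = l then 1 else (0 :: complex))) = f l"
  by (simp add: if_distrib cong: if_cong)

text \<open>Gram-Schmidt, recording the coefficients \<open>c\<close> that express the orthonormal vectors \<open>e\<close> by the given
  family: the same combinations will be formed with a second family.\<close>

lemma orthonormalization:
  fixes p :: "'f \<Rightarrow> 'j \<Rightarrow> complex"
  assumes J: "finite J" and F: "finite F"
  shows "\<exists>(m :: nat) c e. (\<forall>l j. e l j = (\<Sum>a\<in>F. c l a * p a j)) \<and>
    (\<forall>l<m. \<forall>l'<m. inner_on J (e l) (e l') = (if l = l' then 1 else 0)) \<and>
    (\<forall>a\<in>F. \<forall>j\<in>J. p a j = (\<Sum>l<m. inner_on J (p a) (e l) * e l j))"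
  using F
proof (induction F rule: finite_induct)
  case empty
  show ?case by (intro exI[of _ 0] exI[of _ "\<lambda>_ _. 0"]) simp
next
  case (insert a F)
  then obtain m c e where e: "\<And>l j. e l j = (\<Sum>b\<in>F. c l b * p b j)"
    and on: "\<And>l l'. l < (m :: nat) \<Longrightarrow> l' < m \<Longrightarrow> inner_on J (e l) (e l') = (if l = l' then 1 else 0)"
    and ex: "\<And>b j. b \<in> F \<Longrightarrow> j \<in> J \<Longrightarrow> p b j = (\<Sum>l<m. inner_on J (p b) (e l) * e l j)"
    by blast
  define r where "r = (\<lambda>j. p a j - (\<Sum>l<m. inner_on J (p a) (e l) * e l j))"
  have rperp: "inner_on J r (e l) = 0" if "l < m" for l
    unfolding r_def inner_on_diff_left inner_on_sum_left using that
    by (simp add: on sum_kronecker_lessThan[of l m "\<lambda>i. inner_on J (p a) (e i)"])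
  show ?case
  proof (cases "sqnorm J r = 0")
    case True
    define c' where "c' = (\<lambda>l b. if b = a then 0 else c l b)"
    have "e l j = (\<Sum>b\<in>insert a F. c' l b * p b j)" for l j
      using insert.hyps unfolding c'_def e by (simp, intro sum.cong) auto
    moreover have "p a j = (\<Sum>l<m. inner_on J (p a) (e l) * e l j)" if "j \<in> J" for j
      using True that J by (simp add: sqnorm_eq_0_iff r_def)
    ultimately show ?thesis using on ex
      by (intro exI[of _ m] exI[of _ c'] exI[of _ e]) blast
  next
    case False
    define \<nu> where "\<nu> = sqrt (sqnorm J r)"
    have \<nu>: "\<nu> > 0" "of_real (sqnorm J r) = complex_of_real \<nu> * of_real \<nu>"
      using False sqnorm_nonneg[of J r] unfolding \<nu>_def by (simp_all flip: of_real_mult)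
    define e' where "e' = e(m := (\<lambda>j. (1 / of_real \<nu>) * r j))"
    define c' where "c' = (\<lambda>l b. if l = m then (if b = a then 1 else - (\<Sum>l<m. inner_on J (p a) (e l) * c l b)) / of_real \<nu>
       else if b = a then 0 else c l b)"
    have e'eq: "e' l j = (\<Sum>b\<in>insert a F. c' l b * p b j)" for l j
    proof (cases "l = m")
      case True
      have "(\<Sum>l<m. inner_on J (p a) (e l) * e l j) = (\<Sum>b\<in>F. (\<Sum>l<m. inner_on J (p a) (e l) * c l b) * p b j)"
        unfolding e sum_distrib_left sum_distrib_right mult.assoc by (rule sum.swap)
      moreover have "(\<Sum>b\<in>F. c' l b * p b j) = - (\<Sum>b\<in>F. (\<Sum>l<m. inner_on J (p a) (e l) * c l b) * p b j) / of_real \<nu>"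
        using True insert.hyps unfolding c'_def sum_divide_distrib sum_negf[symmetric]
        by (intro sum.cong) (auto simp: sum_negf)
      ultimately show ?thesis using True insert.hyps
        by (simp add: e'_def r_def c'_def diff_divide_distrib)
    next
      case False
      then show ?thesis using insert.hyps unfolding c'_def e'_def by (simp add: e, intro sum.cong) auto
    qed
    have e'm: "inner_on J x (e' m) = inner_on J x r / of_real \<nu>" for x
      using inner_on_scale(2)[of J x "1 / complex_of_real \<nu>" r] by (simp add: e'_def)
    have e'o: "e' l = e l" if "l < m" for l using that by (simp add: e'_def)
    have me': "inner_on J (e' m) x = inner_on J r x / of_real \<nu>" for x
      using inner_on_scale(1)[of J "1 / complex_of_real \<nu>" r x] by (simp add: e'_def)
    have mm: "inner_on J (e' m) (e' m) = 1" unfolding e'm me' using \<nu> by (simp add: inner_on_self)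
    have ml: "inner_on J (e' m) (e l) = 0" "inner_on J (e l) (e' m) = 0" if "l < m" for l
      using rperp[OF that] inner_on_commute[of J r "e l"]
      unfolding e'm me' by auto
    have "inner_on J (e' l) (e' l') = (if l = l' then 1 else 0)" if "l < Suc m" "l' < Suc m" for l l'
      using that on[of l l'] mm ml[of l] ml[of l'] by (auto simp: less_Suc_eq e'o)
    moreover have "p b j = (\<Sum>l<Suc m. inner_on J (p b) (e' l) * e' l j)"
      if b: "b \<in> insert a F" and j: "j \<in> J" for b j
    proof (cases "b = a")
      case True
      have pa: "inner_on J (p a) r = of_real (sqnorm J r)"
      proof -
        have "inner_on J (p a) r = inner_on J r r + inner_on J (\<lambda>j. \<Sum>l<m. inner_on J (p a) (e l) * e l j) r"
          unfolding r_def[symmetric] by (simp add: r_def inner_on_diff_left)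
        also have "inner_on J (\<lambda>j. \<Sum>l<m. inner_on J (p a) (e l) * e l j) r = 0"
          unfolding inner_on_sum_left using rperp inner_on_commute[of J _ r] by (intro sum.neutral) simp
        finally show ?thesis by (simp add: inner_on_self)
      qed
      have "inner_on J (p a) (e' m) * e' m j = r j"
        unfolding e'm pa using \<nu> by (simp add: e'_def)
      then show ?thesis using True by (simp add: e'o r_def)
    next
      case False
      then have bF: "b \<in> F" using b by simp
      have "inner_on J (p b) (e' m) = inner_on J (\<lambda>j. \<Sum>l<m. inner_on J (p b) (e l) * e l j) (e' m)"
        using ex[OF bF] by (intro inner_on_cong) auto
      also have "\<dots> = 0" unfolding inner_on_sum_left using ml by (intro sum.neutral) simp
      finally show ?thesis using ex[OF bF j] by (simp add: e'o)
    qed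
    ultimately show ?thesis using e'eq
      by (intro exI[of _ "Suc m"] exI[of _ c'] exI[of _ e']) blast
  qed
qed

text \<open>The inequality says that \<open>p a \<mapsto> q a\<close> extends to a well-defined contraction of the span of the
  \<open>p a\<close>; it is extended by \<open>0\<close> to the orthogonal complement. It produces both the matrices at which \<open>f\<close> is
  tested and the contractive system in the end.\<close>

lemma contraction_from_gram_inequality:
  fixes p q :: "'f \<Rightarrow> 'j \<Rightarrow> complex"
  assumes J: "finite J" and F: "finite F"
    and le: "\<And>\<xi>. sqnorm J (\<lambda>j. \<Sum>a\<in>F. \<xi> a * q a j) \<le> sqnorm J (\<lambda>j. \<Sum>a\<in>F. \<xi> a * p a j)"
  shows "\<exists>Z. (\<forall>a\<in>F. \<forall>i\<in>J. (\<Sum>j\<in>J. Z i j * p a j) = q a i) \<and>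
    (\<forall>v. sqnorm J (\<lambda>i. \<Sum>j\<in>J. Z i j * v j) \<le> sqnorm J v)"
proof -
  obtain m c e where e: "\<And>l j. e l j = (\<Sum>a\<in>F. c l a * p a j)"
    and on: "\<And>l l'. l < (m :: nat) \<Longrightarrow> l' < m \<Longrightarrow> inner_on J (e l) (e l') = (if l = l' then 1 else 0)"
    and ex: "\<And>b j. b \<in> F \<Longrightarrow> j \<in> J \<Longrightarrow> p b j = (\<Sum>l<m. inner_on J (p b) (e l) * e l j)"
    using orthonormalization[OF J F, of p] by blast
  define Z where "Z = (\<lambda>i j. \<Sum>l<m. (\<Sum>a\<in>F. c l a * q a i) * cnj (e l j))"
  define \<xi> where "\<xi> = (\<lambda>v a. \<Sum>l<m. inner_on J v (e l) * c l a)"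
  have Zv: "(\<Sum>j\<in>J. Z i j * v j) = (\<Sum>a\<in>F. \<xi> v a * q a i)" for i v
  proof -
    have "(\<Sum>j\<in>J. Z i j * v j) = (\<Sum>l<m. (\<Sum>a\<in>F. c l a * q a i) * inner_on J v (e l))"
      unfolding Z_def inner_on_def sum_distrib_left sum_distrib_right
      by (subst sum.swap) (simp add: ac_simps)
    also have "\<dots> = (\<Sum>a\<in>F. \<xi> v a * q a i)"
      unfolding \<xi>_def sum_distrib_right by (subst sum.swap) (simp add: ac_simps)
    finally show ?thesis .
  qed
  have pv: "(\<Sum>a\<in>F. \<xi> v a * p a i) = (\<Sum>l<m. inner_on J v (e l) * e l i)" for i v
    unfolding \<xi>_def e sum_distrib_right sum_distrib_left by (subst sum.swap) (simp add: ac_simps)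
  have "sqnorm J (\<lambda>i. \<Sum>j\<in>J. Z i j * v j) \<le> sqnorm J v" for v
  proof -
    \<comment> \<open>the orthogonal projection of \<open>v\<close> onto the span of the \<open>p a\<close>; the estimate is Bessel's inequality\<close>
    define w where "w = (\<lambda>i. \<Sum>l<m. inner_on J v (e l) * e l i)"
    have we: "inner_on J w (e l) = inner_on J v (e l)" if "l < m" for l
      unfolding w_def inner_on_sum_left using that
      by (simp add: on sum_kronecker_lessThan[of l m "\<lambda>i. inner_on J v (e i)"])
    have ww: "inner_on J w x = (\<Sum>l<m. inner_on J v (e l) * inner_on J (e l) x)" for x unfolding w_def inner_on_sum_left ..
    have "inner_on J w w = inner_on J w v"
      unfolding ww using we inner_on_commute[of J _ w] inner_on_commute[of J _ v] by simp
    moreover have "inner_on J w v = inner_on J v w" using \<open>inner_on J w w = inner_on J w v\<close> inner_on_commute[of J v w]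
      by (metis complex_cnj_complex_of_real inner_on_self)
    moreover have "inner_on J (\<lambda>j. v j - w j) (\<lambda>j. v j - w j) = inner_on J v v - inner_on J v w - (inner_on J w v - inner_on J w w)"
      unfolding inner_on_def by (simp add: algebra_simps sum_subtractf sum.distrib)
    ultimately have "inner_on J (\<lambda>j. v j - w j) (\<lambda>j. v j - w j) = inner_on J v v - inner_on J w w" by simp
    then have "sqnorm J w \<le> sqnorm J v"
      unfolding inner_on_self using sqnorm_nonneg[of J "\<lambda>j. v j - w j"]
      by (metis of_real_diff of_real_eq_iff diff_ge_0_iff_ge)
    then show ?thesis unfolding Zv using le[of "\<xi> v"] unfolding pv w_def by linarith
  qed
  moreover have "(\<Sum>j\<in>J. Z i j * p a j) = q a i" if a: "a \<in> F" and i: "i \<in> J" for a i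
  proof -
    \<comment> \<open>a linear relation between the \<open>p b\<close>, and hence between the \<open>q b\<close>\<close>
    define \<zeta> where "\<zeta> = (\<lambda>b. \<xi> (p a) b - (if b = a then 1 else 0))"
    have sub: "(\<Sum>b\<in>F. \<zeta> b * z b) = (\<Sum>b\<in>F. \<xi> (p a) b * z b) - z a" for z :: "'f \<Rightarrow> complex"
    proof -
      have "(\<Sum>b\<in>F. (if b = a then 1 else 0) * z b) = (\<Sum>b\<in>F. if b = a then z b else 0)"
        by (intro sum.cong) auto
      then show ?thesis unfolding \<zeta>_def left_diff_distrib sum_subtractf using a F by simp
    qed
    have "sqnorm J (\<lambda>j. \<Sum>b\<in>F. \<zeta> b * p b j) = 0"
      unfolding sub pv using J ex[OF a] by (simp add: sqnorm_eq_0_iff)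
    then have "sqnorm J (\<lambda>j. \<Sum>b\<in>F. \<zeta> b * q b j) = 0" using le[of \<zeta>] sqnorm_nonneg by (metis order_antisym)
    then have "(\<Sum>b\<in>F. \<zeta> b * q b i) = 0" using J i by (simp add: sqnorm_eq_0_iff)
    then show ?thesis unfolding Zv sub by simp
  qed
  ultimately show ?thesis by (intro exI[of _ Z]) blast
qed

section \<open>Systems and their coefficients\<close>

text \<open>A system consists of a finite set \<open>S\<close> of states with \<open>0 \<notin> S\<close>, a matrix \<open>T\<close> on \<open>insert 0 S\<close>, where index
  \<open>0\<close> is the external channel, and a colouring \<open>k\<close> of the states by variables. In block form \<open>T 0 0\<close>,
  \<open>T 0 b\<close>, \<open>T a 0\<close>, \<open>T a b\<close> are the entries of \<open>A\<close>, \<open>B\<close>, \<open>C\<close>, \<open>D\<close>. Keeping \<open>S\<close> an arbitrary finite set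
  allows removing single states.\<close>

definition apply_sys :: "nat set \<Rightarrow> (nat \<Rightarrow> nat \<Rightarrow> complex) \<Rightarrow> (nat \<Rightarrow> complex) \<Rightarrow> nat \<Rightarrow> complex" where
  "apply_sys S T x a = (\<Sum>b\<in>insert 0 S. T a b * x b)"

text \<open>The functional \<open>x \<mapsto> \<xi> (T x)\<close>.\<close>

definition coapply_sys :: "nat set \<Rightarrow> (nat \<Rightarrow> nat \<Rightarrow> complex) \<Rightarrow> (nat \<Rightarrow> complex) \<Rightarrow> nat \<Rightarrow> complex" where
  "coapply_sys S T \<xi> b = (\<Sum>a\<in>insert 0 S. \<xi> a * T a b)"

definition input_vec :: "nat \<Rightarrow> complex" where
  "input_vec a = (if a = 0 then 1 else 0)"

text \<open>The vector of states created by a unit input along the word \<open>w\<close>, whose first letter acts last. The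
  empty word gives the input itself, so that input and states need no separate treatment.\<close>

fun reach :: "nat set \<Rightarrow> (nat \<Rightarrow> nat \<Rightarrow> complex) \<Rightarrow> (nat \<Rightarrow> nat) \<Rightarrow> nat list \<Rightarrow> nat \<Rightarrow> complex" where
  "reach S T k [] = input_vec"
| "reach S T k (c # w) = (\<lambda>a. if a \<in> S \<and> k a = c then apply_sys S T (reach S T k w) a else 0)"

definition word_coeff :: "nat set \<Rightarrow> (nat \<Rightarrow> nat \<Rightarrow> complex) \<Rightarrow> (nat \<Rightarrow> nat) \<Rightarrow> nat list \<Rightarrow> complex" where
  "word_coeff S T k w = apply_sys S T (reach S T k w) 0"

definition is_system :: "nat \<Rightarrow> nat set \<Rightarrow> (nat \<Rightarrow> nat) \<Rightarrow> bool" where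
  "is_system d S k \<longleftrightarrow> finite S \<and> 0 \<notin> S \<and> k ` S \<subseteq> {..<d}"

definition coloured :: "nat set \<Rightarrow> (nat \<Rightarrow> nat) \<Rightarrow> nat \<Rightarrow> (nat \<Rightarrow> complex) \<Rightarrow> bool" where
  "coloured S k c \<xi> \<longleftrightarrow> (\<forall>a. \<xi> a \<noteq> 0 \<longrightarrow> a \<in> S \<and> k a = c)"

text \<open>The property of the system that contractivity of \<open>f\<close> at nilpotent tuples yields. Here \<open>P t\<close> is the Gram
  matrix of the signal at time \<open>t\<close>. It starts without state energy, and the condition on each colour
  says that the state at time \<open>Suc t\<close> can be obtained from the one prescribed by \<open>T\<close> at time \<open>t\<close> by
  contractions, one for each variable. The conclusion compares output and input energy.\<close>

definition finite_horizon_contractive ::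
  "nat \<Rightarrow> nat set \<Rightarrow> (nat \<Rightarrow> nat \<Rightarrow> complex) \<Rightarrow> (nat \<Rightarrow> nat) \<Rightarrow> bool" where
  "finite_horizon_contractive d S T k \<longleftrightarrow>
    (\<forall>m P. (\<forall>t\<le>m. psd_form (insert 0 S) (P t)) \<longrightarrow>
      (\<forall>\<xi>. \<xi> 0 = 0 \<longrightarrow> herm_form (insert 0 S) (P 0) \<xi> = 0) \<longrightarrow>
      (\<forall>t<m. \<forall>c<d. \<forall>\<xi>. coloured S k c \<xi> \<longrightarrow>
        herm_form (insert 0 S) (P (Suc t)) \<xi> \<le> herm_form (insert 0 S) (P t) (coapply_sys S T \<xi>)) \<longrightarrow>
      (\<Sum>t\<le>m. herm_form (insert 0 S) (P t) (T 0)) \<le> (\<Sum>t\<le>m. herm_form (insert 0 S) (P t) input_vec))"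

lemma reach_support: "w \<noteq> [] \<Longrightarrow> a \<notin> S \<Longrightarrow> reach S T k w a = 0"
  by (cases w) auto

lemma reach_outside_alphabet:
  assumes "k ` S \<subseteq> {..<d}" "\<not> set w \<subseteq> {..<d}"
  shows "reach S T k w a = 0"
  using assms(2)
proof (induction w arbitrary: a)
  case (Cons c w)
  show ?case
  proof (cases "c < d")
    case True
    then have "\<And>b. reach S T k w b = 0" using Cons by simp
    then show ?thesis by (simp add: apply_sys_def)
  next
    case False
    then show ?thesis using assms(1) by auto
  qed
qed simp

text \<open>On reachable vectors the coordinate \<open>a\<close> is a function of the others, so it can be substituted away.\<close>

lemma eliminate_state:
  assumes S: "finite S" "0 \<notin> S" and a: "a \<in> S"
    and dep: "\<And>w. reach S T k w a = (\<Sum>b\<in>S - {a}. s b * reach S T k w b)"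
  shows "\<exists>T'. \<forall>w. word_coeff (S - {a}) T' k w = word_coeff S T k w"
proof -
  \<comment> \<open>each use of coordinate \<open>a\<close> is replaced by its expression through the remaining states\<close>
  define T' where "T' = (\<lambda>p q. T p q + (if q = 0 then 0 else T p a * s q))"
  have a0: "a \<noteq> 0" using a S(2) by metis
  have app: "apply_sys (S - {a}) T' x p = apply_sys S T (reach S T k w) p"
    if x: "\<And>b. b \<in> insert 0 (S - {a}) \<Longrightarrow> x b = reach S T k w b" for x w p
  proof -
    have "apply_sys (S - {a}) T' x p = T p 0 * reach S T k w 0 + (\<Sum>b\<in>S - {a}. T' p b * reach S T k w b)"
      using S x by (simp add: apply_sys_def T'_def)
    also have "(\<Sum>b\<in>S - {a}. T' p b * reach S T k w b) =
        (\<Sum>b\<in>S - {a}. T p b * reach S T k w b + T p a * (s b * reach S T k w b))"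
      using S by (intro sum.cong) (auto simp: T'_def algebra_simps)
    also have "\<dots> = (\<Sum>b\<in>S - {a}. T p b * reach S T k w b) + T p a * reach S T k w a"
      by (simp add: sum.distrib dep[of w] sum_distrib_left)
    also have "\<dots> = (\<Sum>b\<in>S. T p b * reach S T k w b)"
      using S a by (simp add: sum.remove[of S a] add.commute)
    finally show ?thesis using S by (simp add: apply_sys_def)
  qed
  have r: "b \<in> insert 0 (S - {a}) \<Longrightarrow> reach (S - {a}) T' k w b = reach S T k w b" for w b
    using app S by (induction w arbitrary: b) auto
  show ?thesis unfolding word_coeff_def using app[OF r] by blast
qed

definition minimal_system :: "nat \<Rightarrow> nat set \<Rightarrow> (nat \<Rightarrow> nat \<Rightarrow> complex) \<Rightarrow> (nat \<Rightarrow> nat) \<Rightarrow> bool" where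
  "minimal_system d S T k \<longleftrightarrow> is_system d S k \<and>
    (\<forall>S' T' k'. is_system d S' k' \<longrightarrow> (\<forall>w. word_coeff S' T' k' w = word_coeff S T k w) \<longrightarrow> card S \<le> card S')"

lemma minimal_system_exists:
  assumes "is_system d S k"
  shows "\<exists>S' T' k'. minimal_system d S' T' k' \<and> (\<forall>w. word_coeff S' T' k' w = word_coeff S T k w)"
proof -
  define A where "A = {(S', T', k'). is_system d S' k' \<and> (\<forall>w. word_coeff S' T' k' w = word_coeff S T k w)}"
  have "(S, T, k) \<in> A" using assms by (simp add: A_def)
  then obtain x where x: "x \<in> A" and m: "\<And>y. y \<in> A \<Longrightarrow> card (fst x) \<le> card (fst y)"
    using ex_has_least_nat[of "\<lambda>x. x \<in> A" _ "\<lambda>x. card (fst x)"] by blast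
  obtain S' T' k' where xe: "x = (S', T', k')" by (cases x)
  have "minimal_system d S' T' k'"
    unfolding minimal_system_def
  proof (intro conjI allI impI)
    show "is_system d S' k'" using x xe by (simp add: A_def)
  next
    fix S'' T'' k'' assume "is_system d S'' k''" "\<forall>w. word_coeff S'' T'' k'' w = word_coeff S' T' k' w"
    then have "(S'', T'', k'') \<in> A" using x xe by (simp add: A_def)
    from m[OF this] show "card S' \<le> card S''" by (simp add: xe)
  qed
  then show ?thesis using x xe by (auto simp: A_def)
qed

text \<open>A functional \<open>\<xi>\<close> that vanishes on all reachable vectors may be restricted to one colour, as reachable
  vectors have a single colour; it then expresses a coordinate by the others, contradicting
  minimality.\<close>

lemma minimal_system_reachable:
  assumes min: "minimal_system d S T k" and a: "a \<in> S" "\<xi> a \<noteq> 0"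
  shows "\<exists>w. w \<noteq> [] \<and> set w \<subseteq> {..<d} \<and> (\<Sum>b\<in>S. \<xi> b * reach S T k w b) \<noteq> 0"
proof (rule ccontr)
  assume "\<not> ?thesis"
  then have z: "(\<Sum>b\<in>S. \<xi> b * reach S T k w b) = 0" if "w \<noteq> []" "set w \<subseteq> {..<d}" for w
    using that by blast
  have S: "finite S" "0 \<notin> S" "k ` S \<subseteq> {..<d}" using min by (auto simp: minimal_system_def is_system_def)
  define \<eta> where "\<eta> = (\<lambda>b. if k b = k a then \<xi> b else 0)"
  have z': "(\<Sum>b\<in>S. \<eta> b * reach S T k w b) = 0" for w
  proof (cases "w \<noteq> [] \<and> set w \<subseteq> {..<d} \<and> hd w = k a")
    case True
    then obtain v where v: "w = k a # v" by (cases w) auto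
    have "(\<Sum>b\<in>S. \<eta> b * reach S T k w b) = (\<Sum>b\<in>S. \<xi> b * reach S T k w b)"
      unfolding v \<eta>_def by (intro sum.cong) auto
    then show ?thesis using z True by simp
  next
    case False
    have "\<eta> b * reach S T k w b = 0" if "b \<in> S" for b
    proof (cases w)
      case Nil
      then show ?thesis using that S by (auto simp: input_vec_def)
    next
      case (Cons c v)
      then show ?thesis
        using False reach_outside_alphabet[OF S(3), of w] by (cases "set w \<subseteq> {..<d}") (auto simp: \<eta>_def)
    qed
    then show ?thesis by (intro sum.neutral) auto
  qed
  have "reach S T k w a = (\<Sum>b\<in>S - {a}. (- \<eta> b / \<eta> a) * reach S T k w b)" for w
  proof -
    have "\<eta> a \<noteq> 0" using a by (simp add: \<eta>_def)
    then have "reach S T k w a = \<eta> a * reach S T k w a / \<eta> a" by simp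
    moreover have "\<eta> a * reach S T k w a + (\<Sum>b\<in>S - {a}. \<eta> b * reach S T k w b) = 0"
      using z'[of w] S a by (simp add: sum.remove[of S a])
    moreover have "(\<Sum>b\<in>S - {a}. (- \<eta> b / \<eta> a) * reach S T k w b) =
        - (\<Sum>b\<in>S - {a}. \<eta> b * reach S T k w b) / \<eta> a"
      by (simp add: sum_divide_distrib sum_negf)
    ultimately show ?thesis by (simp only: add_eq_0_iff2)
  qed
  from eliminate_state[OF S(1,2) a(1) this] obtain T' where "\<forall>w. word_coeff (S - {a}) T' k w = word_coeff S T k w"
    by blast
  moreover have "is_system d (S - {a}) k" using S by (auto simp: is_system_def)
  ultimately have "card S \<le> card (S - {a})" using min unfolding minimal_system_def by blast
  then show False using S a by (metis card_Diff1_less not_less)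
qed

text \<open>A quantitative form of reachability. It controls both the cost of steering to a given state and the
  size of a positive form whose values on reachable vectors are bounded.\<close>

definition reachable_by :: "nat \<Rightarrow> nat set \<Rightarrow> (nat \<Rightarrow> nat \<Rightarrow> complex) \<Rightarrow> (nat \<Rightarrow> nat) \<Rightarrow> nat list set \<Rightarrow> real \<Rightarrow> bool" where
  "reachable_by d S T k W C \<longleftrightarrow> finite W \<and> [] \<notin> W \<and> 0 \<le> C \<and>
    (\<forall>\<xi>. \<forall>a\<in>S. (cmod (\<xi> a))\<^sup>2 \<le> C * (\<Sum>w\<in>W. (cmod (\<Sum>b\<in>S. \<xi> b * reach S T k w b))\<^sup>2))"

text \<open>By compactness of the unit sphere: otherwise there are unit functionals that are smaller and smaller on
  all short words, and a limit of them vanishes on all reachable vectors.\<close>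

lemma minimal_system_reachability_estimate:
  assumes min: "minimal_system d S T k"
  shows "\<exists>W C. reachable_by d S T k W C"
proof (rule ccontr)
  assume neg: "\<not> ?thesis"
  have S: "finite S" using min by (auto simp: minimal_system_def is_system_def)
  define W where "W = (\<lambda>n. {w. w \<noteq> [] \<and> set w \<subseteq> {..<d} \<and> length w \<le> n})"
  have finW: "finite (W n)" for n
    by (rule finite_subset[OF _ finite_lists_length_le[of "{..<d}" n]]) (auto simp: W_def)
  define V where "V = (\<lambda>\<xi> w. (cmod (\<Sum>b\<in>S. \<xi> b * reach S T k w b))\<^sup>2)"
  have "\<exists>\<xi> a. a \<in> S \<and> real (Suc n) * (\<Sum>w\<in>W n. V \<xi> w) < (cmod (\<xi> a))\<^sup>2" for n
  proof -
    have "\<not> reachable_by d S T k (W n) (real (Suc n))" using neg by blast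
    then show ?thesis unfolding reachable_by_def using finW by (auto simp: W_def V_def not_le)
  qed
  then obtain \<xi> a where \<xi>: "\<And>n. a n \<in> S" "\<And>n. real (Suc n) * (\<Sum>w\<in>W n. V (\<xi> n) w) < (cmod (\<xi> n (a n)))\<^sup>2"
    by metis
  define \<nu> where "\<nu> = (\<lambda>n. sqnorm S (\<xi> n))"
  have le\<nu>: "(cmod (\<xi> n b))\<^sup>2 \<le> \<nu> n" if "b \<in> S" for n b
    unfolding \<nu>_def sqnorm_def using S that by (intro member_le_sum) auto
  have V0: "V x w \<ge> 0" for x w by (simp add: V_def)
  have \<nu>0: "\<nu> n > 0" for n
  proof -
    have "0 \<le> real (Suc n) * (\<Sum>w\<in>W n. V (\<xi> n) w)" by (simp add: V0 sum_nonneg)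
    then show ?thesis using \<xi>(2)[of n] le\<nu>[OF \<xi>(1), of n n] by linarith
  qed
  define x where "x = (\<lambda>n b. of_real (1 / sqrt (\<nu> n)) * \<xi> n b)"
  have "cmod (of_real (1 / sqrt (\<nu> n)) :: complex) = 1 / sqrt (\<nu> n)" for n
    using \<nu>0[of n] by (simp add: norm_divide)
  then have cm: "(cmod (of_real (1 / sqrt (\<nu> n)) :: complex))\<^sup>2 = 1 / \<nu> n" for n
    using \<nu>0[of n] by (simp add: power_divide)
  have x1: "sqnorm S (x n) = 1" for n
    unfolding x_def sqnorm_scale cm using \<nu>0[of n] by (simp add: \<nu>_def)
  have xb: "cmod (x n b) \<le> 1" if "b \<in> S" for n b
  proof -
    have "(cmod (x n b))\<^sup>2 \<le> sqnorm S (x n)" unfolding sqnorm_def using S that by (intro member_le_sum) auto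
    then have "(cmod (x n b))\<^sup>2 \<le> 1\<^sup>2" unfolding x1 by simp
    then show ?thesis by (rule power2_le_imp_le) simp
  qed
  have Vx: "V (x n) w = V (\<xi> n) w / \<nu> n" for n w
  proof -
    have "(\<Sum>b\<in>S. x n b * reach S T k w b) = of_real (1 / sqrt (\<nu> n)) * (\<Sum>b\<in>S. \<xi> n b * reach S T k w b)"
      unfolding x_def by (simp add: sum_distrib_left mult.assoc)
    then show ?thesis unfolding V_def by (simp only: norm_mult power_mult_distrib cm) simp
  qed
  obtain r l where r: "strict_mono (r :: nat \<Rightarrow> nat)" and l: "\<And>b. b \<in> S \<Longrightarrow> (\<lambda>n. x (r n) b) \<longlonglongrightarrow> l b"
    using finite_family_convergent_subsequence[OF S, of x "\<lambda>_. 1"] xb by blast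
  have "(\<lambda>n. sqnorm S (x (r n))) \<longlonglongrightarrow> sqnorm S l"
    unfolding sqnorm_def by (intro tendsto_intros l)
  then have "sqnorm S l = 1" unfolding x1 by (simp add: LIMSEQ_const_iff)
  then obtain b where b: "b \<in> S" "l b \<noteq> 0" using sqnorm_eq_0_iff[OF S, of l] by auto
  from minimal_system_reachable[OF min, where a = b and \<xi> = l, OF b] obtain w where w: "w \<noteq> []" "set w \<subseteq> {..<d}"
    "(\<Sum>b\<in>S. l b * reach S T k w b) \<noteq> 0" by blast
  have lim: "(\<lambda>n. V (x (r n)) w) \<longlonglongrightarrow> V l w"
    unfolding V_def by (intro tendsto_intros l)
  have "V (x (r n)) w \<le> inverse (real (Suc n))" if n: "n \<ge> length w" for n
  proof -
    have rn: "n \<le> r n" using r by (simp add: seq_suble)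
    have "w \<in> W (r n)" using w n rn by (auto simp: W_def)
    then have "V (\<xi> (r n)) w \<le> (\<Sum>w\<in>W (r n). V (\<xi> (r n)) w)"
      using finW V0 by (intro member_le_sum) auto
    then have "real (Suc (r n)) * V (\<xi> (r n)) w \<le> real (Suc (r n)) * (\<Sum>w\<in>W (r n). V (\<xi> (r n)) w)"
      by (intro mult_left_mono) auto
    also have "\<dots> \<le> \<nu> (r n)" using \<xi>(2)[of "r n"] le\<nu>[OF \<xi>(1), of "r n" "r n"] by linarith
    finally have "real (Suc (r n)) * V (x (r n)) w \<le> 1"
      unfolding Vx using \<nu>0[of "r n"] by (simp add: field_simps)
    moreover have "real (Suc n) * V (x (r n)) w \<le> real (Suc (r n)) * V (x (r n)) w"
      using rn V0 by (intro mult_right_mono) auto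
    ultimately have "real (Suc n) * V (x (r n)) w \<le> 1" by linarith
    then show ?thesis by (simp add: field_simps)
  qed
  then have "V l w \<le> 0"
    by (intro LIMSEQ_le[OF lim LIMSEQ_inverse_real_of_nat]) auto
  then show False using w(3) by (simp add: V_def)
qed

section \<open>No energy gain in stationary signals\<close>

lemma herm_form_coapply:
  assumes "finite S" "0 \<notin> S"
    and g: "\<And>a b. a \<in> insert 0 S \<Longrightarrow> b \<in> insert 0 S \<Longrightarrow> P a b = (\<Sum>c\<in>K. x a c * cnj (x b c))"
  shows "herm_form (insert 0 S) P (coapply_sys S T \<xi>) =
    sqnorm K (\<lambda>c. \<Sum>a\<in>insert 0 S. \<xi> a * apply_sys S T (\<lambda>b. x b c) a)"
proof -
  have "herm_form (insert 0 S) P (coapply_sys S T \<xi>) =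
    (\<Sum>c\<in>K. (cmod (\<Sum>b\<in>insert 0 S. coapply_sys S T \<xi> b * x b c))\<^sup>2)"
    by (rule herm_form_gram[OF g])
  moreover have "(\<Sum>b\<in>insert 0 S. coapply_sys S T \<xi> b * x b c) =
      (\<Sum>a\<in>insert 0 S. \<xi> a * apply_sys S T (\<lambda>b. x b c) a)" for c
    unfolding coapply_sys_def apply_sys_def sum_distrib_left sum_distrib_right
    by (subst sum.swap) (simp only: ac_simps)
  ultimately show ?thesis by (simp only: sqnorm_def)
qed

lemma herm_form_le_sum_of_squares:
  assumes "finite I" and s: "\<And>a. a \<in> I \<Longrightarrow> (cmod (\<xi> a))\<^sup>2 \<le> s"
  shows "\<bar>herm_form I P \<xi>\<bar> \<le> (\<Sum>a\<in>I. \<Sum>b\<in>I. cmod (P a b)) * s"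
proof -
  have "cmod (\<xi> a * P a b * cnj (\<xi> b)) \<le> cmod (P a b) * s" if "a \<in> I" "b \<in> I" for a b
  proof -
    have "2 * (cmod (\<xi> a) * cmod (\<xi> b)) \<le> (cmod (\<xi> a))\<^sup>2 + (cmod (\<xi> b))\<^sup>2"
      using sum_squares_bound[of "cmod (\<xi> a)" "cmod (\<xi> b)"] by (simp add: mult.assoc)
    then have "cmod (\<xi> a) * cmod (\<xi> b) \<le> s" using s[OF that(1)] s[OF that(2)] by linarith
    then have "cmod (P a b) * (cmod (\<xi> a) * cmod (\<xi> b)) \<le> cmod (P a b) * s"
      by (intro mult_left_mono) auto
    then show ?thesis by (simp add: norm_mult ac_simps)
  qed
  then have "(\<Sum>a\<in>I. \<Sum>b\<in>I. cmod (\<xi> a * P a b * cnj (\<xi> b))) \<le> (\<Sum>a\<in>I. \<Sum>b\<in>I. cmod (P a b)) * s"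
    unfolding sum_distrib_right by (intro sum_mono)
  moreover have "cmod (\<Sum>a\<in>I. \<Sum>b\<in>I. \<xi> a * P a b * cnj (\<xi> b)) \<le> (\<Sum>a\<in>I. \<Sum>b\<in>I. cmod (\<xi> a * P a b * cnj (\<xi> b)))"
    by (intro sum_norm_le order_refl)
  ultimately show ?thesis unfolding herm_form_def
    by (meson abs_Re_le_cmod order_trans)
qed

lemma coloured_dot_reach:
  assumes \<xi>: "coloured S k c \<xi>"
  shows "(\<Sum>a\<in>insert 0 S. \<xi> a * reach S T k (i # w) a) =
    (if i = c then \<Sum>b\<in>insert 0 S. coapply_sys S T \<xi> b * reach S T k w b else 0)"
proof -
  have "(\<Sum>a\<in>insert 0 S. \<xi> a * reach S T k (i # w) a) =
     (\<Sum>a\<in>insert 0 S. if i = c then \<xi> a * apply_sys S T (reach S T k w) a else 0)"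
    using \<xi> by (intro sum.cong) (auto simp: coloured_def)
  also have "\<dots> = (if i = c then \<Sum>b\<in>insert 0 S. coapply_sys S T \<xi> b * reach S T k w b else 0)"
    unfolding coapply_sys_def apply_sys_def sum_distrib_left sum_distrib_right
    by (subst sum.swap) (simp only: ac_simps, simp)
  finally show ?thesis .
qed

text \<open>The signal \<open>P\<close> is prepared within \<open>h\<close> steps and then kept. For the preparation, each word of \<open>W\<close> is
  started with an amplitude \<open>sqrt \<Lambda>\<close> so late that it is completed at time \<open>h\<close>; reachability makes the
  sum of these signals dominate \<open>P\<close> on every colour. Its cost \<open>E\<close> does not depend on the number \<open>m\<close> of
  repetitions of \<open>P\<close>.\<close>

lemma stationary_form_contractive:
  assumes sys: "is_system d S k" and fh: "finite_horizon_contractive d S T k"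
    and rb: "reachable_by d S T k W C"
    and psd: "psd_form (insert 0 S) P"
    and stat: "\<And>c \<xi>. c < d \<Longrightarrow> coloured S k c \<xi> \<Longrightarrow>
      herm_form (insert 0 S) P \<xi> \<le> herm_form (insert 0 S) P (coapply_sys S T \<xi>)"
  shows "herm_form (insert 0 S) P (T 0) \<le> herm_form (insert 0 S) P input_vec"
proof -
  let ?I = "insert 0 S"
  have S: "finite S" "0 \<notin> S" using sys by (auto simp: is_system_def)
  have W: "finite W" "[] \<notin> W" "0 \<le> C" using rb by (auto simp: reachable_by_def)
  define \<Lambda> where "\<Lambda> = (\<Sum>a\<in>?I. \<Sum>b\<in>?I. cmod (P a b)) * C"
  have \<Lambda>: "\<Lambda> \<ge> 0" unfolding \<Lambda>_def using W by (intro mult_nonneg_nonneg sum_nonneg) auto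
  define h where "h = Suc (Max (insert 0 (length ` W)))"
  have h: "length w < h" if "w \<in> W" for w
    unfolding h_def using that W by (simp add: less_Suc_eq_le)
  \<comment> \<open>the part of \<open>w\<close> processed by time \<open>t\<close> is its suffix of length \<open>length w - (h - t)\<close>\<close>
  define y where "y = (\<lambda>t w. if h - t \<le> length w then reach S T k (drop (h - t) w) else (\<lambda>_. 0))"
  define Q where "Q = (\<lambda>t a b. \<Sum>w\<in>W. (of_real (sqrt \<Lambda>) * y t w a) * cnj (of_real (sqrt \<Lambda>) * y t w b))"
  have hQ: "herm_form ?I (Q t) \<eta> = \<Lambda> * (\<Sum>w\<in>W. (cmod (\<Sum>a\<in>?I. \<eta> a * y t w a))\<^sup>2)" for t \<eta>
  proof -
    have "herm_form ?I (Q t) \<eta> = (\<Sum>w\<in>W. (cmod (\<Sum>a\<in>?I. \<eta> a * (of_real (sqrt \<Lambda>) * y t w a)))\<^sup>2)"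
      by (rule herm_form_gram) (simp add: Q_def)
    also have "\<dots> = (\<Sum>w\<in>W. \<Lambda> * (cmod (\<Sum>a\<in>?I. \<eta> a * y t w a))\<^sup>2)"
    proof (intro sum.cong refl)
      fix w
      have "(\<Sum>a\<in>?I. \<eta> a * (of_real (sqrt \<Lambda>) * y t w a)) = of_real (sqrt \<Lambda>) * (\<Sum>a\<in>?I. \<eta> a * y t w a)"
        by (simp only: sum_distrib_left ac_simps)
      then show "(cmod (\<Sum>a\<in>?I. \<eta> a * (of_real (sqrt \<Lambda>) * y t w a)))\<^sup>2 = \<Lambda> * (cmod (\<Sum>a\<in>?I. \<eta> a * y t w a))\<^sup>2"
        using \<Lambda> by (simp add: norm_mult power_mult_distrib)
    qed
    finally show ?thesis by (simp add: sum_distrib_left)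
  qed
  define R where "R = (\<lambda>t. if t < h then Q t else P)"
  have psdR: "psd_form ?I (R t)" for t
  proof -
    have "psd_form ?I (Q t)" 
      by (rule psd_form_gram[where x = "\<lambda>a w. of_real (sqrt \<Lambda>) * y t w a" and K = W]) (simp only: Q_def)
    then show ?thesis using psd by (simp add: R_def)
  qed
  have step: "(cmod (\<Sum>a\<in>?I. \<xi> a * y (Suc t) w a))\<^sup>2 \<le> (cmod (\<Sum>a\<in>?I. coapply_sys S T \<xi> a * y t w a))\<^sup>2"
    if "t < h" "w \<in> W" "coloured S k c \<xi>" for t w c \<xi>
  proof (cases "h - Suc t < length w")
    case False
    have "\<xi> 0 = 0" using that S by (auto simp: coloured_def)
    then have "\<xi> a * y (Suc t) w a = 0" for a using False by (auto simp: y_def input_vec_def)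
    then have "(\<Sum>a\<in>?I. \<xi> a * y (Suc t) w a) = 0" by (intro sum.neutral) auto
    then show ?thesis by simp
  next
    case True
    have e: "h - t = Suc (h - Suc t)" using that by simp
    have "drop (h - Suc t) w = (w ! (h - Suc t)) # drop (h - t) w"
      unfolding e using True by (simp add: Cons_nth_drop_Suc)
    then have "y (Suc t) w = reach S T k ((w ! (h - Suc t)) # drop (h - t) w)"
      "y t w = reach S T k (drop (h - t) w)"
      using True e by (auto simp: y_def)
    then show ?thesis using coloured_dot_reach[OF that(3), of T] by simp
  qed
  have bound: "herm_form ?I P \<xi> \<le> \<Lambda> * (\<Sum>w\<in>W. (cmod (\<Sum>a\<in>?I. \<xi> a * y h w a))\<^sup>2)"
    if "coloured S k c \<xi>" for c \<xi>
  proof -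
    have \<xi>0: "\<xi> 0 = 0" using that S by (auto simp: coloured_def)
    have yl: "y h w = reach S T k w" for w by (simp add: y_def)
    have s: "(cmod (\<xi> a))\<^sup>2 \<le> C * (\<Sum>w\<in>W. (cmod (\<Sum>b\<in>?I. \<xi> b * y h w b))\<^sup>2)" if "a \<in> ?I" for a
    proof (cases "a = 0")
      case True
      then show ?thesis using \<xi>0 W(3) by (auto intro!: mult_nonneg_nonneg sum_nonneg)
    next
      case False
      then have "(cmod (\<xi> a))\<^sup>2 \<le> C * (\<Sum>w\<in>W. (cmod (\<Sum>b\<in>S. \<xi> b * reach S T k w b))\<^sup>2)"
        using rb that unfolding reachable_by_def by blast
      then show ?thesis using S \<xi>0 by (simp add: yl)
    qed
    show ?thesis
      using herm_form_le_sum_of_squares[of ?I \<xi> _ P, OF _ s] S unfolding \<Lambda>_def by (simp add: mult.assoc)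
  qed
  have trans: "herm_form ?I (R (Suc t)) \<xi> \<le> herm_form ?I (R t) (coapply_sys S T \<xi>)"
    if "c < d" "coloured S k c \<xi>" for t c \<xi>
  proof -
    consider "Suc t < h" | "Suc t = h" | "Suc t > h" by linarith
    then show ?thesis
    proof cases
      case 1
      then show ?thesis unfolding R_def using that step[of t] \<Lambda>
        by (simp add: hQ mult_left_mono sum_mono)
    next
      case 2
      have "herm_form ?I P \<xi> \<le> \<Lambda> * (\<Sum>w\<in>W. (cmod (\<Sum>a\<in>?I. \<xi> a * y (Suc t) w a))\<^sup>2)"
        using bound[OF that(2)] unfolding 2 .
      also have "\<dots> \<le> \<Lambda> * (\<Sum>w\<in>W. (cmod (\<Sum>a\<in>?I. coapply_sys S T \<xi> a * y t w a))\<^sup>2)"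
        using step[of t] that 2 \<Lambda> by (intro mult_left_mono sum_mono) auto
      finally show ?thesis using 2 by (simp add: R_def hQ)
    next
      case 3
      then show ?thesis using stat[OF that] by (simp add: R_def)
    qed
  qed
  have init: "herm_form ?I (R 0) \<xi> = 0" for \<xi>
  proof -
    have "y 0 w a = 0" if "w \<in> W" for w a using h[OF that] by (simp add: y_def)
    then show ?thesis by (simp add: R_def hQ h_def)
  qed
  define E where "E = (\<Sum>t<h. herm_form ?I (R t) input_vec)"
  let ?g = "herm_form ?I P (T 0) - herm_form ?I P input_vec"
  have "real (Suc m) * ?g \<le> E" for m
  proof -
    have "\<forall>m P. (\<forall>t\<le>m. psd_form (insert 0 S) (P t)) \<longrightarrow>
      (\<forall>\<xi>. \<xi> 0 = 0 \<longrightarrow> herm_form (insert 0 S) (P 0) \<xi> = 0) \<longrightarrow>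
      (\<forall>t<m. \<forall>c<d. \<forall>\<xi>. coloured S k c \<xi> \<longrightarrow>
        herm_form (insert 0 S) (P (Suc t)) \<xi> \<le> herm_form (insert 0 S) (P t) (coapply_sys S T \<xi>)) \<longrightarrow>
      (\<Sum>t\<le>m. herm_form (insert 0 S) (P t) (T 0)) \<le> (\<Sum>t\<le>m. herm_form (insert 0 S) (P t) input_vec)"
      using fh unfolding finite_horizon_contractive_def .
    from this[rule_format, of "h + m" R] psdR init trans
    have le: "(\<Sum>t\<le>h + m. herm_form ?I (R t) (T 0)) \<le> (\<Sum>t\<le>h + m. herm_form ?I (R t) input_vec)" by blast
    have split: "(\<Sum>t\<le>h + m. herm_form ?I (R t) v) =
        (\<Sum>t<h. herm_form ?I (R t) v) + real (Suc m) * herm_form ?I P v" for v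
    proof -
      have "{..h + m} = {..<h} \<union> {h..h + m}" by auto
      then have "(\<Sum>t\<le>h + m. herm_form ?I (R t) v) =
        (\<Sum>t<h. herm_form ?I (R t) v) + (\<Sum>t=h..h + m. herm_form ?I (R t) v)"
        by (simp add: sum.union_disjoint ivl_disj_int)
      moreover have "(\<Sum>t=h..h + m. herm_form ?I (R t) v) = (\<Sum>t=h..h + m. herm_form ?I P v)"
        by (intro sum.cong) (auto simp: R_def)
      ultimately show ?thesis by simp
    qed
    have "(\<Sum>t<h. herm_form ?I (R t) (T 0)) \<ge> 0"
      using psdR by (intro sum_nonneg) (auto simp: psd_form_def)
    then show ?thesis using le unfolding split E_def by (simp add: algebra_simps)
  qed
  then have "\<And>m. real m * ?g \<le> \<bar>E\<bar>"
  proof -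
    fix m
    show "real m * ?g \<le> \<bar>E\<bar>" using \<open>\<And>m. real (Suc m) * ?g \<le> E\<close>[of "m - 1"] by (cases m) auto
  qed
  then have "?g \<le> 0"
    by (metis ex_less_of_nat_mult not_less)
  then show ?thesis by simp
qed

section \<open>Storage forms by duality\<close>

text \<open>The external channel counts as a colour of its own, so that one condition expresses that a form has no
  mixed entries.\<close>

definition channel_colour :: "(nat \<Rightarrow> nat) \<Rightarrow> nat \<Rightarrow> nat" where
  "channel_colour k a = (if a = 0 then 0 else Suc (k a))"

text \<open>In the language of dissipative systems, \<open>E\<close> measures the energy stored in the states; the external
  channel is normalized to weight \<open>1\<close>.\<close>

definition storage_form :: "nat set \<Rightarrow> (nat \<Rightarrow> nat) \<Rightarrow> (nat \<Rightarrow> nat \<Rightarrow> complex) \<Rightarrow> bool" where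
  "storage_form S k E \<longleftrightarrow> psd_form (insert 0 S) E \<and> E 0 0 = 1 \<and>
    (\<forall>a\<in>insert 0 S. \<forall>b\<in>insert 0 S. channel_colour k a \<noteq> channel_colour k b \<longrightarrow> E a b = 0)"

lemma affine_bounded_below_imp_slope_nonneg:
  fixes A B m :: real
  assumes "\<And>r. 0 \<le> r \<Longrightarrow> m \<le> A + r * B"
  shows "0 \<le> B"
proof (rule ccontr)
  assume "\<not> 0 \<le> B"
  then have B: "B < 0" by simp
  define r where "r = (\<bar>A\<bar> + \<bar>m\<bar> + 1) / (- B)"
  have "0 \<le> r" unfolding r_def using B by (intro divide_nonneg_nonneg) auto
  moreover have "r * B = - (\<bar>A\<bar> + \<bar>m\<bar> + 1)" using B by (simp add: r_def)
  ultimately show False using assms[of r] by linarith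
qed

lemma herm_form_linear:
  "herm_form I (\<lambda>a b. of_real r * P a b + of_real s * Q a b) x = r * herm_form I P x + s * herm_form I Q x"
proof -
  have "(\<Sum>a\<in>I. \<Sum>b\<in>I. x a * (of_real r * P a b + of_real s * Q a b) * cnj (x b)) =
    of_real r * (\<Sum>a\<in>I. \<Sum>b\<in>I. x a * P a b * cnj (x b)) + of_real s * (\<Sum>a\<in>I. \<Sum>b\<in>I. x a * Q a b * cnj (x b))"
    by (simp add: sum_distrib_left sum.distrib algebra_simps)
  then show ?thesis unfolding herm_form_def by simp
qed

lemma psd_form_linear:
  assumes "psd_form I P" "psd_form I Q" "0 \<le> r" "0 \<le> s"
  shows "psd_form I (\<lambda>a b. of_real r * P a b + of_real s * Q a b)"
proof -
  have "P b a = cnj (P a b)" "Q b a = cnj (Q a b)" if "a \<in> I" "b \<in> I" for a b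
    using assms that unfolding psd_form_def by blast+
  note eq = this
  have herm: "of_real r * P b a + of_real s * Q b a = cnj (of_real r * P a b + of_real s * Q a b)"
    if "a \<in> I" "b \<in> I" for a b
    unfolding eq[OF that] by simp
  have "0 \<le> herm_form I P x" "0 \<le> herm_form I Q x" for x
    using assms unfolding psd_form_def by blast+
  then have "0 \<le> herm_form I (\<lambda>a b. of_real r * P a b + of_real s * Q a b) x" for x
    using assms(3,4) by (simp only: herm_form_linear add_nonneg_nonneg mult_nonneg_nonneg)
  then show ?thesis using herm unfolding psd_form_def by blast
qed

text \<open>The form \<open>x \<mapsto> E (T x)\<close>.\<close>

definition pullback_form :: "nat set \<Rightarrow> (nat \<Rightarrow> nat \<Rightarrow> complex) \<Rightarrow> (nat \<Rightarrow> nat \<Rightarrow> complex) \<Rightarrow> nat \<Rightarrow> nat \<Rightarrow> complex" where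
  "pullback_form S T E a b = (\<Sum>c\<in>insert 0 S. \<Sum>e\<in>insert 0 S. T c a * E c e * cnj (T e b))"

lemma herm_form_pullback:
  "herm_form (insert 0 S) (pullback_form S T E) x = herm_form (insert 0 S) E (apply_sys S T x)"
proof -
  let ?I = "insert 0 S"
  let ?f = "\<lambda>a b c e. (T c a * x a) * E c e * cnj (T e b * x b)"
  have "(\<Sum>a\<in>?I. \<Sum>b\<in>?I. x a * pullback_form S T E a b * cnj (x b)) = (\<Sum>a\<in>?I. \<Sum>b\<in>?I. \<Sum>c\<in>?I. \<Sum>e\<in>?I. ?f a b c e)"
    unfolding pullback_form_def sum_distrib_left sum_distrib_right
    by (intro sum.cong refl) (simp add: ac_simps)
  also have "\<dots> = (\<Sum>a\<in>?I. \<Sum>c\<in>?I. \<Sum>b\<in>?I. \<Sum>e\<in>?I. ?f a b c e)" by (intro sum.cong refl sum.swap)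
  also have "\<dots> = (\<Sum>a\<in>?I. \<Sum>c\<in>?I. \<Sum>e\<in>?I. \<Sum>b\<in>?I. ?f a b c e)" by (intro sum.cong refl sum.swap)
  also have "\<dots> = (\<Sum>c\<in>?I. \<Sum>a\<in>?I. \<Sum>e\<in>?I. \<Sum>b\<in>?I. ?f a b c e)" by (rule sum.swap)
  also have "\<dots> = (\<Sum>c\<in>?I. \<Sum>e\<in>?I. \<Sum>a\<in>?I. \<Sum>b\<in>?I. ?f a b c e)" by (intro sum.cong refl sum.swap)
  also have "\<dots> = (\<Sum>c\<in>?I. \<Sum>e\<in>?I. apply_sys S T x c * E c e * cnj (apply_sys S T x e))"
  proof (intro sum.cong refl)
    fix c e
    show "(\<Sum>a\<in>?I. \<Sum>b\<in>?I. ?f a b c e) = apply_sys S T x c * E c e * cnj (apply_sys S T x e)"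
      unfolding apply_sys_def cnj_sum sum_distrib_left sum_distrib_right by (rule sum.swap)
  qed
  finally show ?thesis unfolding herm_form_def by simp
qed

lemma pullback_form_linear:
  "pullback_form S T (\<lambda>a b. of_real r * P a b + of_real s * Q a b) a b =
    of_real r * pullback_form S T P a b + of_real s * pullback_form S T Q a b"
  unfolding pullback_form_def by (simp add: sum_distrib_left sum.distrib algebra_simps)

lemma pullback_form_rank_one:
  "pullback_form S T (\<lambda>c e. \<xi> c * cnj (\<xi> e)) a b = coapply_sys S T \<xi> a * cnj (coapply_sys S T \<xi> b)"
  unfolding pullback_form_def coapply_sys_def cnj_sum sum_product by (simp add: ac_simps)

lemma coapply_input: 
  assumes "finite S" "0 \<notin> S" shows "coapply_sys S T input_vec = T 0"
proof
  fix b
  have "(\<Sum>a\<in>S. input_vec a * T a b) = 0" using assms by (intro sum.neutral) (auto simp: input_vec_def)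
  then show "coapply_sys S T input_vec b = T 0 b" using assms
    by (simp add: coapply_sys_def input_vec_def[of 0])
qed

lemma storage_form_linear:
  assumes "storage_form S k E" "storage_form S k F" "0 \<le> t" "t \<le> 1"
  shows "storage_form S k (\<lambda>a b. of_real (1 - t) * E a b + of_real t * F a b)"
  using assms psd_form_linear[of "insert 0 S" E F "1 - t" t] unfolding storage_form_def by auto

text \<open>These test forms suffice to read off, in the next lemma, all the inequalities that the separating
  functional satisfies.\<close>

lemma storage_form_input_plus_coloured:
  assumes S: "finite S" "0 \<notin> S" and \<xi>: "coloured S k c \<xi>" and s: "0 \<le> s"
  shows "storage_form S k (\<lambda>a b. of_real 1 * (input_vec a * cnj (input_vec b)) + of_real s * (\<xi> a * cnj (\<xi> b)))"
proof -
  have r1: "psd_form (insert 0 S) (\<lambda>a b. x a * cnj (x b))" for x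
    using psd_form_gram[of "insert 0 S" "\<lambda>a b. x a * cnj (x b)" "\<lambda>a _. x a" "{()}"] by simp
  have "\<xi> 0 = 0" using \<xi> S by (auto simp: coloured_def)
  have x0: "\<xi> a * cnj (\<xi> b) = 0" if "channel_colour k a \<noteq> channel_colour k b" for a b
    using \<xi> that S by (auto simp: coloured_def channel_colour_def split: if_splits)
  have i0: "input_vec a * cnj (input_vec b) = 0" if "channel_colour k a \<noteq> channel_colour k b" for a b
    using that by (auto simp: input_vec_def channel_colour_def split: if_splits)
  have "of_real 1 * (input_vec a * cnj (input_vec b)) + of_real s * (\<xi> a * cnj (\<xi> b)) = 0"
    if "channel_colour k a \<noteq> channel_colour k b" for a b
    by (simp only: x0[OF that] i0[OF that] mult_zero_right add_0)
  moreover have "psd_form (insert 0 S)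
      (\<lambda>a b. of_real 1 * (input_vec a * cnj (input_vec b)) + of_real s * (\<xi> a * cnj (\<xi> b)))"
    by (rule psd_form_linear[OF r1 r1 _ s]) simp
  ultimately show ?thesis unfolding storage_form_def using \<open>\<xi> 0 = 0\<close>
    by (simp add: input_vec_def[of 0])
qed

text \<open>The matrices \<open>E - T\<^sup>* E T - Q\<close> with \<open>E\<close> a storage form and \<open>Q\<close> positive semidefinite form a convex set.
  A point of it near \<open>0\<close> is what is wanted. Otherwise \<open>0\<close> is separated from the set by some \<open>p\<close>. The
  cone of all \<open>Q\<close> makes \<open>P\<close>, the negative of the Hermitian part of \<open>p\<close>, positive semidefinite, the
  coloured summands of \<open>E\<close> make it stationary, and the channel shows a gain of energy.\<close>

lemma approximate_storage_form:
  assumes sys: "is_system d S k"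
    and stat: "\<And>P. psd_form (insert 0 S) P \<Longrightarrow>
      (\<And>c \<xi>. c < d \<Longrightarrow> coloured S k c \<xi> \<Longrightarrow>
        herm_form (insert 0 S) P \<xi> \<le> herm_form (insert 0 S) P (coapply_sys S T \<xi>)) \<Longrightarrow>
      herm_form (insert 0 S) P (T 0) \<le> herm_form (insert 0 S) P input_vec"
    and \<epsilon>: "0 < \<epsilon>"
  shows "\<exists>E. storage_form S k E \<and> (\<forall>x. herm_form (insert 0 S) E (apply_sys S T x)
      \<le> herm_form (insert 0 S) E x + \<epsilon> * (\<Sum>a\<in>insert 0 S. cmod (x a))\<^sup>2)"
proof (rule ccontr)
  assume neg: "\<not> ?thesis"
  let ?I = "insert 0 S"
  let ?h = "herm_form ?I"
  have S: "finite S" "0 \<notin> S" using sys by (auto simp: is_system_def)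
  define slack where "slack = (\<lambda>E Q (a, b). E a b - pullback_form S T E a b - Q a b)"
  define C where "C = {slack E Q | E Q. storage_form S k E \<and> psd_form ?I Q}"
  have hslack: "?h (\<lambda>a b. slack E Q (a, b)) x = ?h E x - ?h E (apply_sys S T x) - ?h Q x" for E Q x
  proof -
    have "?h (\<lambda>a b. slack E Q (a, b)) x = ?h E x - ?h (pullback_form S T E) x - ?h Q x"
      unfolding herm_form_def slack_def by (simp add: algebra_simps sum_subtractf)
    then show ?thesis by (simp only: herm_form_pullback)
  qed
  have r1: "psd_form ?I (\<lambda>a b. x a * cnj (x b))" for x
    using psd_form_gram[of ?I "\<lambda>a b. x a * cnj (x b)" "\<lambda>a _. x a" "{()}"] by simp
  have z: "psd_form ?I (\<lambda>a b. 0)" by (simp add: psd_form_def herm_form_def)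
  have CI: "slack E Q \<in> C" if "storage_form S k E" "psd_form ?I Q" for E Q
    unfolding C_def using that by blast
  have "coloured S k 0 (\<lambda>_. 0)" by (simp add: coloured_def)
  from storage_form_input_plus_coloured[OF S this order_refl]
  have "C \<noteq> {}" using CI z by blast
  moreover have "(\<lambda>j. complex_of_real (1 - t) * x j + complex_of_real t * x' j) \<in> C"
    if "x \<in> C" "x' \<in> C" and t: "0 \<le> t" "t \<le> 1" for x x' t
  proof -
    obtain E Q E' Q' where e: "x = slack E Q" "x' = slack E' Q'" "storage_form S k E" "psd_form ?I Q"
      "storage_form S k E'" "psd_form ?I Q'"
      using \<open>x \<in> C\<close> \<open>x' \<in> C\<close> unfolding C_def by blast
    have "(\<lambda>j. complex_of_real (1 - t) * x j + complex_of_real t * x' j) =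
      slack (\<lambda>a b. of_real (1 - t) * E a b + of_real t * E' a b) (\<lambda>a b. of_real (1 - t) * Q a b + of_real t * Q' a b)"
      unfolding e slack_def by (rule ext) (clarsimp simp only: split_beta pullback_form_linear, simp add: algebra_simps)
    then show ?thesis
      by (simp only:) (rule CI[OF storage_form_linear psd_form_linear], use e t in auto)
  qed
  moreover have "\<epsilon>\<^sup>2 \<le> (\<Sum>j\<in>?I \<times> ?I. (cmod (x j))\<^sup>2)" if "x \<in> C" for x
  proof (rule ccontr)
    assume small: "\<not> ?thesis"
    obtain E Q where e: "x = slack E Q" "storage_form S k E" "psd_form ?I Q"
      using \<open>x \<in> C\<close> unfolding C_def by blast
    have xs: "cmod (x (a, b)) \<le> \<epsilon>" if "a \<in> ?I" "b \<in> ?I" for a b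
    proof -
      have "(cmod (x (a, b)))\<^sup>2 \<le> (\<Sum>j\<in>?I \<times> ?I. (cmod (x j))\<^sup>2)" using that S by (intro member_le_sum) auto
      then have "(cmod (x (a, b)))\<^sup>2 \<le> \<epsilon>\<^sup>2" using small by linarith
      then show ?thesis using \<epsilon> by (auto intro: power2_le_imp_le)
    qed
    have "?h E (apply_sys S T y) \<le> ?h E y + \<epsilon> * (\<Sum>a\<in>?I. cmod (y a))\<^sup>2" for y
    proof -
      have "cmod (\<Sum>a\<in>?I. \<Sum>b\<in>?I. y a * x (a, b) * cnj (y b)) \<le> (\<Sum>a\<in>?I. \<Sum>b\<in>?I. \<epsilon> * (cmod (y a) * cmod (y b)))"
      proof (intro sum_norm_le)
        fix a b assume "a \<in> ?I" "b \<in> ?I"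
        then have "cmod (x (a, b)) * (cmod (y a) * cmod (y b)) \<le> \<epsilon> * (cmod (y a) * cmod (y b))"
          using xs by (intro mult_right_mono) auto
        then show "cmod (y a * x (a, b) * cnj (y b)) \<le> \<epsilon> * (cmod (y a) * cmod (y b))"
          by (simp add: norm_mult ac_simps)
      qed
      also have "\<dots> = \<epsilon> * (\<Sum>a\<in>?I. cmod (y a))\<^sup>2"
        unfolding power2_eq_square sum_product by (simp only: sum_distrib_left)
      finally have "- (\<epsilon> * (\<Sum>a\<in>?I. cmod (y a))\<^sup>2) \<le> ?h (\<lambda>a b. x (a, b)) y"
        unfolding herm_form_def
        using abs_Re_le_cmod[of "\<Sum>a\<in>?I. \<Sum>b\<in>?I. y a * x (a, b) * cnj (y b)"] by linarith
      moreover have "0 \<le> ?h Q y" using e(3) unfolding psd_form_def by blast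
      ultimately show ?thesis using hslack[of E Q y] unfolding e(1) by linarith
    qed
    then show False using neg e(2) by blast
  qed
  moreover have "finite (?I \<times> ?I)" using S by simp
  ultimately obtain p where p: "\<And>x. x \<in> C \<Longrightarrow> \<epsilon>\<^sup>2 \<le> (\<Sum>j\<in>?I \<times> ?I. Re (cnj (p j) * x j))"
    using convex_separation_from_zero[of "?I \<times> ?I" C "\<epsilon>\<^sup>2"] by blast
  define P where "P = (\<lambda>a b. - (cnj (p (a, b)) + p (b, a)) / 2)"
  define pr where "pr = (\<lambda>G. \<Sum>a\<in>?I. \<Sum>b\<in>?I. Re (cnj (p (a, b)) * G a b))"
  have pr_rank_one: "pr (\<lambda>a b. y a * cnj (y b)) = - ?h P y" for y
  proof -
    have s: "(\<Sum>a\<in>?I. \<Sum>b\<in>?I. Re (p (b, a) * (y a * cnj (y b)))) = pr (\<lambda>a b. y a * cnj (y b))"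
      unfolding pr_def by (subst sum.swap) (intro sum.cong refl, simp add: algebra_simps)
    have "?h P y = (\<Sum>a\<in>?I. \<Sum>b\<in>?I. - (1/2) * Re (cnj (p (a, b)) * (y a * cnj (y b)))
        + - (1/2) * Re (p (b, a) * (y a * cnj (y b))))"
      unfolding herm_form_def P_def Re_sum by (intro sum.cong refl) (simp add: field_simps)
    also have "\<dots> = - (1/2) * pr (\<lambda>a b. y a * cnj (y b)) + - (1/2) * (\<Sum>a\<in>?I. \<Sum>b\<in>?I. Re (p (b, a) * (y a * cnj (y b))))"
      unfolding pr_def by (simp only: sum.distrib sum_distrib_left)
    finally show ?thesis unfolding s by simp
  qed
  have key: "\<epsilon>\<^sup>2 \<le> (?h P (T 0) - ?h P input_vec) + s * (?h P (coapply_sys S T \<xi>) - ?h P \<xi>) + r * ?h P \<eta>"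
    if "coloured S k c \<xi>" "0 \<le> s" "0 \<le> r" for c \<xi> s r \<eta>
  proof -
    define E where "E = (\<lambda>a b. of_real 1 * (input_vec a * cnj (input_vec b)) + of_real s * (\<xi> a * cnj (\<xi> b)))"
    define Q where "Q = (\<lambda>a b. of_real r * (\<eta> a * cnj (\<eta> b)) + of_real 0 * (\<eta> a * cnj (\<eta> b)))"
    have "storage_form S k E" unfolding E_def by (rule storage_form_input_plus_coloured[OF S that(1,2)])
    moreover have "psd_form ?I Q" unfolding Q_def using r1 r1 that(3) by (intro psd_form_linear) auto
    ultimately have "\<epsilon>\<^sup>2 \<le> (\<Sum>j\<in>?I \<times> ?I. Re (cnj (p j) * slack E Q j))" using p CI by blast
    also have "\<dots> = pr (\<lambda>a b. slack E Q (a, b))"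
      unfolding pr_def sum.cartesian_product by (intro sum.cong) auto
    also have "pr (\<lambda>a b. slack E Q (a, b)) = pr (\<lambda>a b. input_vec a * cnj (input_vec b)) + s * pr (\<lambda>a b. \<xi> a * cnj (\<xi> b))
       - pr (\<lambda>a b. T 0 a * cnj (T 0 b)) - s * pr (\<lambda>a b. coapply_sys S T \<xi> a * cnj (coapply_sys S T \<xi> b))
       - r * pr (\<lambda>a b. \<eta> a * cnj (\<eta> b))"
    proof -
      have "slack E Q (a, b) = input_vec a * cnj (input_vec b) + of_real s * (\<xi> a * cnj (\<xi> b))
        - (T 0 a * cnj (T 0 b)) - of_real s * (coapply_sys S T \<xi> a * cnj (coapply_sys S T \<xi> b))
        - of_real r * (\<eta> a * cnj (\<eta> b))" for a b
        unfolding slack_def E_def split_beta fst_conv snd_conv pullback_form_linear pullback_form_rank_one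
          coapply_input[OF S] by (simp add: Q_def)
      moreover have "Re (x * (a + of_real s * b - a' - of_real s * b' - of_real r * c)) =
        Re (x * a) + s * Re (x * b) - Re (x * a') - s * Re (x * b') - r * Re (x * c)" for x a b a' b' c
        by (simp add: algebra_simps)
      ultimately show ?thesis unfolding pr_def
        by (simp only: sum.distrib sum_subtractf sum_distrib_left)
    qed
    finally show ?thesis unfolding pr_rank_one by (simp add: algebra_simps)
  qed
  have c0: "coloured S k 0 (\<lambda>_. 0)" by (simp add: coloured_def)
  \<comment> \<open>the factors \<open>s\<close> and \<open>r\<close> can be arbitrarily large, so what they multiply in the inequality is nonnegative\<close>
  have h0: "?h P \<eta> \<ge> 0" for \<eta>
    using key[OF c0 order_refl, of _ \<eta>]
    by (intro affine_bounded_below_imp_slope_nonneg[of "\<epsilon>\<^sup>2" "?h P (T 0) - ?h P input_vec"]) simp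
  have "P b a = cnj (P a b)" for a b by (simp add: P_def)
  then have "psd_form ?I P" using h0 unfolding psd_form_def by blast
  moreover have "?h P \<xi> \<le> ?h P (coapply_sys S T \<xi>)" if "coloured S k c \<xi>" for c \<xi>
  proof -
    have "0 \<le> ?h P (coapply_sys S T \<xi>) - ?h P \<xi>"
      using key[OF that _ order_refl]
      by (intro affine_bounded_below_imp_slope_nonneg[of "\<epsilon>\<^sup>2" "?h P (T 0) - ?h P input_vec"]) simp
    then show ?thesis by simp
  qed
  ultimately have "?h P (T 0) \<le> ?h P input_vec" using stat by blast
  moreover have "\<epsilon>\<^sup>2 \<le> ?h P (T 0) - ?h P input_vec" using key[OF c0 order_refl order_refl] by simp
  moreover have "\<epsilon>\<^sup>2 > 0" using \<epsilon> by simp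
  ultimately show False by linarith
qed

section \<open>Contractive systems with prescribed coefficients\<close>

lemma storage_form_factorization:
  assumes "finite S" "storage_form S k E"
  shows "\<exists>x. (\<forall>a\<in>insert 0 S. \<forall>b\<in>insert 0 S. E a b = (\<Sum>c\<in>insert 0 S. x a c * cnj (x b c))) \<and>
    (\<forall>a\<in>insert 0 S. \<forall>c\<in>insert 0 S. channel_colour k a \<noteq> channel_colour k c \<longrightarrow> x a c = 0)"
  using assms unfolding storage_form_def by (intro psd_form_factorization) blast+

text \<open>Restricting a vector to one colour does not increase a form without mixed entries.\<close>

lemma storage_form_reach_step:
  assumes S: "finite S" "0 \<notin> S" and E: "storage_form S k E"
  shows "herm_form (insert 0 S) E (reach S T k (c # w)) \<le> herm_form (insert 0 S) E (apply_sys S T (reach S T k w))"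
proof -
  let ?I = "insert 0 S"
  have S0: "a \<noteq> 0" if "a \<in> S" for a using that S(2) by metis
  obtain x where x: "\<And>a b. a \<in> ?I \<Longrightarrow> b \<in> ?I \<Longrightarrow> E a b = (\<Sum>c\<in>?I. x a c * cnj (x b c))"
    and xk: "\<And>a c. a \<in> ?I \<Longrightarrow> c \<in> ?I \<Longrightarrow> channel_colour k a \<noteq> channel_colour k c \<Longrightarrow> x a c = 0"
    using storage_form_factorization[OF S(1) E] by blast
  define y where "y = apply_sys S T (reach S T k w)"
  have "cmod (\<Sum>a\<in>?I. reach S T k (c # w) a * x a i) \<le> cmod (\<Sum>a\<in>?I. y a * x a i)" if i: "i \<in> ?I" for i
  proof (cases "i \<in> S \<and> k i = c")
    case True
    then have "i \<noteq> 0" using S(2) by metis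
    have "(\<Sum>a\<in>?I. reach S T k (c # w) a * x a i) = (\<Sum>a\<in>?I. y a * x a i)"
    proof (intro sum.cong refl)
      fix a assume "a \<in> ?I"
      then show "reach S T k (c # w) a * x a i = y a * x a i"
        using xk[of a i] i True \<open>i \<noteq> 0\<close> S0 by (cases "a = 0") (auto simp: y_def channel_colour_def)
    qed
    then show ?thesis by simp
  next
    case False
    have "(\<Sum>a\<in>?I. reach S T k (c # w) a * x a i) = 0"
    proof (intro sum.neutral ballI)
      fix a assume "a \<in> ?I"
      then show "reach S T k (c # w) a * x a i = 0"
        using xk[of a i] i False S0 by (cases "a = 0"; cases "i = 0") (auto simp: channel_colour_def)
    qed
    then show ?thesis by simp
  qed
  then have "(\<Sum>i\<in>?I. (cmod (\<Sum>a\<in>?I. reach S T k (c # w) a * x a i))\<^sup>2) \<le> (\<Sum>i\<in>?I. (cmod (\<Sum>a\<in>?I. y a * x a i))\<^sup>2)"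
    by (intro sum_mono power_mono) auto
  moreover have "herm_form ?I E v = (\<Sum>i\<in>?I. (cmod (\<Sum>a\<in>?I. v a * x a i))\<^sup>2)" for v
    by (rule herm_form_gram[OF x])
  ultimately show ?thesis unfolding y_def by (simp only:)
qed

text \<open>The approximate inequality, applied along the words, bounds the forms on reachable vectors; by the
  reachability estimate the forms themselves are bounded, and a limit of them is exact.\<close>

lemma exact_storage_form:
  assumes sys: "is_system d S k" and rb: "reachable_by d S T k W C"
    and approx: "\<And>\<epsilon>. 0 < \<epsilon> \<Longrightarrow> \<exists>E. storage_form S k E \<and> (\<forall>x. herm_form (insert 0 S) E (apply_sys S T x)
      \<le> herm_form (insert 0 S) E x + \<epsilon> * (\<Sum>a\<in>insert 0 S. cmod (x a))\<^sup>2)"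
  shows "\<exists>E. storage_form S k E \<and>
    (\<forall>x. herm_form (insert 0 S) E (apply_sys S T x) \<le> herm_form (insert 0 S) E x)"
proof -
  let ?I = "insert 0 S"
  let ?h = "herm_form ?I"
  have S: "finite S" "0 \<notin> S" using sys by (auto simp: is_system_def)
  have W: "finite W" "[] \<notin> W" "0 \<le> C" using rb by (auto simp: reachable_by_def)
  have "\<forall>n. \<exists>E. storage_form S k E \<and> (\<forall>x. ?h E (apply_sys S T x)
      \<le> ?h E x + inverse (real (Suc n)) * (\<Sum>a\<in>?I. cmod (x a))\<^sup>2)"
    using approx by simp
  then obtain E where st: "\<And>n. storage_form S k (E n)"
    and le: "\<And>n x. ?h (E n) (apply_sys S T x) \<le> ?h (E n) x + inverse (real (Suc n)) * (\<Sum>a\<in>?I. cmod (x a))\<^sup>2"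
    by metis
  have "\<exists>\<beta>\<ge>0. \<forall>n. ?h (E n) (reach S T k w) \<le> \<beta>" for w
  proof (induction w)
    case Nil
    have "?h (E n) (reach S T k []) = 1" for n
    proof -
      have "?h (E n) (reach S T k []) = Re (\<Sum>a\<in>?I. \<Sum>b\<in>?I. if b = 0 then (if a = 0 then E n 0 0 else 0) else 0)"
        unfolding herm_form_def by (intro arg_cong[where f = Re] sum.cong refl) (simp add: input_vec_def)
      also have "(\<Sum>a\<in>?I. \<Sum>b\<in>?I. if b = 0 then (if a = 0 then E n 0 0 else 0) else 0) = (\<Sum>a\<in>?I. if a = 0 then E n 0 0 else 0)"
        using S(1) by (subst sum.delta) auto
      also have "\<dots> = E n 0 0" using S(1) by (subst sum.delta) auto
      finally show ?thesis using st[of n] by (simp add: storage_form_def)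
    qed
    then show ?case by (intro exI[of _ 1]) simp
  next
    case (Cons c w)
    then obtain \<beta> where \<beta>: "\<beta> \<ge> 0" "\<And>n. ?h (E n) (reach S T k w) \<le> \<beta>" by blast
    let ?s = "(\<Sum>a\<in>?I. cmod (reach S T k w a))\<^sup>2"
    have "?h (E n) (reach S T k (c # w)) \<le> \<beta> + ?s" for n
    proof -
      have "inverse (real (Suc n)) \<le> 1" by (simp add: inverse_le_1_iff)
      then have "inverse (real (Suc n)) * ?s \<le> 1 * ?s" by (intro mult_right_mono) auto
      then show ?thesis
        using storage_form_reach_step[OF S st[of n], of T c w] le[of n "reach S T k w"] \<beta>(2)[of n]
        by linarith
    qed
    then show ?case using \<beta>(1) by (intro exI[of _ "\<beta> + ?s"]) simp
  qed
  then obtain bnd where bnd0: "\<And>w. bnd w \<ge> 0" and bnd: "\<And>n w. ?h (E n) (reach S T k w) \<le> bnd w"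
    by metis
  define B where "B = 1 + C * (\<Sum>w\<in>W. bnd w)"
  have Eb: "cmod (E n a b) \<le> 2 * B" if ab: "a \<in> ?I" "b \<in> ?I" for n a b
  proof -
    obtain x where x: "\<And>a b. a \<in> ?I \<Longrightarrow> b \<in> ?I \<Longrightarrow> E n a b = (\<Sum>c\<in>?I. x a c * cnj (x b c))"
      using storage_form_factorization[OF S(1) st[of n]] by blast
    have diag: "(\<Sum>c\<in>?I. (cmod (x a c))\<^sup>2) \<le> B" if a: "a \<in> ?I" for a
    proof (cases "a = 0")
      case True
      have "complex_of_real (\<Sum>c\<in>?I. (cmod (x a c))\<^sup>2) = E n a a"
        unfolding x[OF a a] by (simp only: complex_norm_square of_real_sum)
      also have "\<dots> = complex_of_real 1" using True st[of n] by (simp add: storage_form_def)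
      finally have "(\<Sum>c\<in>?I. (cmod (x a c))\<^sup>2) = 1" by (simp only: of_real_eq_iff)
      moreover have "B \<ge> 1" unfolding B_def using W bnd0 by (simp add: sum_nonneg)
      ultimately show ?thesis by simp
    next
      case False
      have "(\<Sum>c\<in>?I. (cmod (x a c))\<^sup>2) \<le> (\<Sum>c\<in>?I. C * (\<Sum>w\<in>W. (cmod (\<Sum>b\<in>S. x b c * reach S T k w b))\<^sup>2))"
        using rb a False unfolding reachable_by_def by (intro sum_mono) auto
      also have "\<dots> = C * (\<Sum>w\<in>W. \<Sum>c\<in>?I. (cmod (\<Sum>b\<in>S. x b c * reach S T k w b))\<^sup>2)"
        unfolding sum_distrib_left[symmetric] by (subst sum.swap) simp
      also have "\<dots> = C * (\<Sum>w\<in>W. ?h (E n) (reach S T k w))"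
      proof (intro arg_cong[where f = "(*) C"] sum.cong refl)
        fix w assume "w \<in> W"
        then have "w \<noteq> []" using W by auto
        then have "reach S T k w 0 = 0" using S by (intro reach_support) auto
        then have "(\<Sum>b\<in>S. x b c * reach S T k w b) = (\<Sum>b\<in>?I. reach S T k w b * x b c)" for c
          using S by (simp add: mult.commute)
        then show "(\<Sum>c\<in>?I. (cmod (\<Sum>b\<in>S. x b c * reach S T k w b))\<^sup>2) = ?h (E n) (reach S T k w)"
          by (simp only: herm_form_gram[where x = x and K = ?I, OF x])
      qed
      also have "\<dots> \<le> C * (\<Sum>w\<in>W. bnd w)" using W bnd by (intro mult_left_mono sum_mono) auto
      finally show ?thesis unfolding B_def by simp
    qed
    have "cmod (E n a b) \<le> (\<Sum>c\<in>?I. (cmod (x a c))\<^sup>2 + (cmod (x b c))\<^sup>2)"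
      unfolding x[OF ab]
    proof (intro sum_norm_le)
      fix c
      have "2 * (cmod (x a c) * cmod (x b c)) \<le> (cmod (x a c))\<^sup>2 + (cmod (x b c))\<^sup>2"
        using sum_squares_bound[of "cmod (x a c)" "cmod (x b c)"] by (simp add: mult.assoc)
      moreover have "0 \<le> cmod (x a c) * cmod (x b c)" by simp
      ultimately show "cmod (x a c * cnj (x b c)) \<le> (cmod (x a c))\<^sup>2 + (cmod (x b c))\<^sup>2"
        unfolding norm_mult complex_mod_cnj by linarith
    qed
    also have "\<dots> \<le> 2 * B" using diag[OF ab(1)] diag[OF ab(2)] by (simp only: sum.distrib)
    finally show ?thesis .
  qed
  define x where "x = (\<lambda>n j. E n (fst j) (snd j))"
  have "finite (?I \<times> ?I)" using S(1) by simp
  moreover have "cmod (x n j) \<le> 2 * B" if "j \<in> ?I \<times> ?I" for j n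
    using that unfolding x_def mem_Times_iff by (intro Eb) blast+
  ultimately obtain r l where r: "strict_mono (r :: nat \<Rightarrow> nat)"
    and l: "\<And>j. j \<in> ?I \<times> ?I \<Longrightarrow> (\<lambda>n. x (r n) j) \<longlonglongrightarrow> l j"
    using finite_family_convergent_subsequence[of "?I \<times> ?I" x "\<lambda>_. 2 * B"] by blast
  define F where "F = (\<lambda>a b. l (a, b))"
  have lim: "(\<lambda>n. E (r n) a b) \<longlonglongrightarrow> F a b" if "a \<in> ?I" "b \<in> ?I" for a b
    using l[OF SigmaI[OF that]] by (simp add: F_def x_def)
  have hlim: "(\<lambda>n. ?h (E (r n)) x) \<longlonglongrightarrow> ?h F x" for x
    unfolding herm_form_def by (intro tendsto_intros lim)
  have "psd_form ?I F"
    unfolding psd_form_def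
  proof (intro conjI ballI allI)
    fix a b assume ab: "a \<in> ?I" "b \<in> ?I"
    have eq: "E n b a = cnj (E n a b)" for n
      using st[of n] ab unfolding storage_form_def psd_form_def by blast
    have "(\<lambda>n. E (r n) b a) \<longlonglongrightarrow> cnj (F a b)" unfolding eq by (rule tendsto_cnj[OF lim[OF ab]])
    then show "F b a = cnj (F a b)" using lim[OF ab(2,1)] LIMSEQ_unique by blast
  next
    fix x
    have "0 \<le> ?h (E n) x" for n using st[of n] unfolding storage_form_def psd_form_def by blast
    then show "0 \<le> ?h F x" by (intro LIMSEQ_le_const[OF hlim]) auto
  qed
  moreover have "F 0 0 = 1"
    using lim[of 0 0] st by (simp add: storage_form_def LIMSEQ_const_iff)
  moreover have "F a b = 0" if "a \<in> ?I" "b \<in> ?I" "channel_colour k a \<noteq> channel_colour k b" for a b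
  proof -
    have "E n a b = 0" for n using st[of n] that unfolding storage_form_def by blast
    then show ?thesis using lim[OF that(1,2)] by (simp add: LIMSEQ_const_iff)
  qed
  ultimately have "storage_form S k F" unfolding storage_form_def by blast
  moreover have "?h F (apply_sys S T x) \<le> ?h F x" for x
  proof -
    have "(\<lambda>n. inverse (real (Suc (r n)))) \<longlonglongrightarrow> 0"
      using LIMSEQ_subseq_LIMSEQ[OF LIMSEQ_inverse_real_of_nat r] by (simp add: o_def)
    then have "(\<lambda>n. ?h (E (r n)) x + inverse (real (Suc (r n))) * (\<Sum>a\<in>?I. cmod (x a))\<^sup>2) \<longlonglongrightarrow>
        ?h F x + 0 * (\<Sum>a\<in>?I. cmod (x a))\<^sup>2"
      by (intro tendsto_intros hlim)
    then show ?thesis using hlim[of "apply_sys S T x"] le by (intro LIMSEQ_le[of _ _ _ "?h F x"]) auto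
  qed
  ultimately show ?thesis by blast
qed

text \<open>With \<open>E = L\<^sup>* L\<close>, where \<open>L i a\<close> is written \<open>x a i\<close>, the inequality makes the map from the
  columns of \<open>L\<close> to those of \<open>L T\<close> contractive, which yields \<open>T'\<close> with \<open>T' L = L T\<close>.
  The reachable vectors of \<open>T'\<close> are the images under \<open>L\<close> of those of \<open>T\<close>, up to the unimodular number \<open>u = L 0 0\<close>.\<close>

lemma contractive_system_from_storage_form:
  assumes sys: "is_system d S k" and E: "storage_form S k E"
    and le: "\<And>x. herm_form (insert 0 S) E (apply_sys S T x) \<le> herm_form (insert 0 S) E x"
  shows "\<exists>T'. (\<forall>w. word_coeff S T' k w = word_coeff S T k w) \<and>
    (\<forall>v. sqnorm (insert 0 S) (apply_sys S T' v) \<le> sqnorm (insert 0 S) v)"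
proof -
  let ?I = "insert 0 S"
  have S: "finite S" "0 \<notin> S" using sys by (auto simp: is_system_def)
  have S0: "a \<noteq> 0" if "a \<in> S" for a using that S(2) by metis
  obtain x where x: "\<And>a b. a \<in> ?I \<Longrightarrow> b \<in> ?I \<Longrightarrow> E a b = (\<Sum>c\<in>?I. x a c * cnj (x b c))"
    and xk: "\<And>a c. a \<in> ?I \<Longrightarrow> c \<in> ?I \<Longrightarrow> channel_colour k a \<noteq> channel_colour k c \<Longrightarrow> x a c = 0"
    using storage_form_factorization[OF S(1) E] by blast
  have h: "herm_form ?I E v = sqnorm ?I (\<lambda>c. \<Sum>a\<in>?I. v a * x a c)" for v
    unfolding sqnorm_def by (rule herm_form_gram[OF x])
  define q where "q = (\<lambda>a c. \<Sum>b\<in>?I. T b a * x b c)"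
  have "sqnorm ?I (\<lambda>c. \<Sum>a\<in>?I. v a * q a c) \<le> sqnorm ?I (\<lambda>c. \<Sum>a\<in>?I. v a * x a c)" for v
  proof -
    have "(\<Sum>a\<in>?I. v a * q a c) = (\<Sum>b\<in>?I. apply_sys S T v b * x b c)" for c
      unfolding q_def apply_sys_def sum_distrib_left sum_distrib_right
      by (subst sum.swap) (simp only: ac_simps)
    then show ?thesis using le[of v] unfolding h by simp
  qed
  then obtain T' where T': "\<And>a i. a \<in> ?I \<Longrightarrow> i \<in> ?I \<Longrightarrow> (\<Sum>j\<in>?I. T' i j * x a j) = q a i"
    and con: "\<And>v. sqnorm ?I (\<lambda>i. \<Sum>j\<in>?I. T' i j * v j) \<le> sqnorm ?I v"
    using contraction_from_gram_inequality[of ?I ?I q x] S(1) by blast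
  have app: "apply_sys S T' (\<lambda>j. \<Sum>a\<in>?I. v a * x a j) i = (\<Sum>b\<in>?I. apply_sys S T v b * x b i)"
    if i: "i \<in> ?I" for v i
  proof -
    have "apply_sys S T' (\<lambda>j. \<Sum>a\<in>?I. v a * x a j) i = (\<Sum>a\<in>?I. v a * (\<Sum>j\<in>?I. T' i j * x a j))"
      unfolding apply_sys_def sum_distrib_left by (subst sum.swap) (simp only: ac_simps)
    also have "\<dots> = (\<Sum>a\<in>?I. v a * q a i)" using T' i by simp
    also have "\<dots> = (\<Sum>b\<in>?I. apply_sys S T v b * x b i)"
      unfolding q_def apply_sys_def sum_distrib_left sum_distrib_right
      by (subst sum.swap) (simp only: ac_simps)
    finally show ?thesis .
  qed
  define u where "u = x 0 0"
  have x0: "x 0 c = 0" "x c 0 = 0" if "c \<in> S" for c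
  proof -
    have "c \<noteq> 0" using that S(2) by metis
    then show "x 0 c = 0" "x c 0 = 0" using xk[of 0 c] xk[of c 0] that by (auto simp: channel_colour_def)
  qed
  have "E 0 0 = u * cnj u" using x[of 0 0] S x0 by (simp add: u_def)
  then have u: "u \<noteq> 0" using E by (auto simp: storage_form_def)
  have r: "i \<in> ?I \<Longrightarrow> u * reach S T' k w i = (\<Sum>a\<in>?I. reach S T k w a * x a i)" for w i
  proof (induction w arbitrary: i)
    case Nil
    have "(\<Sum>a\<in>S. input_vec a * x a i) = 0" using S by (intro sum.neutral) (auto simp: input_vec_def)
    then show ?case using Nil S x0 by (auto simp: input_vec_def[of 0] input_vec_def[of i] u_def)
  next
    case (Cons c w)
    show ?case
    proof (cases "i \<in> S \<and> k i = c")
      case True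
      have "u * reach S T' k (c # w) i = apply_sys S T' (\<lambda>j. u * reach S T' k w j) i"
        using True by (simp add: apply_sys_def sum_distrib_left ac_simps)
      also have "\<dots> = apply_sys S T' (\<lambda>j. \<Sum>a\<in>?I. reach S T k w a * x a j) i"
        unfolding apply_sys_def using Cons.IH by (intro sum.cong refl) simp
      also have "\<dots> = (\<Sum>b\<in>?I. apply_sys S T (reach S T k w) b * x b i)" using app True by simp
      also have "\<dots> = (\<Sum>b\<in>?I. reach S T k (c # w) b * x b i)"
      proof (intro sum.cong refl)
        fix b assume "b \<in> ?I"
        then show "apply_sys S T (reach S T k w) b * x b i = reach S T k (c # w) b * x b i"
          using xk[of b i] True S0 x0 by (cases "b = 0") (auto simp: channel_colour_def)
      qed
      finally show ?thesis .
    next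
      case False
      have "(\<Sum>b\<in>?I. reach S T k (c # w) b * x b i) = 0"
      proof (intro sum.neutral ballI)
        fix b assume "b \<in> ?I"
        then show "reach S T k (c # w) b * x b i = 0"
          using xk[of b i] Cons.prems False S0
          by (cases "b = 0"; cases "i = 0") (auto simp: channel_colour_def)
      qed
      then show ?thesis using False by auto
    qed
  qed
  have "word_coeff S T' k w = word_coeff S T k w" for w
  proof -
    have "u * word_coeff S T' k w = apply_sys S T' (\<lambda>j. u * reach S T' k w j) 0"
      by (simp add: word_coeff_def apply_sys_def sum_distrib_left ac_simps)
    also have "\<dots> = apply_sys S T' (\<lambda>j. \<Sum>a\<in>?I. reach S T k w a * x a j) 0"
      unfolding apply_sys_def using r by (intro sum.cong refl) simp
    also have "\<dots> = (\<Sum>b\<in>?I. apply_sys S T (reach S T k w) b * x b 0)" by (rule app) simp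
    also have "\<dots> = u * word_coeff S T k w" using S x0 by (simp add: word_coeff_def u_def)
    finally show ?thesis using u by simp
  qed
  moreover have "apply_sys S T' v = (\<lambda>i. \<Sum>j\<in>?I. T' i j * v j)" for v
    by (rule ext) (simp only: apply_sys_def)
  ultimately show ?thesis using con by (intro exI[of _ T']) (simp only: simp_thms)
qed

theorem contractive_realization:
  assumes sys: "is_system d S k"
    and fh: "\<And>S' T' k'. is_system d S' k' \<Longrightarrow> (\<forall>w. word_coeff S' T' k' w = word_coeff S T k w) \<Longrightarrow>
      finite_horizon_contractive d S' T' k'"
  shows "\<exists>S' T' k'. is_system d S' k' \<and> (\<forall>w. word_coeff S' T' k' w = word_coeff S T k w) \<and>
    (\<forall>v. sqnorm (insert 0 S') (apply_sys S' T' v) \<le> sqnorm (insert 0 S') v)"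
proof -
  obtain S' T' k' where min: "minimal_system d S' T' k'" and co: "\<forall>w. word_coeff S' T' k' w = word_coeff S T k w"
    using minimal_system_exists[OF sys] by blast
  have sys': "is_system d S' k'" using min by (simp add: minimal_system_def)
  obtain W C where rb: "reachable_by d S' T' k' W C" using minimal_system_reachability_estimate[OF min] by blast
  note stat = stationary_form_contractive[OF sys' fh[OF sys' co] rb]
  have approx: "\<exists>E. storage_form S' k' E \<and> (\<forall>x. herm_form (insert 0 S') E (apply_sys S' T' x)
      \<le> herm_form (insert 0 S') E x + \<epsilon> * (\<Sum>a\<in>insert 0 S'. cmod (x a))\<^sup>2)" if "0 < \<epsilon>" for \<epsilon>
    by (rule approximate_storage_form[OF sys' _ that]) (rule stat)
  obtain E where "storage_form S' k' E"
    "\<And>x. herm_form (insert 0 S') E (apply_sys S' T' x) \<le> herm_form (insert 0 S') E x"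
    using exact_storage_form[OF sys' rb approx] by blast
  from contractive_system_from_storage_form[OF sys' this] co sys' show ?thesis by metis
qed

section \<open>Indices of block matrices\<close>

lemma index_less_mult: "\<alpha> < N \<Longrightarrow> i < n \<Longrightarrow> \<alpha> * n + i < N * (n :: nat)"
proof -
  assume "\<alpha> < N" "i < n"
  then have "\<alpha> * n + i < Suc \<alpha> * n" by simp
  also have "\<dots> \<le> N * n" using \<open>\<alpha> < N\<close> by (intro mult_le_mono1) auto
  finally show ?thesis .
qed

lemma div_less_mult: "i < n * m \<Longrightarrow> i div m < (n :: nat)"
  by (simp add: less_mult_imp_div_less)

lemma sum_prod_index:
  fixes f :: "nat \<Rightarrow> 'a :: comm_monoid_add"
  shows "(\<Sum>p<N * n. f p) = (\<Sum>a<N. \<Sum>i<n. f (a * n + i))"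
proof -
  have "sum f {a * n..<a * n + n} = (\<Sum>i<n. f (a * n + i))" for a
    using sum.shift_bounds_nat_ivl[of f 0 "a * n" n] by (simp add: atLeast0LessThan add.commute)
  then show ?thesis unfolding sum.nat_group[symmetric] by simp
qed

section \<open>Evaluation at tuples given by their entries\<close>

definition mat_act :: "nat \<Rightarrow> complex mat \<Rightarrow> (nat \<Rightarrow> complex) \<Rightarrow> nat \<Rightarrow> complex" where
  "mat_act n W x i = (\<Sum>j<n. W $$ (i, j) * x j)"

definition tuple_of :: "nat \<Rightarrow> nat \<Rightarrow> (nat \<Rightarrow> nat \<Rightarrow> nat \<Rightarrow> complex) \<Rightarrow> complex mat list" where
  "tuple_of d n z = map (\<lambda>c. mat n n (\<lambda>(i, j). z c i j)) [0..<d]"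

lemma tuple_of_mat_tuples: "tuple_of d n z \<in> mat_tuples d n"
  by (auto simp: tuple_of_def mat_tuples_def)

lemma tuple_of_nth: "c < d \<Longrightarrow> tuple_of d n z ! c = mat n n (\<lambda>(i, j). z c i j)"
  by (simp add: tuple_of_def)

lemma mat_tuple_eq_tuple_of: "Z \<in> mat_tuples d n \<Longrightarrow> Z = tuple_of d n (\<lambda>c i j. (Z ! c) $$ (i, j))"
  unfolding mat_tuples_def tuple_of_def
  by (intro nth_equalityI) (auto intro!: eq_matI simp: subset_iff in_set_conv_nth)

lemma mat_mult_entry:
  "V \<in> carrier_mat n m \<Longrightarrow> W \<in> carrier_mat m l \<Longrightarrow> i < n \<Longrightarrow> j < l \<Longrightarrow>
    (V * W) $$ (i, j) = (\<Sum>h<m. V $$ (i, h) * W $$ (h, j))"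
  by (simp add: scalar_prod_def atLeast0LessThan)

lemma mat_act_mult:
  assumes "V \<in> carrier_mat n n" "W \<in> carrier_mat n n" "i < n"
  shows "mat_act n (V * W) x i = mat_act n V (mat_act n W x) i"
proof -
  have "mat_act n (V * W) x i = (\<Sum>j<n. \<Sum>h<n. V $$ (i, h) * W $$ (h, j) * x j)"
    unfolding mat_act_def by (intro sum.cong refl) (use assms in \<open>simp add: mat_mult_entry[of V n n W n] sum_distrib_right del: index_mult_mat\<close>)
  also have "\<dots> = mat_act n V (mat_act n W x) i"
    unfolding mat_act_def sum_distrib_left by (subst sum.swap) (simp only: ac_simps)
  finally show ?thesis .
qed

lemma mat_act_cong: "(\<And>j. j < n \<Longrightarrow> x j = y j) \<Longrightarrow> mat_act n W x i = mat_act n W y i"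
  unfolding mat_act_def by simp

lemma mat_act_one: "i < n \<Longrightarrow> mat_act n (1\<^sub>m n) x i = x i"
proof -
  assume i: "i < n"
  have "mat_act n (1\<^sub>m n) x i = (\<Sum>j<n. if j = i then x j else 0)"
    unfolding mat_act_def using i by (intro sum.cong) auto
  then show ?thesis using i by simp
qed

lemma mat_inverse_Some:
  assumes "A \<in> carrier_mat n n" "mat_inverse (A :: complex mat) = Some B"
  shows "A * B = 1\<^sub>m n" "B * A = 1\<^sub>m n" "B \<in> carrier_mat n n"
  using mat_inverse(2)[OF assms] by auto

lemma mat_inverse_eq_SomeI:
  fixes A :: "complex mat"
  assumes A: "A \<in> carrier_mat n n" and B: "B \<in> carrier_mat n n" and AB: "A * B = 1\<^sub>m n" "B * A = 1\<^sub>m n"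
  shows "mat_inverse A = Some B"
proof (cases "mat_inverse A")
  case None
  from mat_inverse(1)[OF A None, where b = "()"] have "A \<notin> Units (ring_mat TYPE(complex) n ())" .
  moreover have "A \<in> Units (ring_mat TYPE(complex) n ())"
    unfolding Units_def ring_mat_def using A B AB by auto
  ultimately show ?thesis by simp
next
  case (Some C)
  note C = mat_inverse_Some[OF A Some]
  have "C = C * (A * B)" using C(3) AB by simp
  also have "\<dots> = (C * A) * B" by (rule assoc_mult_mat[symmetric]) (use A B C in auto)
  finally show ?thesis using C B Some by simp
qed

lemma nc_eval_carrier:
  "Z \<in> mat_tuples d n \<Longrightarrow> nc_vars r \<subseteq> {..<d} \<Longrightarrow> nc_eval n Z r = Some V \<Longrightarrow> V \<in> carrier_mat n n"
proof (induction r arbitrary: V)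
  case (Var x)
  then show ?case by (auto simp: mat_tuples_def subset_iff)
next
  case (Inv r)
  from Inv.prems obtain U where U: "nc_eval n Z r = Some U" "mat_inverse U = Some V"
    by (auto simp: bind_eq_Some_conv)
  with Inv have "U \<in> carrier_mat n n" by simp
  then show ?case using mat_inverse_Some(3) U by blast
qed (auto simp: bind_eq_Some_conv)

section \<open>Realization of expressions\<close>

definition state_eqs ::
  "nat set \<Rightarrow> (nat \<Rightarrow> nat \<Rightarrow> complex) \<Rightarrow> (nat \<Rightarrow> nat) \<Rightarrow> nat \<Rightarrow> (nat \<Rightarrow> nat \<Rightarrow> nat \<Rightarrow> complex) \<Rightarrow>
    (nat \<Rightarrow> nat \<Rightarrow> complex) \<Rightarrow> bool" where
  "state_eqs S T k n z X \<longleftrightarrow>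
    (\<forall>a\<in>S. \<forall>i<n. X a i = (\<Sum>j<n. z (k a) i j * apply_sys S T (\<lambda>b. X b j) a))"

text \<open>Nothing is claimed about solvability of the state equations. This makes the property stable under all
  operations, inverses included, at every point where the expression is defined.\<close>

definition realizes :: "nat \<Rightarrow> nat nc_expr \<Rightarrow> nat set \<Rightarrow> (nat \<Rightarrow> nat \<Rightarrow> complex) \<Rightarrow> (nat \<Rightarrow> nat) \<Rightarrow> bool" where
  "realizes d r S T k \<longleftrightarrow> (\<forall>n z X W. nc_eval n (tuple_of d n z) r = Some W \<longrightarrow> state_eqs S T k n z X \<longrightarrow>
     (\<forall>i<n. mat_act n W (X 0) i = apply_sys S T (\<lambda>b. X b i) 0))"

lemma apply_sys_insert: "finite S \<Longrightarrow> 0 \<notin> S \<Longrightarrow> apply_sys S T x a = T a 0 * x 0 + (\<Sum>b\<in>S. T a b * x b)"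
  by (simp add: apply_sys_def)

lemma realizes_Add:
  assumes S: "finite S" "finite S'" "0 \<notin> S" "0 \<notin> S'" "S \<inter> S' = {}"
    and vars: "nc_vars r \<subseteq> {..<d}" "nc_vars s \<subseteq> {..<d}"
    and r: "realizes d r S T k" and s: "realizes d s S' T' k'"
  shows "\<exists>U. realizes d (Add r s) (S \<union> S') U (\<lambda>a. if a \<in> S then k a else k' a)"
proof -
  define U where "U a b = (if a = 0 then (if b = 0 then T 0 0 + T' 0 0 else if b \<in> S then T 0 b else T' 0 b)
    else if a \<in> S then (if b \<in> S' then 0 else T a b) else (if b \<in> S then 0 else T' a b))" for a b :: nat
  have dis: "b \<notin> S" if "b \<in> S'" for b using that S by auto
  have nz: "b \<noteq> 0" if "b \<in> S \<or> b \<in> S'" for b using that S by metis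
  have U0: "apply_sys (S \<union> S') U x 0 = apply_sys S T x 0 + apply_sys S' T' x 0" for x
  proof -
    have "(\<Sum>b\<in>S. U 0 b * x b) = (\<Sum>b\<in>S. T 0 b * x b)" "(\<Sum>b\<in>S'. U 0 b * x b) = (\<Sum>b\<in>S'. T' 0 b * x b)"
      using dis nz S(3,4) by (auto simp: U_def intro!: sum.cong)
    then show ?thesis using S by (simp add: apply_sys_insert sum.union_disjoint U_def[of 0 0] algebra_simps)
  qed
  have US: "apply_sys (S \<union> S') U x a = apply_sys S T x a" if "a \<in> S" for x a
  proof -
    have "(\<Sum>b\<in>S. U a b * x b) = (\<Sum>b\<in>S. T a b * x b)" "(\<Sum>b\<in>S'. U a b * x b) = 0" "U a 0 = T a 0"
      using dis nz that S by (auto simp: U_def intro!: sum.cong sum.neutral)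
    then show ?thesis using S by (simp add: apply_sys_insert sum.union_disjoint)
  qed
  have US': "apply_sys (S \<union> S') U x a = apply_sys S' T' x a" if "a \<in> S'" for x a
  proof -
    have "(\<Sum>b\<in>S. U a b * x b) = 0" "(\<Sum>b\<in>S'. U a b * x b) = (\<Sum>b\<in>S'. T' a b * x b)" "U a 0 = T' a 0"
      using dis nz that S by (auto simp: U_def intro!: sum.cong sum.neutral)
    then show ?thesis using S by (simp add: apply_sys_insert sum.union_disjoint)
  qed
  have "realizes d (Add r s) (S \<union> S') U (\<lambda>a. if a \<in> S then k a else k' a)"
    unfolding realizes_def
  proof (intro allI impI)
    fix n z X W i
    assume W: "nc_eval n (tuple_of d n z) (Add r s) = Some W" and i: "i < n"
      and X: "state_eqs (S \<union> S') U (\<lambda>a. if a \<in> S then k a else k' a) n z X"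
    from W obtain V V' where V: "nc_eval n (tuple_of d n z) r = Some V" "nc_eval n (tuple_of d n z) s = Some V'" "W = V + V'"
      by (auto simp: bind_eq_Some_conv)
    note car = nc_eval_carrier[OF tuple_of_mat_tuples vars(1) V(1)] nc_eval_carrier[OF tuple_of_mat_tuples vars(2) V(2)]
    have "state_eqs S T k n z X" using X US unfolding state_eqs_def by auto
    moreover have "state_eqs S' T' k' n z X" using X US' dis unfolding state_eqs_def by auto
    ultimately have "mat_act n V (X 0) i + mat_act n V' (X 0) i = apply_sys (S \<union> S') U (\<lambda>b. X b i) 0"
      using r s V i unfolding realizes_def U0 by auto
    moreover have "mat_act n W (X 0) i = mat_act n V (X 0) i + mat_act n V' (X 0) i"
      unfolding mat_act_def sum.distrib[symmetric] using car i V(3) by (intro sum.cong) (auto simp: algebra_simps)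
    ultimately show "mat_act n W (X 0) i = apply_sys (S \<union> S') U (\<lambda>b. X b i) 0" by simp
  qed
  then show ?thesis by blast
qed

text \<open>Cascade connection: the output of the system for \<open>s\<close> is the input of the one for \<open>r\<close>.\<close>

lemma realizes_Mult:
  assumes S: "finite S" "finite S'" "0 \<notin> S" "0 \<notin> S'" "S \<inter> S' = {}"
    and vars: "nc_vars r \<subseteq> {..<d}" "nc_vars s \<subseteq> {..<d}"
    and r: "realizes d r S T k" and s: "realizes d s S' T' k'"
  shows "\<exists>U. realizes d (Mult r s) (S \<union> S') U (\<lambda>a. if a \<in> S then k a else k' a)"
proof -
  define U where "U a b = (if a \<in> S' then (if b \<in> S then 0 else T' a b)
    else if b \<in> S then T a b else T a 0 * T' 0 b)" for a b :: nat
  have dis: "b \<notin> S" if "b \<in> S'" for b using that S by auto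
  have US: "apply_sys (S \<union> S') U x a = apply_sys S T (x(0 := apply_sys S' T' x 0)) a" if "a \<notin> S'" for x a
  proof -
    have "(\<Sum>b\<in>S. U a b * x b) = (\<Sum>b\<in>S. T a b * (x(0 := apply_sys S' T' x 0)) b)"
      using S that by (intro sum.cong refl) (auto simp: U_def)
    moreover have "(\<Sum>b\<in>S'. U a b * x b) = T a 0 * (\<Sum>b\<in>S'. T' 0 b * x b)"
      unfolding sum_distrib_left using dis that by (intro sum.cong refl) (auto simp: U_def)
    moreover have "U a 0 = T a 0 * T' 0 0" using S that by (simp add: U_def)
    ultimately show ?thesis using S by (simp add: apply_sys_insert sum.union_disjoint algebra_simps)
  qed
  have US': "apply_sys (S \<union> S') U x a = apply_sys S' T' x a" if "a \<in> S'" for x a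
  proof -
    have "(\<Sum>b\<in>S. U a b * x b) = 0" "(\<Sum>b\<in>S'. U a b * x b) = (\<Sum>b\<in>S'. T' a b * x b)" "U a 0 = T' a 0"
      using dis that S by (auto simp: U_def intro!: sum.cong sum.neutral)
    then show ?thesis using S by (simp add: apply_sys_insert sum.union_disjoint)
  qed
  have "realizes d (Mult r s) (S \<union> S') U (\<lambda>a. if a \<in> S then k a else k' a)"
    unfolding realizes_def
  proof (intro allI impI)
    fix n z X W i
    assume W: "nc_eval n (tuple_of d n z) (Mult r s) = Some W" and i: "i < n"
      and X: "state_eqs (S \<union> S') U (\<lambda>a. if a \<in> S then k a else k' a) n z X"
    from W obtain V V' where V: "nc_eval n (tuple_of d n z) r = Some V" "nc_eval n (tuple_of d n z) s = Some V'" "W = V * V'"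
      by (auto simp: bind_eq_Some_conv)
    note car = nc_eval_carrier[OF tuple_of_mat_tuples vars(1) V(1)] nc_eval_carrier[OF tuple_of_mat_tuples vars(2) V(2)]
    define Y where "Y = (\<lambda>b j. if b = 0 then apply_sys S' T' (\<lambda>b. X b j) 0 else X b j)"
    have Yj: "(\<lambda>b. Y b j) = (\<lambda>b. X b j)(0 := apply_sys S' T' (\<lambda>b. X b j) 0)" for j
      by (auto simp: Y_def)
    have "state_eqs S' T' k' n z X" using X US' dis unfolding state_eqs_def by auto
    then have v': "mat_act n V' (X 0) j = Y 0 j" if "j < n" for j
      using s V(2) that unfolding realizes_def by (simp add: Y_def)
    have "state_eqs S T k n z Y"
      unfolding state_eqs_def
    proof (intro ballI allI impI)
      fix a j assume a: "a \<in> S" and j: "j < n"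
      have "a \<notin> S'" "a \<noteq> 0" using a S by auto
      then have "Y a j = X a j" by (simp add: Y_def)
      also have "\<dots> = (\<Sum>l<n. z (k a) j l * apply_sys (S \<union> S') U (\<lambda>b. X b l) a)"
        using X a j unfolding state_eqs_def by auto
      finally show "Y a j = (\<Sum>l<n. z (k a) j l * apply_sys S T (\<lambda>b. Y b l) a)"
        unfolding US[OF \<open>a \<notin> S'\<close>] Yj .
    qed
    then have "mat_act n V (Y 0) i = apply_sys S T (\<lambda>b. Y b i) 0"
      using r V(1) i unfolding realizes_def by blast
    also have "\<dots> = apply_sys (S \<union> S') U (\<lambda>b. X b i) 0" using US[of 0] S unfolding Yj by simp
    finally have "mat_act n V (Y 0) i = apply_sys (S \<union> S') U (\<lambda>b. X b i) 0" .
    moreover have "mat_act n V (mat_act n V' (X 0)) i = mat_act n V (Y 0) i" by (intro mat_act_cong v')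
    ultimately show "mat_act n W (X 0) i = apply_sys (S \<union> S') U (\<lambda>b. X b i) 0"
      unfolding V(3) mat_act_mult[OF car i] by simp
  qed
  then show ?thesis by blast
qed

lemma realizes_Scale:
  assumes S: "finite S" "0 \<notin> S" and vars: "nc_vars r \<subseteq> {..<d}" and r: "realizes d r S T k"
  shows "realizes d (Scale c r) S (\<lambda>a b. if a = 0 then c * T a b else T a b) k"
  unfolding realizes_def
proof (intro allI impI)
  fix n z X W i
  let ?U = "\<lambda>a b. if a = 0 then c * T a b else T a b"
  assume W: "nc_eval n (tuple_of d n z) (Scale c r) = Some W" and i: "i < n" and X: "state_eqs S ?U k n z X"
  from W obtain V where V: "nc_eval n (tuple_of d n z) r = Some V" "W = c \<cdot>\<^sub>m V" by auto
  note car = nc_eval_carrier[OF tuple_of_mat_tuples vars(1) V(1)]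
  have "apply_sys S ?U x a = apply_sys S T x a" if "a \<in> S" for x a
  proof -
    have "a \<noteq> 0" using that S(2) by metis
    then show ?thesis by (simp add: apply_sys_def)
  qed
  then have "state_eqs S T k n z X" using X unfolding state_eqs_def by simp
  then have "c * mat_act n V (X 0) i = c * apply_sys S T (\<lambda>b. X b i) 0"
    using r V i unfolding realizes_def by simp
  moreover have "mat_act n W (X 0) i = c * mat_act n V (X 0) i"
    unfolding mat_act_def sum_distrib_left using car i V(2) by (intro sum.cong) (auto simp: algebra_simps)
  ultimately show "mat_act n W (X 0) i = apply_sys S ?U (\<lambda>b. X b i) 0"
    by (simp add: apply_sys_def sum_distrib_left mult.assoc)
qed

lemma realizes_at_zero:
  assumes "0 \<notin> S" "finite S" "realizes d r S T k" "nc_eval 1 (tuple_of d 1 (\<lambda>_ _ _. 0)) r = Some W"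
  shows "T 0 0 = W $$ (0, 0)"
proof -
  have S0: "b \<noteq> 0" if "b \<in> S" for b using that assms(1) by metis
  have "state_eqs S T k 1 (\<lambda>_ _ _. 0) (\<lambda>b i. input_vec b)"
    using S0 unfolding state_eqs_def by (auto simp: input_vec_def)
  then have "mat_act 1 W (\<lambda>i. input_vec 0) 0 = apply_sys S T input_vec 0"
    using assms(3,4) unfolding realizes_def by blast
  moreover have "(\<Sum>b\<in>S. T 0 b * input_vec b) = 0"
    using assms by (intro sum.neutral) (auto simp: input_vec_def)
  ultimately show ?thesis using assms by (simp add: apply_sys_insert mat_act_def input_vec_def[of 0])
qed

text \<open>The inverse system exchanges the roles of input and output. This is possible as the direct term
  \<open>T 0 0\<close> can be inverted.\<close>

lemma realizes_Inv:
  assumes S: "finite S" "0 \<notin> S" and vars: "nc_vars r \<subseteq> {..<d}" and r: "realizes d r S T k"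
    and nz: "T 0 0 \<noteq> 0"
  shows "\<exists>U. realizes d (Inv r) S U k"
proof -
  define U where "U a b = (if a = 0 then (if b = 0 then 1 / T 0 0 else - T 0 b / T 0 0)
     else if b = 0 then T a 0 / T 0 0 else T a b - T a 0 * T 0 b / T 0 0)" for a b :: nat
  have S0: "b \<noteq> 0" if "b \<in> S" for b using that S(2) by metis
  have U0: "apply_sys S U x 0 = (x 0 - (\<Sum>b\<in>S. T 0 b * x b)) / T 0 0" for x
  proof -
    have "(\<Sum>b\<in>S. U 0 b * x b) = - (\<Sum>b\<in>S. T 0 b * x b) / T 0 0"
      unfolding sum_divide_distrib sum_negf[symmetric] using S0 by (intro sum.cong refl) (auto simp: U_def)
    then show ?thesis using S by (simp add: apply_sys_insert U_def[of 0 0] diff_divide_distrib)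
  qed
  have Ua: "apply_sys S U x a = apply_sys S T (x(0 := apply_sys S U x 0)) a" if "a \<in> S" for x a
  proof -
    have "(\<Sum>b\<in>S. U a b * x b) = (\<Sum>b\<in>S. T a b * x b - (T a 0 / T 0 0) * (T 0 b * x b))"
      using S0 that by (intro sum.cong refl) (auto simp: U_def algebra_simps)
    also have "\<dots> = (\<Sum>b\<in>S. T a b * x b) - (T a 0 / T 0 0) * (\<Sum>b\<in>S. T 0 b * x b)"
      by (simp only: sum_subtractf sum_distrib_left)
    finally have "apply_sys S U x a = T a 0 * apply_sys S U x 0 + (\<Sum>b\<in>S. T a b * x b)"
      unfolding U0 using S S0[OF that] by (simp add: apply_sys_insert U_def[of a 0] algebra_simps diff_divide_distrib)
    moreover have "(\<Sum>b\<in>S. T a b * (x(0 := apply_sys S U x 0)) b) = (\<Sum>b\<in>S. T a b * x b)"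
      using S0 by (intro sum.cong refl) auto
    ultimately show ?thesis using S by (simp add: apply_sys_insert[of S T])
  qed
  have T0: "apply_sys S T (x(0 := apply_sys S U x 0)) 0 = x 0" for x
  proof -
    have "(\<Sum>b\<in>S. T 0 b * (x(0 := apply_sys S U x 0)) b) = (\<Sum>b\<in>S. T 0 b * x b)"
      using S0 by (intro sum.cong refl) auto
    then show ?thesis using nz S by (simp add: apply_sys_insert[of S T]) (simp add: U0)
  qed
  have "realizes d (Inv r) S U k"
    unfolding realizes_def
  proof (intro allI impI)
    fix n z X W i
    assume W: "nc_eval n (tuple_of d n z) (Inv r) = Some W" and i: "i < n" and X: "state_eqs S U k n z X"
    from W obtain V where V: "nc_eval n (tuple_of d n z) r = Some V" "mat_inverse V = Some W"
      by (auto simp: bind_eq_Some_conv)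
    note car = nc_eval_carrier[OF tuple_of_mat_tuples vars V(1)]
    note inv = mat_inverse_Some[OF car V(2)]
    define Y where "Y = (\<lambda>b j. if b = 0 then apply_sys S U (\<lambda>b. X b j) 0 else X b j)"
    have Yj: "(\<lambda>b. Y b j) = (\<lambda>b. X b j)(0 := apply_sys S U (\<lambda>b. X b j) 0)" for j
      by (auto simp: Y_def)
    have "state_eqs S T k n z Y"
      unfolding state_eqs_def
    proof (intro ballI allI impI)
      fix a j assume a: "a \<in> S" and j: "j < n"
      have "Y a j = X a j" using S0[OF a] by (simp add: Y_def)
      also have "\<dots> = (\<Sum>l<n. z (k a) j l * apply_sys S U (\<lambda>b. X b l) a)"
        using X a j unfolding state_eqs_def by blast
      finally show "Y a j = (\<Sum>l<n. z (k a) j l * apply_sys S T (\<lambda>b. Y b l) a)"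
        unfolding Ua[OF a] Yj .
    qed
    then have v: "mat_act n V (Y 0) j = X 0 j" if "j < n" for j
    proof -
      have "mat_act n V (Y 0) j = apply_sys S T (\<lambda>b. Y b j) 0"
        using r V(1) that \<open>state_eqs S T k n z Y\<close> unfolding realizes_def by blast
      then show ?thesis unfolding Yj T0 .
    qed
    have "mat_act n W (X 0) i = mat_act n W (mat_act n V (Y 0)) i" by (intro mat_act_cong v[symmetric])
    also have "\<dots> = mat_act n (W * V) (Y 0) i" using mat_act_mult[OF inv(3) car i] by simp
    also have "\<dots> = Y 0 i" unfolding inv(2) using i by (rule mat_act_one)
    finally show "mat_act n W (X 0) i = apply_sys S U (\<lambda>b. X b i) 0" by (simp add: Y_def)
  qed
  then show ?thesis by blast
qed

text \<open>States above a prescribed bound \<open>m\<close> allow making the states of two systems disjoint without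
  renaming.\<close>

definition has_realization_above :: "nat \<Rightarrow> nat \<Rightarrow> nat nc_expr \<Rightarrow> bool" where
  "has_realization_above d m r \<longleftrightarrow>
    (\<exists>S T k. finite S \<and> (\<forall>a\<in>S. m < a) \<and> k ` S \<subseteq> {..<d} \<and> realizes d r S T k)"

lemma has_realization_aboveI:
  "finite S \<Longrightarrow> (\<And>a. a \<in> S \<Longrightarrow> m < a) \<Longrightarrow> k ` S \<subseteq> {..<d} \<Longrightarrow> realizes d r S T k \<Longrightarrow>
    has_realization_above d m r"
  unfolding has_realization_above_def by (intro exI conjI) auto

lemma has_realization_aboveE:
  assumes "has_realization_above d m r"
  obtains S k T where "finite S" "\<And>a. a \<in> S \<Longrightarrow> m < a" "k ` S \<subseteq> {..<d}" "realizes d r S T k"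
  using assms unfolding has_realization_above_def by (elim exE conjE) (rule that, auto)

text \<open>For inverses, the direct term is the value at the zero tuple of size \<open>1\<close>, which is invertible where the
  expression is regular.\<close>

lemma realization_exists:
  assumes "nc_vars r \<subseteq> {..<d}" and "nc_eval 1 (tuple_of d 1 (\<lambda>_ _ _. 0)) r \<noteq> None"
  shows "has_realization_above d m r"
  using assms
proof (induction r arbitrary: m)
  case (Var c)
  define S where "S = {Suc m}"
  define T where "T = (\<lambda>(a :: nat) (b :: nat). if a = 0 \<and> b = 0 then 0 else if a = 0 \<or> b = 0 then 1 else 0 :: complex)"
  have "realizes d (Var c) S T (\<lambda>_. c)"
    unfolding realizes_def
  proof (intro allI impI)
    fix n z X W i
    assume W: "nc_eval n (tuple_of d n z) (Var c) = Some W" and i: "i < n" and X: "state_eqs S T (\<lambda>_. c) n z X"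
    have "W = mat n n (\<lambda>(i, j). z c i j)" using W Var.prems by (simp add: tuple_of_nth)
    then have "mat_act n W (X 0) i = (\<Sum>j<n. z c i j * X 0 j)" unfolding mat_act_def using i by simp
    then show "mat_act n W (X 0) i = apply_sys S T (\<lambda>b. X b i) 0"
      using X i by (simp add: state_eqs_def S_def apply_sys_def T_def)
  qed
  then show ?case by (rule has_realization_aboveI[rotated 3]) (use Var.prems in \<open>auto simp: S_def\<close>)
next
  case One
  have "realizes d One {} (\<lambda>_ _. 1) k" for k
    unfolding realizes_def by (auto simp: apply_sys_def mat_act_one)
  then show ?case by (rule has_realization_aboveI[rotated 3]) auto
next
  case (Add r s)
  then have d: "nc_vars r \<subseteq> {..<d}" "nc_vars s \<subseteq> {..<d}" and
    e: "nc_eval 1 (tuple_of d 1 (\<lambda>_ _ _. 0)) r \<noteq> None" "nc_eval 1 (tuple_of d 1 (\<lambda>_ _ _. 0)) s \<noteq> None"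
    by (auto simp: bind_eq_Some_conv)
  from Add.IH(1)[OF d(1) e(1), of m]
  obtain S k T where 1: "finite S" "\<And>a. a \<in> S \<Longrightarrow> m < a" "k ` S \<subseteq> {..<d}" "realizes d r S T k"
    by (rule has_realization_aboveE) (rule that)
  from Add.IH(2)[OF d(2) e(2), of "Max (insert m S)"]
  obtain S' k' T' where 2: "finite S'" "\<And>a. a \<in> S' \<Longrightarrow> Max (insert m S) < a" "k' ` S' \<subseteq> {..<d}" "realizes d s S' T' k'"
    by (rule has_realization_aboveE) (rule that)
  have 3: "\<forall>a\<in>S'. m < a" "S \<inter> S' = {}" using 1(1) 2(2) by auto
  have 4: "0 \<notin> S" "0 \<notin> S'" using 1(2) 3(1) by auto
  from realizes_Add[OF 1(1) 2(1) 4 3(2) d 1(4) 2(4)] obtain U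
    where "realizes d (Add r s) (S \<union> S') U (\<lambda>a. if a \<in> S then k a else k' a)" by blast
  moreover have "(\<lambda>a. if a \<in> S then k a else k' a) ` (S \<union> S') \<subseteq> {..<d}" using 1(3) 2(3) by auto
  moreover have "finite (S \<union> S')" "\<And>a. a \<in> S \<union> S' \<Longrightarrow> m < a" using 1(1,2) 2(1) 3(1) by auto
  ultimately show ?case by (intro has_realization_aboveI)
next
  case (Mult r s)
  then have d: "nc_vars r \<subseteq> {..<d}" "nc_vars s \<subseteq> {..<d}" and
    e: "nc_eval 1 (tuple_of d 1 (\<lambda>_ _ _. 0)) r \<noteq> None" "nc_eval 1 (tuple_of d 1 (\<lambda>_ _ _. 0)) s \<noteq> None"
    by (auto simp: bind_eq_Some_conv)
  from Mult.IH(1)[OF d(1) e(1), of m]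
  obtain S k T where 1: "finite S" "\<And>a. a \<in> S \<Longrightarrow> m < a" "k ` S \<subseteq> {..<d}" "realizes d r S T k"
    by (rule has_realization_aboveE) (rule that)
  from Mult.IH(2)[OF d(2) e(2), of "Max (insert m S)"]
  obtain S' k' T' where 2: "finite S'" "\<And>a. a \<in> S' \<Longrightarrow> Max (insert m S) < a" "k' ` S' \<subseteq> {..<d}" "realizes d s S' T' k'"
    by (rule has_realization_aboveE) (rule that)
  have 3: "\<forall>a\<in>S'. m < a" "S \<inter> S' = {}" using 1(1) 2(2) by auto
  have 4: "0 \<notin> S" "0 \<notin> S'" using 1(2) 3(1) by auto
  from realizes_Mult[OF 1(1) 2(1) 4 3(2) d 1(4) 2(4)] obtain U
    where "realizes d (Mult r s) (S \<union> S') U (\<lambda>a. if a \<in> S then k a else k' a)" by blast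
  moreover have "(\<lambda>a. if a \<in> S then k a else k' a) ` (S \<union> S') \<subseteq> {..<d}" using 1(3) 2(3) by auto
  moreover have "finite (S \<union> S')" "\<And>a. a \<in> S \<union> S' \<Longrightarrow> m < a" using 1(1,2) 2(1) 3(1) by auto
  ultimately show ?case by (intro has_realization_aboveI)
next
  case (Scale c r)
  then have d: "nc_vars r \<subseteq> {..<d}" and e: "nc_eval 1 (tuple_of d 1 (\<lambda>_ _ _. 0)) r \<noteq> None" by auto
  from Scale.IH[OF d e, of m]
  obtain S k T where 1: "finite S" "\<And>a. a \<in> S \<Longrightarrow> m < a" "k ` S \<subseteq> {..<d}" "realizes d r S T k"
    by (rule has_realization_aboveE) (rule that)
  then have "0 \<notin> S" by auto
  from realizes_Scale[OF 1(1) this d 1(4)] 1(1,2,3) show ?case by (intro has_realization_aboveI)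
next
  case (Inv r)
  then have d: "nc_vars r \<subseteq> {..<d}" by simp
  from Inv.prems obtain W V where W: "nc_eval 1 (tuple_of d 1 (\<lambda>_ _ _. 0)) r = Some W" "mat_inverse W = Some V"
    by (auto simp: bind_eq_Some_conv)
  have "has_realization_above d m r" using Inv.IH[OF d, of m] W(1) by simp
  then obtain S k T where 1: "finite S" "\<And>a. a \<in> S \<Longrightarrow> m < a" "k ` S \<subseteq> {..<d}" "realizes d r S T k"
    by (rule has_realization_aboveE) (rule that)
  then have S0: "0 \<notin> S" by auto
  note car = nc_eval_carrier[OF tuple_of_mat_tuples d W(1)]
  note inv = mat_inverse_Some[OF car W(2)]
  have "W $$ (0, 0) * V $$ (0, 0) = (W * V) $$ (0, 0)"
    using mat_mult_entry[OF car inv(3), of 0 0] by simp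
  then have "W $$ (0, 0) \<noteq> 0" unfolding inv(1) by auto
  then have "T 0 0 \<noteq> 0" using realizes_at_zero[OF S0 1(1,4) W(1)] by simp
  from realizes_Inv[OF 1(1) S0 d 1(4) this] obtain U where "realizes d (Inv r) S U k" by blast
  with 1(1,2,3) show ?case by (rule has_realization_aboveI)
qed

section \<open>Rationality along curves\<close>

definition eval_mat :: "complex \<Rightarrow> complex poly mat \<Rightarrow> complex mat" where
  "eval_mat t P = map_mat (\<lambda>p. poly p t) P"

lemma eval_mat_carrier: "P \<in> carrier_mat n m \<Longrightarrow> eval_mat t P \<in> carrier_mat n m"
  by (simp add: eval_mat_def)

lemma eval_mat_entry: "P \<in> carrier_mat n m \<Longrightarrow> i < n \<Longrightarrow> j < m \<Longrightarrow> eval_mat t P $$ (i, j) = poly (P $$ (i, j)) t"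
  by (simp add: eval_mat_def)

lemma eval_mat_smult: "eval_mat t (q \<cdot>\<^sub>m P) = poly q t \<cdot>\<^sub>m eval_mat t P"
  by (intro eq_matI) (auto simp: eval_mat_def)

lemma eval_mat_one: "eval_mat t (1\<^sub>m n) = 1\<^sub>m n"
  by (intro eq_matI) (auto simp: eval_mat_def)

lemma eval_mat_mult:
  assumes "P \<in> carrier_mat n m" "Q \<in> carrier_mat m l"
  shows "eval_mat t (P * Q) = eval_mat t P * eval_mat t Q"
  unfolding eval_mat_def by (rule semiring_hom.mat_hom_mult[OF poly_hom.semiring_hom_axioms assms])

lemma det_eval_mat: "det (eval_mat t P) = poly (det P) t"
  unfolding eval_mat_def by (rule comm_ring_hom.hom_det[OF poly_hom.comm_ring_hom_axioms])

lemma smult_smult_mat: "a \<cdot>\<^sub>m (b \<cdot>\<^sub>m A) = (a * b :: 'a :: semigroup_mult) \<cdot>\<^sub>m A"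
  by (intro eq_matI) (auto simp: mult.assoc)

lemma smult_mult_smult_mat:
  fixes A B :: "complex mat"
  assumes "A \<in> carrier_mat n m" "B \<in> carrier_mat m l"
  shows "(a \<cdot>\<^sub>m A) * (b \<cdot>\<^sub>m B) = (a * b) \<cdot>\<^sub>m (A * B)"
  unfolding mult_smult_assoc_mat[OF assms(1) smult_carrier_mat[OF assms(2)]] mult_smult_distrib[OF assms]
    smult_smult_mat ..

text \<open>For inverses use Cramer's rule: \<open>(P / q)\<^sup>-\<^sup>1 = (q\<^sup>2 adj P) / (q det P)\<close>, and \<open>det P\<close> does not vanish at the
  parameter \<open>s\<close>, where the inverse exists.\<close>

lemma nc_eval_rational_along_curve:
  fixes z :: "nat \<Rightarrow> nat \<Rightarrow> nat \<Rightarrow> complex poly"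
  assumes "nc_vars r \<subseteq> {..<d}" and "nc_eval n (tuple_of d n (\<lambda>c i j. poly (z c i j) s)) r \<noteq> None"
  shows "\<exists>q P. poly q s \<noteq> 0 \<and> P \<in> carrier_mat n n \<and> (\<forall>t. poly q t \<noteq> 0 \<longrightarrow>
    nc_eval n (tuple_of d n (\<lambda>c i j. poly (z c i j) t)) r = Some ((1 / poly q t) \<cdot>\<^sub>m eval_mat t P))"
  using assms
proof (induction r)
  case (Var c)
  have "nc_eval n (tuple_of d n (\<lambda>c i j. poly (z c i j) t)) (Var c) =
     Some ((1 / poly 1 t) \<cdot>\<^sub>m eval_mat t (mat n n (\<lambda>(i, j). z c i j)))" for t
    using Var by (auto simp: tuple_of_nth eval_mat_def intro!: eq_matI)
  then show ?case
    by (intro exI[of _ 1] exI[of _ "mat n n (\<lambda>(i, j). z c i j)"]) auto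
next
  case One
  then show ?case by (intro exI[of _ 1] exI[of _ "1\<^sub>m n"]) (auto simp: eval_mat_one)
next
  case (Add r s')
  then obtain q P where 1: "poly q s \<noteq> 0" "P \<in> carrier_mat n n" "\<And>t. poly q t \<noteq> 0 \<Longrightarrow>
    nc_eval n (tuple_of d n (\<lambda>c i j. poly (z c i j) t)) r = Some ((1 / poly q t) \<cdot>\<^sub>m eval_mat t P)"
    by (auto simp: bind_eq_Some_conv)
  from Add obtain q' P' where 2: "poly q' s \<noteq> 0" "P' \<in> carrier_mat n n" "\<And>t. poly q' t \<noteq> 0 \<Longrightarrow>
    nc_eval n (tuple_of d n (\<lambda>c i j. poly (z c i j) t)) s' = Some ((1 / poly q' t) \<cdot>\<^sub>m eval_mat t P')"
    by (auto simp: bind_eq_Some_conv)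
  have "(1 / poly q t) \<cdot>\<^sub>m eval_mat t P + (1 / poly q' t) \<cdot>\<^sub>m eval_mat t P' =
      (1 / poly (q * q') t) \<cdot>\<^sub>m eval_mat t (q' \<cdot>\<^sub>m P + q \<cdot>\<^sub>m P')" if "poly (q * q') t \<noteq> 0" for t
    using 1(2) 2(2) that by (intro eq_matI) (auto simp: eval_mat_def field_simps)
  then show ?case using 1 2
    by (intro exI[of _ "q * q'"] exI[of _ "q' \<cdot>\<^sub>m P + q \<cdot>\<^sub>m P'"]) auto
next
  case (Mult r s')
  then obtain q P where 1: "poly q s \<noteq> 0" "P \<in> carrier_mat n n" "\<And>t. poly q t \<noteq> 0 \<Longrightarrow>
    nc_eval n (tuple_of d n (\<lambda>c i j. poly (z c i j) t)) r = Some ((1 / poly q t) \<cdot>\<^sub>m eval_mat t P)"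
    by (auto simp: bind_eq_Some_conv)
  from Mult obtain q' P' where 2: "poly q' s \<noteq> 0" "P' \<in> carrier_mat n n" "\<And>t. poly q' t \<noteq> 0 \<Longrightarrow>
    nc_eval n (tuple_of d n (\<lambda>c i j. poly (z c i j) t)) s' = Some ((1 / poly q' t) \<cdot>\<^sub>m eval_mat t P')"
    by (auto simp: bind_eq_Some_conv)
  have "(1 / poly q t) \<cdot>\<^sub>m eval_mat t P * ((1 / poly q' t) \<cdot>\<^sub>m eval_mat t P') =
      (1 / poly (q * q') t) \<cdot>\<^sub>m eval_mat t (P * P')" for t
    unfolding smult_mult_smult_mat[OF eval_mat_carrier[OF 1(2)] eval_mat_carrier[OF 2(2)]]
      eval_mat_mult[OF 1(2) 2(2)] by simp
  then show ?case using 1 2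
    by (intro exI[of _ "q * q'"] exI[of _ "P * P'"]) auto
next
  case (Scale c r)
  then obtain q P where 1: "poly q s \<noteq> 0" "P \<in> carrier_mat n n" "\<And>t. poly q t \<noteq> 0 \<Longrightarrow>
    nc_eval n (tuple_of d n (\<lambda>c i j. poly (z c i j) t)) r = Some ((1 / poly q t) \<cdot>\<^sub>m eval_mat t P)"
    by auto
  have "c \<cdot>\<^sub>m ((1 / poly q t) \<cdot>\<^sub>m eval_mat t P) = (1 / poly q t) \<cdot>\<^sub>m eval_mat t ([:c:] \<cdot>\<^sub>m P)" for t
    by (intro eq_matI) (auto simp: eval_mat_def)
  then show ?case using 1 by (intro exI[of _ q] exI[of _ "[:c:] \<cdot>\<^sub>m P"]) auto
next
  case (Inv r)
  then obtain q P where 1: "poly q s \<noteq> 0" and P: "P \<in> carrier_mat n n" and 2: "\<And>t. poly q t \<noteq> 0 \<Longrightarrow>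
    nc_eval n (tuple_of d n (\<lambda>c i j. poly (z c i j) t)) r = Some ((1 / poly q t) \<cdot>\<^sub>m eval_mat t P)"
    by (auto simp: bind_eq_Some_conv)
  let ?A = "\<lambda>t. (1 / poly q t) \<cdot>\<^sub>m eval_mat t P"
  have A: "?A t \<in> carrier_mat n n" for t using eval_mat_carrier[OF P] by simp
  from Inv.prems obtain B where "mat_inverse (?A s) = Some B" using 2[OF 1] by auto
  from mat_inverse_Some[OF A this] have B: "?A s * B = 1\<^sub>m n" "B \<in> carrier_mat n n" by auto
  have "det (?A s) * det B = 1" using det_mult[OF A B(2), of s] unfolding B(1) by simp
  then have "det (?A s) \<noteq> 0" by (metis mult_zero_left zero_neq_one)
  then have ds: "poly (det P) s \<noteq> 0" using 1 by (auto simp: det_eval_mat)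
  define R where "R = (q * q) \<cdot>\<^sub>m adj_mat P"
  note adj = adj_mat[OF P]
  have R: "R \<in> carrier_mat n n" using adj by (simp add: R_def)
  have "mat_inverse (?A t) = Some ((1 / poly (q * det P) t) \<cdot>\<^sub>m eval_mat t R)"
    if t: "poly (q * det P) t \<noteq> 0" for t
  proof (rule mat_inverse_eq_SomeI[OF A])
    have q: "poly q t \<noteq> 0" "poly (det P) t \<noteq> 0" using t by auto
    note cP = eval_mat_carrier[OF P, of t] and cR = eval_mat_carrier[OF R, of t]
    show "(1 / poly (q * det P) t) \<cdot>\<^sub>m eval_mat t R \<in> carrier_mat n n" using cR by simp
    have PR: "P * R = (q * q * det P) \<cdot>\<^sub>m 1\<^sub>m n" "R * P = (q * q * det P) \<cdot>\<^sub>m 1\<^sub>m n"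
      unfolding R_def mult_smult_distrib[OF P adj(1)] mult_smult_assoc_mat[OF adj(1) P] adj(2,3)
      by (simp_all add: smult_smult_mat)
    have fac: "1 / poly q t * (1 / poly (q * det P) t) * poly (q * q * det P) t = 1"
      "1 / poly (q * det P) t * (1 / poly q t) * poly (q * q * det P) t = 1"
      using q by (simp_all add: field_simps)
    show "?A t * ((1 / poly (q * det P) t) \<cdot>\<^sub>m eval_mat t R) = 1\<^sub>m n"
      unfolding smult_mult_smult_mat[OF cP cR] eval_mat_mult[OF P R, symmetric] PR eval_mat_smult eval_mat_one
        smult_smult_mat fac by (intro eq_matI) auto
    show "(1 / poly (q * det P) t) \<cdot>\<^sub>m eval_mat t R * ?A t = 1\<^sub>m n"
      unfolding smult_mult_smult_mat[OF cR cP] eval_mat_mult[OF R P, symmetric] PR eval_mat_smult eval_mat_one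
        smult_smult_mat fac by (intro eq_matI) auto
  qed
  then show ?case using 1 2 ds R
    by (intro exI[of _ "q * det P"] exI[of _ R]) auto
qed

section \<open>Independence of the representative\<close>

lemma kron_one_entry:
  assumes "A \<in> carrier_mat n l" "i < n * m" "j < l * m"
  shows "kron A (1\<^sub>m m) $$ (i, j) = (if i mod m = j mod m then A $$ (i div m, j div m) else 0)"
proof -
  have "m > 0" using assms(2) by (cases m) auto
  then show ?thesis using assms by (simp add: kron_def)
qed

lemma kron_one_carrier: "A \<in> carrier_mat n l \<Longrightarrow> kron A (1\<^sub>m m) \<in> carrier_mat (n * m) (l * m)"
  by (simp add: kron_def)

text \<open>Together with the two lemmas that follow, this says that \<open>X \<mapsto> X \<otimes> I\<close> commutes with the evaluation of
  expressions; it brings points of different sizes to a common size.\<close>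

lemma kron_one_mult:
  assumes A: "A \<in> carrier_mat n n" and B: "B \<in> carrier_mat n n"
  shows "kron A (1\<^sub>m m) * kron B (1\<^sub>m m) = kron (A * B) (1\<^sub>m m)"
proof (rule eq_matI)
  fix i j assume "i < dim_row (kron (A * B) (1\<^sub>m m))" "j < dim_col (kron (A * B) (1\<^sub>m m))"
  then have ij: "i < n * m" "j < n * m" using A B by (simp_all add: kron_def)
  then have m: "m > 0" by (cases m) auto
  note d = div_less_mult[OF ij(1)] div_less_mult[OF ij(2)]
  note idx = index_less_mult[of _ n _ m]
  have "(kron A (1\<^sub>m m) * kron B (1\<^sub>m m)) $$ (i, j) =
      (\<Sum>h<n * m. kron A (1\<^sub>m m) $$ (i, h) * kron B (1\<^sub>m m) $$ (h, j))"
    by (rule mat_mult_entry[OF kron_one_carrier[OF A] kron_one_carrier[OF B] ij])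
  also have "\<dots> = (\<Sum>a<n. \<Sum>l<m. if l = i mod m then (if i mod m = j mod m then A $$ (i div m, a) * B $$ (a, j div m) else 0) else 0)"
    unfolding sum_prod_index using ij idx A B
    by (intro sum.cong refl) (auto simp: kron_one_entry[of _ n n])
  also have "\<dots> = (\<Sum>a<n. (if i mod m = j mod m then A $$ (i div m, a) * B $$ (a, j div m) else 0))"
    using m by (intro sum.cong refl) (subst sum.delta, auto)
  also have "\<dots> = kron (A * B) (1\<^sub>m m) $$ (i, j)"
    using d by (simp add: kron_one_entry[OF mult_carrier_mat[OF A B] ij] mat_mult_entry[OF A B d] del: index_mult_mat)
  finally show "(kron A (1\<^sub>m m) * kron B (1\<^sub>m m)) $$ (i, j) = kron (A * B) (1\<^sub>m m) $$ (i, j)" .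
qed (use A B in \<open>auto simp: kron_def\<close>)

lemma kron_one_one: "kron (1\<^sub>m n) (1\<^sub>m m) = 1\<^sub>m (n * m)"
proof (rule eq_matI)
  fix i j assume "i < dim_row (1\<^sub>m (n * m) :: complex mat)" "j < dim_col (1\<^sub>m (n * m) :: complex mat)"
  then have ij: "i < n * m" "j < n * m" by auto
  have "i = j \<longleftrightarrow> i div m = j div m \<and> i mod m = j mod m" by (metis div_mult_mod_eq)
  then show "kron (1\<^sub>m n) (1\<^sub>m m) $$ (i, j) = (1\<^sub>m (n * m) :: complex mat) $$ (i, j)"
    using ij div_less_mult[OF ij(1)] div_less_mult[OF ij(2)] by (auto simp: kron_one_entry[of _ n n])
qed (auto simp: kron_def)

lemma nc_eval_ampliation:
  assumes Z: "Z \<in> mat_tuples d n"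
  shows "nc_vars r \<subseteq> {..<d} \<Longrightarrow> nc_eval n Z r = Some V \<Longrightarrow>
    nc_eval (n * m) (map (\<lambda>X. kron X (1\<^sub>m m)) Z) r = Some (kron V (1\<^sub>m m))"
proof (induction r arbitrary: V)
  case (Var c)
  then show ?case using Z by (auto simp: mat_tuples_def)
next
  case One
  then show ?case by (auto simp: kron_one_one)
next
  case (Add r s)
  then obtain U W where e: "nc_eval n Z r = Some U" "nc_eval n Z s = Some W" "V = U + W"
    by (auto simp: bind_eq_Some_conv)
  have "nc_vars r \<subseteq> {..<d}" "nc_vars s \<subseteq> {..<d}" using Add.prems by auto
  then have "U \<in> carrier_mat n n" "W \<in> carrier_mat n n"
    using nc_eval_carrier[OF Z _ e(1)] nc_eval_carrier[OF Z _ e(2)] by blast+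
  then have "kron U (1\<^sub>m m) + kron W (1\<^sub>m m) = kron (U + W) (1\<^sub>m m)"
    by (intro eq_matI) (auto simp: kron_def div_less_mult algebra_simps)
  then show ?case using Add.IH(1)[OF _ e(1)] Add.IH(2)[OF _ e(2)] Add.prems(1) e(3) by simp
next
  case (Mult r s)
  then obtain U W where e: "nc_eval n Z r = Some U" "nc_eval n Z s = Some W" "V = U * W"
    by (auto simp: bind_eq_Some_conv)
  have "nc_vars r \<subseteq> {..<d}" "nc_vars s \<subseteq> {..<d}" using Mult.prems by auto
  then have "U \<in> carrier_mat n n" "W \<in> carrier_mat n n"
    using nc_eval_carrier[OF Z _ e(1)] nc_eval_carrier[OF Z _ e(2)] by blast+
  from kron_one_mult[OF this, of m] show ?case
    using Mult.IH(1)[OF _ e(1)] Mult.IH(2)[OF _ e(2)] Mult.prems(1) e(3) by simp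
next
  case (Scale c r)
  then obtain U where e: "nc_eval n Z r = Some U" "V = c \<cdot>\<^sub>m U" by auto
  have "U \<in> carrier_mat n n" using Scale.prems e by (auto intro!: nc_eval_carrier[OF Z])
  then have "c \<cdot>\<^sub>m kron U (1\<^sub>m m) = kron (c \<cdot>\<^sub>m U) (1\<^sub>m m)"
    by (intro eq_matI) (auto simp: kron_def div_less_mult)
  then show ?case using Scale e by simp
next
  case (Inv r)
  then obtain U where e: "nc_eval n Z r = Some U" "mat_inverse U = Some V" by (auto simp: bind_eq_Some_conv)
  have U: "U \<in> carrier_mat n n" using Inv.prems e by (auto intro!: nc_eval_carrier[OF Z])
  note inv = mat_inverse_Some[OF U e(2)]
  have "mat_inverse (kron U (1\<^sub>m m)) = Some (kron V (1\<^sub>m m))"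
    by (rule mat_inverse_eq_SomeI[OF kron_one_carrier[OF U] kron_one_carrier[OF inv(3)]])
      (simp_all only: kron_one_mult[OF U inv(3)] kron_one_mult[OF inv(3) U] inv(1,2) kron_one_one)
  then show ?case using Inv e by simp
qed

lemma kron_one_inject:
  assumes "A \<in> carrier_mat n n" "B \<in> carrier_mat n n" "0 < m" "kron A (1\<^sub>m m) = kron B (1\<^sub>m m)"
  shows "A = B"
proof (rule eq_matI)
  fix i j assume "i < dim_row B" "j < dim_col B"
  then have ij: "i < n" "j < n" using assms by auto
  then have ijm: "i * m < n * m" "j * m < n * m" using assms(3) by auto
  from arg_cong[OF assms(4), of "\<lambda>M. M $$ (i * m, j * m)"] show "A $$ (i, j) = B $$ (i, j)"
    using kron_one_entry[OF assms(1) ijm] kron_one_entry[OF assms(2) ijm] assms(3) by simp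
qed (use assms in auto)

lemma poly_eqI_infinite:
  fixes p q :: "complex poly"
  assumes "infinite {t. poly p t = poly q t}"
  shows "p = q"
  using poly_roots_finite[of "p - q"] assms by fastforce

lemma nonroots_infinite:
  assumes "q \<noteq> 0" shows "infinite {t :: complex. poly q t \<noteq> 0}"
proof
  assume "finite {t. poly q t \<noteq> 0}"
  then have "finite ({t. poly q t = 0} \<union> {t. poly q t \<noteq> 0})" using poly_roots_finite[OF assms] by simp
  moreover have "{t. poly q t = 0} \<union> {t. poly q t \<noteq> 0} = UNIV" by auto
  ultimately show False using infinite_UNIV_char_0[where 'a = complex] by simp
qed

text \<open>Along a curve both values are rational in the parameter, so agreement outside finitely many
  parameters extends to every parameter where both are defined.\<close>

lemma equal_values_at_common_point:
  fixes z :: "nat \<Rightarrow> nat \<Rightarrow> nat \<Rightarrow> complex poly"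
  assumes vars: "nc_vars r \<subseteq> {..<d}" "nc_vars s \<subseteq> {..<d}"
    and r: "nc_eval n (tuple_of d n (\<lambda>c i j. poly (z c i j) u)) r = Some V"
    and s: "nc_eval n (tuple_of d n (\<lambda>c i j. poly (z c i j) u)) s = Some W"
    and q: "q \<noteq> 0"
    and eq: "\<And>t. poly q t \<noteq> 0 \<Longrightarrow> nc_eval n (tuple_of d n (\<lambda>c i j. poly (z c i j) t)) r \<noteq> None \<Longrightarrow>
      nc_eval n (tuple_of d n (\<lambda>c i j. poly (z c i j) t)) s \<noteq> None \<Longrightarrow>
      nc_eval n (tuple_of d n (\<lambda>c i j. poly (z c i j) t)) r = nc_eval n (tuple_of d n (\<lambda>c i j. poly (z c i j) t)) s"
  shows "V = W"
proof -
  obtain q1 P1 where 1: "poly q1 u \<noteq> 0" "P1 \<in> carrier_mat n n" "\<And>t. poly q1 t \<noteq> 0 \<Longrightarrow>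
    nc_eval n (tuple_of d n (\<lambda>c i j. poly (z c i j) t)) r = Some ((1 / poly q1 t) \<cdot>\<^sub>m eval_mat t P1)"
    using nc_eval_rational_along_curve[OF vars(1), of n z u] r by auto
  obtain q2 P2 where 2: "poly q2 u \<noteq> 0" "P2 \<in> carrier_mat n n" "\<And>t. poly q2 t \<noteq> 0 \<Longrightarrow>
    nc_eval n (tuple_of d n (\<lambda>c i j. poly (z c i j) t)) s = Some ((1 / poly q2 t) \<cdot>\<^sub>m eval_mat t P2)"
    using nc_eval_rational_along_curve[OF vars(2), of n z u] s by auto
  have "q1 \<noteq> 0" "q2 \<noteq> 0" using 1 2 by auto
  then have qqq: "q * q1 * q2 \<noteq> 0" using q by simp
  have "V $$ (i, j) = W $$ (i, j)" if ij: "i < n" "j < n" for i j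
  proof -
    have "q2 * P1 $$ (i, j) = q1 * P2 $$ (i, j)"
    proof (rule poly_eqI_infinite, rule infinite_super[OF _ nonroots_infinite[OF qqq]], clarify)
      fix t assume "poly (q * q1 * q2) t \<noteq> 0"
      then have t: "poly q t \<noteq> 0" "poly q1 t \<noteq> 0" "poly q2 t \<noteq> 0" by auto
      have "(1 / poly q1 t) \<cdot>\<^sub>m eval_mat t P1 = (1 / poly q2 t) \<cdot>\<^sub>m eval_mat t P2"
        using eq[OF t(1)] 1(3)[OF t(2)] 2(3)[OF t(3)] by simp
      from arg_cong[OF this, of "\<lambda>M. M $$ (i, j)"]
      have "(1 / poly q1 t) * poly (P1 $$ (i, j)) t = (1 / poly q2 t) * poly (P2 $$ (i, j)) t"
        using ij 1(2) 2(2) by (simp add: eval_mat_def)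
      then show "poly (q2 * P1 $$ (i, j)) t = poly (q1 * P2 $$ (i, j)) t"
        using t by (simp add: field_simps)
    qed
    from arg_cong[OF this, of "\<lambda>p. poly p u"]
    have "(1 / poly q1 u) * poly (P1 $$ (i, j)) u = (1 / poly q2 u) * poly (P2 $$ (i, j)) u"
      using 1(1) 2(1) by (simp add: field_simps)
    then show ?thesis using 1 2 r s ij by (auto simp: eval_mat_def)
  qed
  moreover have "V \<in> carrier_mat n n" "W \<in> carrier_mat n n"
    using nc_eval_carrier[OF tuple_of_mat_tuples vars(1) r] nc_eval_carrier[OF tuple_of_mat_tuples vars(2) s] by auto
  ultimately show ?thesis by (intro eq_matI) auto
qed

text \<open>The fixed representative \<open>r0\<close> is defined at some point \<open>Z0\<close>, possibly of another size, hence at almost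
  all points of the line from \<open>Z \<otimes> I\<close> to \<open>Z0 \<otimes> I\<close>. There \<open>r\<close> and \<open>s\<close> agree with \<open>r0\<close>, hence with each
  other.\<close>

lemma nc_class_values_agree:
  assumes f: "f \<in> nc_rational_functions d" and rs: "r \<in> f" "s \<in> f"
    and n: "1 \<le> n" and Z: "Z \<in> mat_tuples d n"
    and r: "nc_eval n Z r = Some V" and s: "nc_eval n Z s = Some W"
  shows "V = W"
proof -
  obtain r0 where r0: "r0 \<in> nc_exprs d" "f = nc_equiv d `` {r0}"
    using f unfolding nc_rational_functions_def quotient_def by blast
  have eq: "(r0, r) \<in> nc_equiv d" "(r0, s) \<in> nc_equiv d" using rs r0 by auto
  have vars: "nc_vars r0 \<subseteq> {..<d}" "nc_vars r \<subseteq> {..<d}" "nc_vars s \<subseteq> {..<d}"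
    using eq unfolding nc_equiv_def nc_exprs_def by auto
  have agree: "nc_eval l Y r0 = nc_eval l Y x"
    if "(r0, x) \<in> nc_equiv d" "1 \<le> l" "Y \<in> mat_tuples d l" "nc_eval l Y r0 \<noteq> None" "nc_eval l Y x \<noteq> None" for x l Y
  proof -
    have "\<forall>n\<ge>1. \<forall>Z\<in>nc_dom d n r0 \<inter> nc_dom d n x. nc_eval n Z r0 = nc_eval n Z x"
      using that(1) unfolding nc_equiv_def by simp
    moreover have "Y \<in> nc_dom d l r0 \<inter> nc_dom d l x" using that(3-5) by (simp add: nc_dom_def)
    ultimately show ?thesis using that(2) by blast
  qed
  obtain m Z0 where m: "1 \<le> m" and Z0: "Z0 \<in> mat_tuples d m" "nc_eval m Z0 r0 \<noteq> None"
    using r0(1) unfolding nc_exprs_def nc_dom_def by auto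
  define X where "X = map (\<lambda>X. kron X (1\<^sub>m m)) Z"
  define X0 where "X0 = map (\<lambda>X. kron X (1\<^sub>m n)) Z0"
  have Xr: "nc_eval (n * m) X r = Some (kron V (1\<^sub>m m))" and Xs: "nc_eval (n * m) X s = Some (kron W (1\<^sub>m m))"
    unfolding X_def using nc_eval_ampliation[OF Z] vars r s by auto
  have X0r: "nc_eval (n * m) X0 r0 \<noteq> None"
    unfolding X0_def using nc_eval_ampliation[OF Z0(1) vars(1), of _ n] Z0(2) by (auto simp: mult.commute)
  have Xc: "X \<in> mat_tuples d (n * m)" "X0 \<in> mat_tuples d (n * m)"
    using Z Z0(1) kron_one_carrier[of _ n n m] kron_one_carrier[of _ m m n]
    by (auto simp: mat_tuples_def X_def X0_def mult.commute subset_iff)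
  \<comment> \<open>the line from \<open>X\<close> at \<open>t = 0\<close> to \<open>X0\<close> at \<open>t = 1\<close>\<close>
  define z where "z = (\<lambda>c i j. [: (X ! c) $$ (i, j), (X0 ! c) $$ (i, j) - (X ! c) $$ (i, j) :])"
  let ?c = "\<lambda>t. tuple_of d (n * m) (\<lambda>c i j. poly (z c i j) t)"
  have c0: "?c 0 = X" and c1: "?c 1 = X0"
    using mat_tuple_eq_tuple_of[OF Xc(1)] mat_tuple_eq_tuple_of[OF Xc(2)] by (simp_all add: z_def)
  obtain q P where q: "poly q 1 \<noteq> 0" "\<And>t. poly q t \<noteq> 0 \<Longrightarrow> nc_eval (n * m) (?c t) r0 = Some ((1 / poly q t) \<cdot>\<^sub>m eval_mat t P)"
    using nc_eval_rational_along_curve[OF vars(1), of "n * m" z 1] X0r unfolding c1 by auto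
  have nm: "1 \<le> n * m" using n m by simp
  have ker: "kron V (1\<^sub>m m) = kron W (1\<^sub>m m)"
  proof (rule equal_values_at_common_point[OF vars(2,3), of "n * m" z 0])
    show "nc_eval (n * m) (?c 0) r = Some (kron V (1\<^sub>m m))" "nc_eval (n * m) (?c 0) s = Some (kron W (1\<^sub>m m))"
      unfolding c0 by (rule Xr, rule Xs)
    show "q \<noteq> 0" using q(1) by auto
    fix t assume "poly q t \<noteq> 0" "nc_eval (n * m) (?c t) r \<noteq> None" "nc_eval (n * m) (?c t) s \<noteq> None"
    moreover from this have "nc_eval (n * m) (?c t) r0 \<noteq> None" using q(2) by simp
    ultimately show "nc_eval (n * m) (?c t) r = nc_eval (n * m) (?c t) s"
      using agree[OF eq(1) nm tuple_of_mat_tuples] agree[OF eq(2) nm tuple_of_mat_tuples] by metis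
  qed
  have "0 < m" using m by simp
  from kron_one_inject[OF nc_eval_carrier[OF Z vars(2) r] nc_eval_carrier[OF Z vars(3) s] this ker]
  show "V = W" .
qed

lemma nc_class_vars:
  assumes "f \<in> nc_rational_functions d" "r \<in> f" shows "nc_vars r \<subseteq> {..<d}"
  using assms unfolding nc_rational_functions_def quotient_def nc_equiv_def nc_exprs_def by auto

lemma nc_fun_eval_eq:
  assumes f: "f \<in> nc_rational_functions d" and r: "r \<in> f"
    and n: "1 \<le> n" and Z: "Z \<in> mat_tuples d n" and V: "nc_eval n Z r = Some V"
  shows "nc_fun_eval d n f Z = V"
  unfolding nc_fun_eval_def
proof (rule the_equality)
  show "\<exists>r\<in>f. Z \<in> nc_dom d n r \<and> nc_eval n Z r = Some V" using r Z V by (auto simp: nc_dom_def)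
next
  fix W assume "\<exists>r\<in>f. Z \<in> nc_dom d n r \<and> nc_eval n Z r = Some W"
  then show "W = V" using nc_class_values_agree[OF f _ r n Z _ V] by blast
qed

section \<open>Solutions of the state equations\<close>

text \<open>Cramer's rule for \<open>v = t (M v + b)\<close>.\<close>

lemma det_pencil_solution:
  fixes M :: "nat \<Rightarrow> nat \<Rightarrow> complex" and K :: nat
  defines "PM \<equiv> mat K K (\<lambda>(p, q). [: if p = q then 1 else 0, - M p q :])"
  shows "poly (det PM) 0 = 1"
    and "\<exists>x. \<forall>t. poly (det PM) t \<noteq> 0 \<longrightarrow> (\<forall>p<K. poly (x p) t / poly (det PM) t =
      t * ((\<Sum>q<K. M p q * (poly (x q) t / poly (det PM) t)) + b p))"
    and "poly (det PM) t = 0 \<Longrightarrow> \<exists>v. (\<forall>p<K. v p = t * (\<Sum>q<K. M p q * v q)) \<and> (\<exists>p<K. v p \<noteq> 0)"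
proof -
  have PM: "PM \<in> carrier_mat K K" by (simp add: PM_def)
  have ev: "eval_mat t PM \<in> carrier_mat K K" for t using eval_mat_carrier[OF PM] .
  have entry: "eval_mat t PM $$ (p, q) = (if p = q then 1 else 0) - t * M p q" if "p < K" "q < K" for p q t
    using that by (simp add: eval_mat_entry[OF PM]) (simp add: PM_def)
  have mat_act: "mat_act K (eval_mat t PM) v p = v p - t * (\<Sum>q<K. M p q * v q)" if "p < K" for p v t
  proof -
    have "mat_act K (eval_mat t PM) v p = (\<Sum>q<K. (if q = p then v q else 0) - t * (M p q * v q))"
      unfolding mat_act_def using that by (intro sum.cong refl) (auto simp: entry algebra_simps)
    then show ?thesis using that by (simp add: sum_subtractf sum_distrib_left)
  qed
  have "eval_mat 0 PM = 1\<^sub>m K" using ev[of 0] by (intro eq_matI) (auto simp: entry)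
  then show "poly (det PM) 0 = 1" using det_eval_mat[of 0 PM] by simp
  note adj = adj_mat[OF PM]
  define x where "x = (\<lambda>p. \<Sum>q<K. adj_mat PM $$ (p, q) * [: 0, b q :])"
  have "\<forall>p<K. poly (x p) t / poly (det PM) t =
      t * ((\<Sum>q<K. M p q * (poly (x q) t / poly (det PM) t)) + b p)" if t: "poly (det PM) t \<noteq> 0" for t
  proof (intro allI impI)
    fix p assume p: "p < K"
    have x: "poly (x p) t = mat_act K (eval_mat t (adj_mat PM)) (\<lambda>q. t * b q) p" if "p < K" for p
      unfolding x_def mat_act_def poly_sum using that adj(1) by (intro sum.cong) (auto simp: eval_mat_entry)
    have "mat_act K (eval_mat t PM) (\<lambda>p. poly (x p) t) p =
        mat_act K (eval_mat t PM) (mat_act K (eval_mat t (adj_mat PM)) (\<lambda>q. t * b q)) p"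
      by (intro mat_act_cong x)
    also have "\<dots> = mat_act K (eval_mat t (PM * adj_mat PM)) (\<lambda>q. t * b q) p"
      using mat_act_mult[OF ev eval_mat_carrier[OF adj(1)] p] eval_mat_mult[OF PM adj(1)] by simp
    also have "\<dots> = mat_act K (poly (det PM) t \<cdot>\<^sub>m 1\<^sub>m K) (\<lambda>q. t * b q) p"
      unfolding adj(2) eval_mat_smult eval_mat_one ..
    also have "\<dots> = poly (det PM) t * mat_act K (1\<^sub>m K) (\<lambda>q. t * b q) p"
      unfolding mat_act_def sum_distrib_left using p by (intro sum.cong) auto
    also have "\<dots> = poly (det PM) t * (t * b p)" using p by (simp add: mat_act_one)
    finally have "poly (x p) t = t * (\<Sum>q<K. M p q * poly (x q) t) + poly (det PM) t * (t * b p)"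
      unfolding mat_act[OF p] by (simp add: algebra_simps)
    moreover have "(\<Sum>q<K. M p q * (poly (x q) t / poly (det PM) t)) = (\<Sum>q<K. M p q * poly (x q) t) / poly (det PM) t"
      by (simp add: sum_divide_distrib)
    ultimately show "poly (x p) t / poly (det PM) t = t * ((\<Sum>q<K. M p q * (poly (x q) t / poly (det PM) t)) + b p)"
      using t by (simp add: field_simps)
  qed
  then show "\<exists>x. \<forall>t. poly (det PM) t \<noteq> 0 \<longrightarrow> (\<forall>p<K. poly (x p) t / poly (det PM) t =
      t * ((\<Sum>q<K. M p q * (poly (x q) t / poly (det PM) t)) + b p))" by blast
  assume "poly (det PM) t = 0"
  then have "det (eval_mat t PM) = 0" by (simp add: det_eval_mat)
  then obtain w where w: "w \<in> carrier_vec K" "w \<noteq> 0\<^sub>v K" "eval_mat t PM *\<^sub>v w = 0\<^sub>v K"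
    using det_0_iff_vec_prod_zero[OF ev] by blast
  have "w $ p = t * (\<Sum>q<K. M p q * w $ q)" if p: "p < K" for p
  proof -
    have "mat_act K (eval_mat t PM) (\<lambda>q. w $ q) p = (eval_mat t PM *\<^sub>v w) $ p"
      using p w(1) ev[of t] by (simp add: mat_act_def scalar_prod_def atLeast0LessThan)
    then show ?thesis unfolding w(3) mat_act[OF p] using p by simp
  qed
  moreover have "\<exists>p<K. w $ p \<noteq> 0" using w(1,2) by (metis carrier_vecD eq_vecI index_zero_vec)
  ultimately show "\<exists>v. (\<forall>p<K. v p = t * (\<Sum>q<K. M p q * v q)) \<and> (\<exists>p<K. v p \<noteq> 0)" by blast
qed

text \<open>The state equations at \<open>t Z\<close> are a linear system of the preceding form for the vector of all entries of
  all states, state number \<open>\<alpha>\<close> occupying the entries \<open>\<alpha> n + i\<close>.\<close>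

lemma solution_family:
  assumes S: "finite S" "0 \<notin> S"
  shows "\<exists>q. poly q 0 = 1 \<and>
    (\<forall>U. \<exists>p. (\<forall>i. p 0 i = smult (U i) q) \<and> (\<forall>t. poly q t \<noteq> 0 \<longrightarrow>
       state_eqs S T k n (\<lambda>c i j. t * z c i j) (\<lambda>a i. poly (p a i) t / poly q t))) \<and>
    (\<forall>t. poly q t = 0 \<longrightarrow> (\<exists>X. (\<forall>i. X 0 i = 0) \<and> state_eqs S T k n (\<lambda>c i j. t * z c i j) X \<and>
       (\<exists>a\<in>S. \<exists>i<n. X a i \<noteq> 0)))"
proof -
  define N where "N = card S"
  obtain h where h: "bij_betw h {..<N} S" using ex_bij_betw_nat_finite[OF S(1)] unfolding N_def atLeast0LessThan by blast
  define g where "g = inv_into {..<N} h"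
  have g: "g a < N" "h (g a) = a" if "a \<in> S" for a
    using that h unfolding g_def by (auto simp: bij_betw_def f_inv_into_f inv_into_into)
  have hS: "h \<alpha> \<in> S" "g (h \<alpha>) = \<alpha>" if "\<alpha> < N" for \<alpha>
    using that h unfolding g_def by (auto simp: bij_betw_def)
  have S0: "a \<noteq> 0" if "a \<in> S" for a using that S(2) by metis
  have hz: "(h \<alpha> = 0) = False" if "\<alpha> < N" for \<alpha> using S0 hS(1)[OF that] by metis
  define M where "M = (\<lambda>p q. z (k (h (p div n))) (p mod n) (q mod n) * T (h (p div n)) (h (q div n)))"
  define PM where "PM = mat (N * n) (N * n) (\<lambda>(p, q). [: if p = q then 1 else 0, - M p q :])"
  define bv where "bv = (\<lambda>U p. \<Sum>j<n. z (k (h (p div n))) (p mod n) j * (T (h (p div n)) 0 * U j))"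
  define Xof where "Xof = (\<lambda>(U :: nat \<Rightarrow> complex) v a i. if a = 0 then U i else v (g a * n + i))"
  have idx: "\<alpha> * n + i < N * n" "(\<alpha> * n + i) div n = \<alpha>" "(\<alpha> * n + i) mod n = i" if "\<alpha> < N" "i < n" for \<alpha> i
    using that by (auto intro: index_less_mult)
  have Xh: "Xof U v (h \<beta>) j = v (\<beta> * n + j)" if "\<beta> < N" for U v \<beta> j
    unfolding Xof_def hz[OF that] hS(2)[OF that] by simp
  have eqs: "state_eqs S T k n (\<lambda>c i j. t * z c i j) (Xof U v)"
    if v: "\<And>p. p < N * n \<Longrightarrow> v p = t * ((\<Sum>q<N * n. M p q * v q) + bv U p)" for t U v
    unfolding state_eqs_def
  proof (intro ballI allI impI)
    fix a i assume a: "a \<in> S" and i: "i < n"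
    note ai = idx[OF g(1)[OF a] i] and ga = g[OF a]
    have Mv: "(\<Sum>q<N * n. M (g a * n + i) q * v q) = (\<Sum>j<n. z (k a) i j * (\<Sum>b\<in>S. T a b * Xof U v b j))"
    proof -
      have "(\<Sum>q<N * n. M (g a * n + i) q * v q) = (\<Sum>\<beta><N. \<Sum>j<n. z (k a) i j * (T a (h \<beta>) * Xof U v (h \<beta>) j))"
        unfolding sum_prod_index M_def using ai ga
        by (intro sum.cong refl) (simp add: idx Xh ac_simps)
      also have "\<dots> = (\<Sum>j<n. z (k a) i j * (\<Sum>\<beta><N. T a (h \<beta>) * Xof U v (h \<beta>) j))"
        unfolding sum_distrib_left by (rule sum.swap)
      also have "\<dots> = (\<Sum>j<n. z (k a) i j * (\<Sum>b\<in>S. T a b * Xof U v b j))"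
        by (subst sum.reindex_bij_betw[OF h, symmetric]) (rule refl)
      finally show ?thesis .
    qed
    have "Xof U v a i = t * ((\<Sum>j<n. z (k a) i j * (\<Sum>b\<in>S. T a b * Xof U v b j)) + (\<Sum>j<n. z (k a) i j * (T a 0 * U j)))"
      using v[OF ai(1)] S0[OF a] i unfolding Mv by (simp add: Xof_def bv_def ai ga)
    also have "\<dots> = t * (\<Sum>j<n. z (k a) i j * apply_sys S T (\<lambda>b. Xof U v b j) a)"
      unfolding sum.distrib[symmetric] using S by (simp add: apply_sys_insert Xof_def algebra_simps)
    finally show "Xof U v a i = (\<Sum>j<n. t * z (k a) i j * apply_sys S T (\<lambda>b. Xof U v b j) a)"
      by (simp add: sum_distrib_left mult.assoc)
  qed
  note det = det_pencil_solution[of "N * n" M, folded PM_def]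
  have "\<exists>p. (\<forall>i. p 0 i = smult (U i) (det PM)) \<and> (\<forall>t. poly (det PM) t \<noteq> 0 \<longrightarrow>
       state_eqs S T k n (\<lambda>c i j. t * z c i j) (\<lambda>a i. poly (p a i) t / poly (det PM) t))" for U
  proof -
    obtain x where x: "\<And>t p. poly (det PM) t \<noteq> 0 \<Longrightarrow> p < N * n \<Longrightarrow> poly (x p) t / poly (det PM) t =
      t * ((\<Sum>q<N * n. M p q * (poly (x q) t / poly (det PM) t)) + bv U p)"
      using det(2)[of "bv U"] by blast
    define p where "p = (\<lambda>a i. if a = 0 then smult (U i) (det PM) else x (g a * n + i))"
    have "state_eqs S T k n (\<lambda>c i j. t * z c i j) (\<lambda>a i. poly (p a i) t / poly (det PM) t)"
      if t: "poly (det PM) t \<noteq> 0" for t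
    proof -
      have "(\<lambda>a i. poly (p a i) t / poly (det PM) t) = Xof U (\<lambda>q. poly (x q) t / poly (det PM) t)"
        using t by (intro ext) (simp add: p_def Xof_def)
      moreover have "state_eqs S T k n (\<lambda>c i j. t * z c i j) (Xof U (\<lambda>q. poly (x q) t / poly (det PM) t))"
        by (rule eqs) (rule x[OF t])
      ultimately show ?thesis by (simp only:)
    qed
    then show ?thesis by (intro exI[of _ p]) (simp add: p_def)
  qed
  moreover have "\<exists>X. (\<forall>i. X 0 i = 0) \<and> state_eqs S T k n (\<lambda>c i j. t * z c i j) X \<and> (\<exists>a\<in>S. \<exists>i<n. X a i \<noteq> 0)"
    if t: "poly (det PM) t = 0" for t
  proof -
    obtain v p where v: "\<And>p. p < N * n \<Longrightarrow> v p = t * (\<Sum>q<N * n. M p q * v q)" and p: "p < N * n" "v p \<noteq> 0"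
      using det(3)[OF t] by blast
    have n0: "n > 0" using p(1) by (cases n) auto
    have a: "h (p div n) \<in> S" "g (h (p div n)) = p div n" using hS[OF div_less_mult[OF p(1)]] by auto
    have "Xof (\<lambda>_. 0) v (h (p div n)) (p mod n) \<noteq> 0" using p(2) S0[OF a(1)] by (simp add: Xof_def a(2))
    moreover have "state_eqs S T k n (\<lambda>c i j. t * z c i j) (Xof (\<lambda>_. 0) v)"
    proof (rule eqs)
      fix p assume "p < N * n"
      moreover have "bv (\<lambda>_. 0) p = 0" by (simp add: bv_def)
      ultimately show "v p = t * ((\<Sum>q<N * n. M p q * v q) + bv (\<lambda>_. 0) p)" by (simp only: v add_0_right)
    qed
    moreover have "\<forall>i. Xof (\<lambda>_. 0) v 0 i = 0" by (simp add: Xof_def)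
    moreover have "p mod n < n" using n0 by simp
    ultimately show ?thesis using a(1) by blast
  qed
  ultimately show ?thesis using det(1) by (intro exI[of _ "det PM"]) blast
qed

text \<open>Words of length \<open>m\<close> are summed over letter by letter, in the order in which \<open>reach\<close> and \<open>monomial\<close>
  consume them.\<close>

primrec word_sum :: "nat \<Rightarrow> nat \<Rightarrow> (nat list \<Rightarrow> complex) \<Rightarrow> complex" where
  "word_sum d 0 g = g []"
| "word_sum d (Suc m) g = (\<Sum>c<d. word_sum d m (\<lambda>w. g (c # w)))"

text \<open>The vector \<open>Z\<^sup>w U\<close>.\<close>

fun monomial :: "nat \<Rightarrow> (nat \<Rightarrow> nat \<Rightarrow> nat \<Rightarrow> complex) \<Rightarrow> (nat \<Rightarrow> complex) \<Rightarrow> nat list \<Rightarrow> nat \<Rightarrow> complex" where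
  "monomial n z U [] = U"
| "monomial n z U (c # w) = (\<lambda>i. \<Sum>j<n. z c i j * monomial n z U w j)"

lemma word_sum_sum: "word_sum d m (\<lambda>w. \<Sum>j\<in>J. g j w) = (\<Sum>j\<in>J. word_sum d m (g j))"
  by (induction m arbitrary: g) (simp_all add: sum.swap[of _ J])

lemma word_sum_scale: "word_sum d m (\<lambda>w. c * g w) = c * word_sum d m g"
  by (induction m arbitrary: g) (simp_all add: sum_distrib_left)

lemma word_sum_zero: "word_sum d m (\<lambda>w. 0) = 0"
  by (induction m) simp_all

text \<open>The partial sums \<open>P\<close> of the Neumann series satisfy the recursion \<open>P \<mapsto> t Z T P\<close> of which \<open>X\<close> is a fixed
  point, so the error shrinks by the factor \<open>\<rho>\<close> in each step.\<close>

lemma output_series: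
  assumes sys: "is_system d S k"
  shows "\<exists>\<delta>>0. \<forall>t X. cmod t < \<delta> \<longrightarrow> state_eqs S T k n (\<lambda>c i j. t * z c i j) X \<longrightarrow>
    (\<forall>i<n. (\<lambda>M. \<Sum>m\<le>M. t ^ m * word_sum d m (\<lambda>w. word_coeff S T k w * monomial n z (X 0) w i))
      \<longlonglongrightarrow> apply_sys S T (\<lambda>b. X b i) 0)"
proof -
  let ?I = "insert 0 S"
  have S: "finite S" "0 \<notin> S" "k ` S \<subseteq> {..<d}" using sys by (auto simp: is_system_def)
  define K where "K = (\<Sum>a\<in>S. \<Sum>i<n. \<Sum>j<n. \<Sum>b\<in>?I. cmod (z (k a) i j) * cmod (T a b))"
  have K0: "K \<ge> 0" unfolding K_def by (intro sum_nonneg) auto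
  have Kai: "(\<Sum>j<n. \<Sum>b\<in>?I. cmod (z (k a) i j) * cmod (T a b)) \<le> K" if "a \<in> S" "i < n" for a i
  proof -
    have "(\<Sum>j<n. \<Sum>b\<in>?I. cmod (z (k a) i j) * cmod (T a b)) \<le> (\<Sum>i<n. \<Sum>j<n. \<Sum>b\<in>?I. cmod (z (k a) i j) * cmod (T a b))"
      using that by (intro member_le_sum[of i "{..<n}" "\<lambda>i. \<Sum>j<n. \<Sum>b\<in>?I. cmod (z (k a) i j) * cmod (T a b)"])
        (auto intro!: sum_nonneg add_nonneg_nonneg)
    also have "\<dots> \<le> K" unfolding K_def using that S
      by (intro member_le_sum[of a S "\<lambda>a. \<Sum>i<n. \<Sum>j<n. \<Sum>b\<in>?I. cmod (z (k a) i j) * cmod (T a b)"])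
        (auto intro!: sum_nonneg add_nonneg_nonneg)
    finally show ?thesis .
  qed
  have main: "(\<lambda>M. \<Sum>m\<le>M. t ^ m * word_sum d m (\<lambda>w. word_coeff S T k w * monomial n z (X 0) w i))
      \<longlonglongrightarrow> apply_sys S T (\<lambda>b. X b i) 0"
    if t: "cmod t < 1 / (K + 1)" and X: "state_eqs S T k n (\<lambda>c i j. t * z c i j) X" and i: "i < n" for t X i
  proof -
    define summand where "summand = (\<lambda>m a i. word_sum d m (\<lambda>w. reach S T k w a * monomial n z (X 0) w i))"
    define P where "P = (\<lambda>M a i. \<Sum>m\<le>M. t ^ m * summand m a i)"
    have term_Suc: "summand (Suc m) a i = (\<Sum>j<n. z (k a) i j * apply_sys S T (\<lambda>b. summand m b j) a)" if a: "a \<in> S" for m a i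
    proof -
      have ka: "k a < d" using a S by auto
      have "summand (Suc m) a i = (\<Sum>c<d. word_sum d m (\<lambda>w. reach S T k (c # w) a * monomial n z (X 0) (c # w) i))"
        by (simp only: summand_def word_sum.simps)
      also have "\<dots> = (\<Sum>c<d. if c = k a then word_sum d m (\<lambda>w. apply_sys S T (reach S T k w) a * monomial n z (X 0) (c # w) i) else 0)"
        using a by (intro sum.cong refl) (auto simp: word_sum_zero)
      also have "\<dots> = word_sum d m (\<lambda>w. apply_sys S T (reach S T k w) a * monomial n z (X 0) (k a # w) i)"
        using ka by simp
      also have "\<dots> = word_sum d m (\<lambda>w. \<Sum>j<n. \<Sum>b\<in>?I. (z (k a) i j * T a b) * (reach S T k w b * monomial n z (X 0) w j))"
        unfolding apply_sys_def monomial.simps sum_product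
        by (subst sum.swap) (simp only: ac_simps)
      also have "\<dots> = (\<Sum>j<n. \<Sum>b\<in>?I. (z (k a) i j * T a b) * summand m b j)"
        unfolding word_sum_sum word_sum_scale by (simp only: summand_def)
      also have "\<dots> = (\<Sum>j<n. z (k a) i j * apply_sys S T (\<lambda>b. summand m b j) a)"
        unfolding apply_sys_def sum_distrib_left by (simp only: ac_simps)
      finally show ?thesis .
    qed
    have term_0: "summand (Suc m) 0 i = 0" for m i
      unfolding summand_def word_sum.simps using S by (simp add: word_sum_zero)
    have P_0: "P M 0 i = X 0 i" for M i
    proof (induction M)
      case 0
      then show ?case by (simp add: P_def summand_def input_vec_def)
    next
      case (Suc M)
      then show ?case by (simp add: P_def term_0)
    qed
    have P_Suc: "P (Suc M) a i = t * (\<Sum>j<n. z (k a) i j * apply_sys S T (\<lambda>b. P M b j) a)" if a: "a \<in> S" for M a i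
    proof -
      have "a \<noteq> 0" using a S(2) by metis
      then have "summand 0 a i = 0" by (simp add: summand_def input_vec_def)
      then have "P (Suc M) a i = (\<Sum>m\<le>M. t ^ Suc m * summand (Suc m) a i)"
        unfolding P_def sum.atMost_Suc_shift by simp
      also have "\<dots> = (\<Sum>m\<le>M. t * (\<Sum>j<n. z (k a) i j * apply_sys S T (\<lambda>b. t ^ m * summand m b j) a))"
        unfolding term_Suc[OF a] apply_sys_def sum_distrib_left power_Suc by (simp only: ac_simps)
      also have "\<dots> = t * (\<Sum>j<n. \<Sum>m\<le>M. z (k a) i j * apply_sys S T (\<lambda>b. t ^ m * summand m b j) a)"
        by (simp only: sum_distrib_left[symmetric] sum.swap[of _ "{..<n}" "{..M}"])
      also have "\<dots> = t * (\<Sum>j<n. z (k a) i j * apply_sys S T (\<lambda>b. P M b j) a)"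
      proof -
        have "(\<Sum>m\<le>M. z (k a) i j * apply_sys S T (\<lambda>b. t ^ m * summand m b j) a) = z (k a) i j * apply_sys S T (\<lambda>b. P M b j) a" for j
          unfolding P_def apply_sys_def sum_distrib_left by (rule sum.swap)
        then show ?thesis by (simp only:)
      qed
      finally show ?thesis .
    qed
    define B where "B = (\<Sum>a\<in>?I. \<Sum>i<n. cmod (X a i - P 0 a i))"
    have B: "cmod (X a i - P 0 a i) \<le> B" if "a \<in> ?I" "i < n" for a i
    proof -
      have "cmod (X a i - P 0 a i) \<le> (\<Sum>i<n. cmod (X a i - P 0 a i))"
        using that by (intro member_le_sum[of i "{..<n}" "\<lambda>i. cmod (X a i - P 0 a i)"]) auto
      also have "\<dots> \<le> B" unfolding B_def using that S
        by (intro member_le_sum[of a ?I "\<lambda>a. \<Sum>i<n. cmod (X a i - P 0 a i)"]) (auto intro!: sum_nonneg add_nonneg_nonneg)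
      finally show ?thesis .
    qed
    have B0: "B \<ge> 0" unfolding B_def by (intro sum_nonneg) auto
    define \<rho> where "\<rho> = cmod t * K"
    have \<rho>0: "\<rho> \<ge> 0" using K0 by (simp add: \<rho>_def)
    have err: "cmod (X a i - P M a i) \<le> \<rho> ^ M * B" if "a \<in> ?I" "i < n" for M a i
      using that
    proof (induction M arbitrary: a i)
      case 0
      then show ?case using B by simp
    next
      case (Suc M)
      show ?case
      proof (cases "a \<in> S")
        case False
        then show ?thesis using Suc.prems \<rho>0 B0 by (auto simp: P_0)
      next
        case True
        have "X a i = t * (\<Sum>j<n. z (k a) i j * apply_sys S T (\<lambda>b. X b j) a)"
          using X True Suc.prems unfolding state_eqs_def by (simp add: sum_distrib_left mult.assoc)
        then have diff: "X a i - P (Suc M) a i = t * (\<Sum>j<n. \<Sum>b\<in>?I. z (k a) i j * T a b * (X b j - P M b j))"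
          unfolding P_Suc[OF True] apply_sys_def
          by (simp only: right_diff_distrib[symmetric] sum_subtractf[symmetric] sum_distrib_left mult.assoc)
        have "cmod (\<Sum>j<n. \<Sum>b\<in>?I. z (k a) i j * T a b * (X b j - P M b j)) \<le>
            (\<Sum>j<n. \<Sum>b\<in>?I. cmod (z (k a) i j) * cmod (T a b) * (\<rho> ^ M * B))"
        proof (intro sum_norm_le)
          fix j b assume "j \<in> {..<n}" "b \<in> ?I"
          then have "cmod (X b j - P M b j) \<le> \<rho> ^ M * B" using Suc.IH by simp
          then show "cmod (z (k a) i j * T a b * (X b j - P M b j)) \<le> cmod (z (k a) i j) * cmod (T a b) * (\<rho> ^ M * B)"
            unfolding norm_mult by (intro mult_left_mono) auto
        qed
        also have "\<dots> = (\<Sum>j<n. \<Sum>b\<in>?I. cmod (z (k a) i j) * cmod (T a b)) * (\<rho> ^ M * B)"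
          by (simp only: sum_distrib_right)
        also have "\<dots> \<le> K * (\<rho> ^ M * B)" using Kai[OF True] Suc.prems \<rho>0 B0 by (intro mult_right_mono) auto
        finally have "cmod t * cmod (\<Sum>j<n. \<Sum>b\<in>?I. z (k a) i j * T a b * (X b j - P M b j)) \<le> cmod t * (K * (\<rho> ^ M * B))"
          by (intro mult_left_mono) auto
        then show ?thesis unfolding diff norm_mult by (simp add: \<rho>_def mult.assoc)
      qed
    qed
    have "\<rho> < 1"
    proof -
      have "cmod t * (K + 1) < 1" using t K0 by (simp add: field_simps)
      moreover have "cmod t * (K + 1) = \<rho> + cmod t" by (simp add: \<rho>_def algebra_simps)
      moreover have "0 \<le> cmod t" by simp
      ultimately show ?thesis by linarith
    qed
    then have "(\<lambda>M. \<rho> ^ M * B) \<longlonglongrightarrow> 0 * B" using \<rho>0 by (intro tendsto_intros LIMSEQ_realpow_zero)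
    then have lim0: "(\<lambda>M. \<rho> ^ M * B) \<longlonglongrightarrow> 0" by simp
    have err0: "(\<lambda>M. X a i - P M a i) \<longlonglongrightarrow> 0" if "a \<in> ?I" for a
      by (rule tendsto_0_le[OF lim0, where K = 1], intro always_eventually allI)
        (use err[OF that i] \<rho>0 B0 in \<open>simp add: abs_mult\<close>)
    have "(\<lambda>M. P M a i) \<longlonglongrightarrow> X a i" if "a \<in> ?I" for a
    proof -
      have "(\<lambda>M. X a i - (X a i - P M a i)) \<longlonglongrightarrow> X a i - 0"
        by (intro tendsto_diff tendsto_const err0 that)
      then show ?thesis by simp
    qed
    then have "(\<lambda>M. apply_sys S T (\<lambda>b. P M b i) 0) \<longlonglongrightarrow> apply_sys S T (\<lambda>b. X b i) 0"
      unfolding apply_sys_def by (intro tendsto_intros)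
    moreover have "apply_sys S T (\<lambda>b. P M b i) 0 = (\<Sum>m\<le>M. t ^ m * word_sum d m (\<lambda>w. word_coeff S T k w * monomial n z (X 0) w i))" for M
    proof -
      have "word_sum d m (\<lambda>w. word_coeff S T k w * monomial n z (X 0) w i) = apply_sys S T (\<lambda>b. summand m b i) 0" for m
        unfolding word_coeff_def apply_sys_def sum_distrib_right word_sum_sum summand_def word_sum_scale[symmetric]
        by (simp only: ac_simps)
      moreover have "apply_sys S T (\<lambda>b. P M b i) 0 = (\<Sum>m\<le>M. t ^ m * apply_sys S T (\<lambda>b. summand m b i) 0)"
        unfolding P_def apply_sys_def sum_distrib_left by (subst sum.swap) (simp only: ac_simps)
      ultimately show ?thesis by (simp only:)
    qed
    ultimately show ?thesis by simp
  qed
  show ?thesis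
  proof (intro exI[of _ "1 / (K + 1)"] conjI allI impI)
    show "0 < 1 / (K + 1)" using K0 by simp
  qed (rule main)
qed

section \<open>The value of the function is the output of the system\<close>

lemma infinite_small_disc:
  assumes "0 < \<delta>" shows "infinite {t :: complex. cmod t < \<delta>}"
proof
  assume "finite {t :: complex. cmod t < \<delta>}"
  then have "finite (complex_of_real ` {0<..<\<delta>})" by (rule finite_subset[rotated]) auto
  then have "finite {0<..<\<delta>}" by (rule finite_imageD) (simp add: inj_on_def)
  then show False using infinite_Ioo[OF assms] by simp
qed

lemma poly_eqI_near_zero:
  fixes p p' q :: "complex poly"
  assumes "q \<noteq> 0" "0 < \<delta>" and eq: "\<And>t. cmod t < \<delta> \<Longrightarrow> poly q t \<noteq> 0 \<Longrightarrow> poly p t = poly p' t"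
  shows "p = p'"
proof (rule poly_eqI_infinite)
  have "infinite ({t. cmod t < \<delta>} - {t. poly q t = 0})"
    using infinite_small_disc[OF assms(2)] poly_roots_finite[OF assms(1)] by (rule Diff_infinite_finite[rotated])
  then show "infinite {t. poly p t = poly p' t}" by (rule infinite_super[rotated]) (use eq in auto)
qed

lemma nc_eval_at_zero_tuple:
  assumes "nc_vars r \<subseteq> {..<d}" "nc_eval 1 (tuple_of d 1 (\<lambda>_ _ _. 0)) r \<noteq> None"
  shows "nc_eval n (tuple_of d n (\<lambda>_ _ _. 0)) r \<noteq> None"
proof -
  have "map (\<lambda>X. kron X (1\<^sub>m n)) (tuple_of d 1 (\<lambda>_ _ _. 0)) = tuple_of d n (\<lambda>_ _ _. 0)"
    unfolding tuple_of_def by (auto simp: kron_def intro!: eq_matI)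
  then show ?thesis using nc_eval_ampliation[OF tuple_of_mat_tuples assms(1), of 1 "\<lambda>_ _ _. 0" _ n] assms(2) by auto
qed

text \<open>For small \<open>t\<close> three outputs coincide at \<open>t Z\<close>: the value of \<open>f\<close>, the output of the system that
  realizes the representative \<open>r\<close>, and, by equality of coefficients, the output of the given system. Both
  ends of this chain are rational in \<open>t\<close> and defined at \<open>u\<close>. The representative \<open>s\<close> that is defined at
  \<open>u Z\<close> may differ from \<open>r\<close>.\<close>

lemma value_equals_output:
  assumes f: "f \<in> nc_rational_functions d" and r: "r \<in> f" and reg: "nc_eval 1 (tuple_of d 1 (\<lambda>_ _ _. 0)) r \<noteq> None"
    and sys0: "is_system d S0 k0" and real: "realizes d r S0 T0 k0"
    and sys: "is_system d S k" and co: "\<And>w. word_coeff S T k w = word_coeff S0 T0 k0 w"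
    and n: "1 \<le> n"
    and sol: "\<And>t. poly q t \<noteq> 0 \<Longrightarrow>
      state_eqs S T k n (\<lambda>c i j. t * z c i j) (\<lambda>a i. poly (p a i) t / poly q t)"
    and u: "poly q u \<noteq> 0" and dom: "tuple_of d n (\<lambda>c i j. u * z c i j) \<in> nc_fun_dom d n f" and i: "i < n"
  shows "mat_act n (nc_fun_eval d n f (tuple_of d n (\<lambda>c i j. u * z c i j))) (\<lambda>i. poly (p 0 i) u / poly q u) i =
    apply_sys S T (\<lambda>b. poly (p b i) u / poly q u) 0"
proof -
  define zp where "zp = (\<lambda>c i j. [: 0, z c i j :])"
  have zp: "(\<lambda>c i j. poly (zp c i j) t) = (\<lambda>c i j. t * z c i j)" for t by (simp add: zp_def)
  obtain s where s: "s \<in> f" "nc_eval n (tuple_of d n (\<lambda>c i j. u * z c i j)) s \<noteq> None"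
    using dom unfolding nc_fun_dom_def nc_dom_def by auto
  note vars = nc_class_vars[OF f r] nc_class_vars[OF f s(1)]
  obtain qr Pr where qr: "poly qr 0 \<noteq> 0" "\<And>t. poly qr t \<noteq> 0 \<Longrightarrow>
    nc_eval n (tuple_of d n (\<lambda>c i j. t * z c i j)) r = Some ((1 / poly qr t) \<cdot>\<^sub>m eval_mat t Pr)"
    using nc_eval_rational_along_curve[OF vars(1), of n zp 0] nc_eval_at_zero_tuple[OF vars(1) reg, of n]
    unfolding zp by auto
  obtain qs Ps where qs: "poly qs u \<noteq> 0" "Ps \<in> carrier_mat n n" "\<And>t. poly qs t \<noteq> 0 \<Longrightarrow>
    nc_eval n (tuple_of d n (\<lambda>c i j. t * z c i j)) s = Some ((1 / poly qs t) \<cdot>\<^sub>m eval_mat t Ps)"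
    using nc_eval_rational_along_curve[OF vars(2), of n zp u] s(2) unfolding zp by auto
  have S0: "finite S0" "0 \<notin> S0" using sys0 by (auto simp: is_system_def)
  obtain q0 where q0: "poly q0 0 = 1" and sol0: "\<And>U. \<exists>p. (\<forall>i. p 0 i = smult (U i) q0) \<and> (\<forall>t. poly q0 t \<noteq> 0 \<longrightarrow>
       state_eqs S0 T0 k0 n (\<lambda>c i j. t * z c i j) (\<lambda>a i. poly (p a i) t / poly q0 t))"
    using solution_family[OF S0, of T0 k0 n z] by blast
  obtain \<delta>1 where d1: "\<delta>1 > 0" "\<And>t X i. cmod t < \<delta>1 \<Longrightarrow> state_eqs S T k n (\<lambda>c i j. t * z c i j) X \<Longrightarrow> i < n \<Longrightarrow>
    (\<lambda>M. \<Sum>m\<le>M. t ^ m * word_sum d m (\<lambda>w. word_coeff S T k w * monomial n z (X 0) w i))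
      \<longlonglongrightarrow> apply_sys S T (\<lambda>b. X b i) 0"
    using output_series[OF sys, of T n z] by blast
  obtain \<delta>2 where d2: "\<delta>2 > 0" "\<And>t X i. cmod t < \<delta>2 \<Longrightarrow> state_eqs S0 T0 k0 n (\<lambda>c i j. t * z c i j) X \<Longrightarrow> i < n \<Longrightarrow>
    (\<lambda>M. \<Sum>m\<le>M. t ^ m * word_sum d m (\<lambda>w. word_coeff S0 T0 k0 w * monomial n z (X 0) w i))
      \<longlonglongrightarrow> apply_sys S0 T0 (\<lambda>b. X b i) 0"
    using output_series[OF sys0, of T0 n z] by blast
  have near_zero: "mat_act n ((1 / poly qs t) \<cdot>\<^sub>m eval_mat t Ps) (\<lambda>i. poly (p 0 i) t / poly q t) i =
      apply_sys S T (\<lambda>b. poly (p b i) t / poly q t) 0"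
    if t: "cmod t < min \<delta>1 \<delta>2" "poly q t \<noteq> 0" "poly qr t \<noteq> 0" "poly qs t \<noteq> 0" "poly q0 t \<noteq> 0" for t
  proof -
    define U where "U = (\<lambda>i. poly (p 0 i) t / poly q t)"
    obtain p' where p': "\<And>i. p' 0 i = smult (U i) q0" "state_eqs S0 T0 k0 n (\<lambda>c i j. t * z c i j) (\<lambda>a i. poly (p' a i) t / poly q0 t)"
      using sol0[of U] t(5) by blast
    define X where "X = (\<lambda>a i. poly (p' a i) t / poly q0 t)"
    have X0: "X 0 = U" using t(5) by (auto simp: X_def p'(1))
    have "(1 / poly qr t) \<cdot>\<^sub>m eval_mat t Pr = (1 / poly qs t) \<cdot>\<^sub>m eval_mat t Ps"
      by (rule nc_class_values_agree[OF f r s(1) n tuple_of_mat_tuples qr(2)[OF t(3)] qs(3)[OF t(4)]])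
    moreover have "mat_act n ((1 / poly qr t) \<cdot>\<^sub>m eval_mat t Pr) (X 0) i = apply_sys S0 T0 (\<lambda>b. X b i) 0"
      using real qr(2)[OF t(3)] p'(2) i unfolding realizes_def X_def by blast
    moreover have "apply_sys S0 T0 (\<lambda>b. X b i) 0 = apply_sys S T (\<lambda>b. poly (p b i) t / poly q t) 0"
    proof (rule LIMSEQ_unique)
      show "(\<lambda>M. \<Sum>m\<le>M. t ^ m * word_sum d m (\<lambda>w. word_coeff S0 T0 k0 w * monomial n z U w i)) \<longlonglongrightarrow> apply_sys S0 T0 (\<lambda>b. X b i) 0"
        using d2(2)[of t X i] t(1) p'(2) i X0 unfolding X_def by simp
      show "(\<lambda>M. \<Sum>m\<le>M. t ^ m * word_sum d m (\<lambda>w. word_coeff S0 T0 k0 w * monomial n z U w i)) \<longlonglongrightarrow>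
          apply_sys S T (\<lambda>b. poly (p b i) t / poly q t) 0"
        using d1(2)[of t "\<lambda>a i. poly (p a i) t / poly q t" i] t(1) sol[OF t(2)] i unfolding U_def co by simp
    qed
    ultimately show ?thesis unfolding X0 U_def by simp
  qed
  define L where "L = (\<Sum>j<n. Ps $$ (i, j) * p 0 j)"
  define R where "R = qs * (\<Sum>b\<in>insert 0 S. smult (T 0 b) (p b i))"
  have LR: "(poly qs t * poly q t) * mat_act n ((1 / poly qs t) \<cdot>\<^sub>m eval_mat t Ps) (\<lambda>i. poly (p 0 i) t / poly q t) i = poly L t"
    "(poly qs t * poly q t) * apply_sys S T (\<lambda>b. poly (p b i) t / poly q t) 0 = poly R t"
    if t: "poly q t \<noteq> 0" "poly qs t \<noteq> 0" for t
  proof -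
    show "(poly qs t * poly q t) * mat_act n ((1 / poly qs t) \<cdot>\<^sub>m eval_mat t Ps) (\<lambda>i. poly (p 0 i) t / poly q t) i = poly L t"
      unfolding mat_act_def L_def sum_distrib_left poly_sum using t i qs(2)
      by (intro sum.cong refl) (simp add: eval_mat_def)
    show "(poly qs t * poly q t) * apply_sys S T (\<lambda>b. poly (p b i) t / poly q t) 0 = poly R t"
      unfolding apply_sys_def R_def sum_distrib_left poly_sum poly_mult using t
      by (intro sum.cong refl) simp
  qed
  have "L = R"
  proof (rule poly_eqI_near_zero[of "q * qr * qs * q0" "min \<delta>1 \<delta>2"])
    show "q * qr * qs * q0 \<noteq> 0" using u qr(1) qs(1) q0 by auto
    show "0 < min \<delta>1 \<delta>2" using d1 d2 by simp
    fix t assume t: "cmod t < min \<delta>1 \<delta>2" "poly (q * qr * qs * q0) t \<noteq> 0"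
    then show "poly L t = poly R t" using near_zero[of t] LR[of t] by simp
  qed
  moreover have "nc_fun_eval d n f (tuple_of d n (\<lambda>c i j. u * z c i j)) = (1 / poly qs u) \<cdot>\<^sub>m eval_mat u Ps"
    by (rule nc_fun_eval_eq[OF f s(1) n tuple_of_mat_tuples qs(3)[OF qs(1)]])
  moreover have "poly qs u * poly q u \<noteq> 0" using u qs(1) by simp
  ultimately show ?thesis using LR[OF u qs(1)] by (metis mult_left_cancel)
qed

section \<open>Operator norms\<close>

lemma l2_norm_sqnorm: "l2_norm v = sqrt (sqnorm {..<dim_vec v} (\<lambda>i. v $ i))"
  by (simp add: l2_norm_def sqnorm_def)

lemma l2_norm_mult_mat_vec:
  assumes A: "A \<in> carrier_mat n m" and v: "v \<in> carrier_vec m"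
  shows "l2_norm (A *\<^sub>v v) = sqrt (sqnorm {..<n} (mat_act m A (\<lambda>j. v $ j)))"
proof -
  have "(A *\<^sub>v v) $ i = mat_act m A (\<lambda>j. v $ j) i" if "i < n" for i
    using that A v by (simp add: mat_act_def scalar_prod_def atLeast0LessThan)
  then have "sqnorm {..<n} (\<lambda>i. (A *\<^sub>v v) $ i) = sqnorm {..<n} (mat_act m A (\<lambda>j. v $ j))"
    by (intro sqnorm_cong) auto
  then show ?thesis using A by (simp add: l2_norm_sqnorm)
qed

lemma op_norm_le:
  assumes A: "A \<in> carrier_mat n m" and c: "0 \<le> c"
    and le: "\<And>v. sqnorm {..<n} (mat_act m A v) \<le> c\<^sup>2 * sqnorm {..<m} v"
  shows "op_norm A \<le> c"
  unfolding op_norm_def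
proof (rule cSup_least)
  have "0\<^sub>v m \<in> carrier_vec (dim_col A)" "l2_norm (0\<^sub>v m) \<le> 1" using A by (auto simp: l2_norm_def)
  then show "{l2_norm (A *\<^sub>v v) |v. v \<in> carrier_vec (dim_col A) \<and> l2_norm v \<le> 1} \<noteq> {}" by blast
next
  fix x assume "x \<in> {l2_norm (A *\<^sub>v v) |v. v \<in> carrier_vec (dim_col A) \<and> l2_norm v \<le> 1}"
  then obtain v where v: "v \<in> carrier_vec m" "l2_norm v \<le> 1" "x = l2_norm (A *\<^sub>v v)" using A by auto
  have "x \<le> sqrt (c\<^sup>2 * sqnorm {..<m} (\<lambda>j. v $ j))"
    unfolding v(3) l2_norm_mult_mat_vec[OF A v(1)] using le by simp
  also have "\<dots> = c * l2_norm v" using c v(1) by (simp add: real_sqrt_mult l2_norm_sqnorm)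
  also have "\<dots> \<le> c" using c v(2) by (simp add: mult_left_le)
  finally show "x \<le> c" .
qed

lemma op_norm_bound:
  assumes A: "A \<in> carrier_mat n m"
  shows "sqnorm {..<n} (mat_act m A v) \<le> (op_norm A)\<^sup>2 * sqnorm {..<m} v" and "0 \<le> op_norm A"
proof -
  let ?S = "{l2_norm (A *\<^sub>v v) |v. v \<in> carrier_vec (dim_col A) \<and> l2_norm v \<le> 1}"
  define B where "B = sqrt (\<Sum>i<n. (\<Sum>j<m. cmod (A $$ (i, j)))\<^sup>2)"
  have bdd: "bdd_above ?S"
  proof (rule bdd_aboveI)
    fix x assume "x \<in> ?S"
    then obtain v where v: "v \<in> carrier_vec m" "l2_norm v \<le> 1" "x = l2_norm (A *\<^sub>v v)" using A by auto
    have vj: "cmod (v $ j) \<le> 1" if "j < m" for j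
    proof -
      have "(cmod (v $ j))\<^sup>2 \<le> sqnorm {..<m} (\<lambda>j. v $ j)"
        unfolding sqnorm_def using that by (intro member_le_sum) auto
      also have "\<dots> \<le> 1" using v(1,2) by (simp add: l2_norm_sqnorm)
      finally have "(cmod (v $ j))\<^sup>2 \<le> 1\<^sup>2" by simp
      then show ?thesis by (rule power2_le_imp_le) simp
    qed
    have "cmod (mat_act m A (\<lambda>j. v $ j) i) \<le> (\<Sum>j<m. cmod (A $$ (i, j)))" for i
      unfolding mat_act_def
    proof (intro sum_norm_le)
      fix j assume "j \<in> {..<m}"
      then show "cmod (A $$ (i, j) * v $ j) \<le> cmod (A $$ (i, j))"
        unfolding norm_mult using vj[of j] by (intro mult_left_le) auto
    qed
    then show "x \<le> B" unfolding v(3) l2_norm_mult_mat_vec[OF A v(1)] B_def sqnorm_def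
      by (intro real_sqrt_le_mono sum_mono power_mono) auto
  qed
  have op: "l2_norm (A *\<^sub>v v) \<le> op_norm A" if "v \<in> carrier_vec m" "l2_norm v \<le> 1" for v
    unfolding op_norm_def using that A by (intro cSup_upper bdd) auto
  show op0: "0 \<le> op_norm A"
  proof (rule order_trans)
    show "0 \<le> l2_norm (A *\<^sub>v 0\<^sub>v m)" by (simp add: l2_norm_sqnorm sqnorm_nonneg)
    show "l2_norm (A *\<^sub>v 0\<^sub>v m) \<le> op_norm A" by (rule op) (simp_all add: l2_norm_def)
  qed
  show "sqnorm {..<n} (mat_act m A v) \<le> (op_norm A)\<^sup>2 * sqnorm {..<m} v"
  proof (cases "sqnorm {..<m} v = 0")
    case True
    then have "\<forall>j<m. v j = 0" by (simp add: sqnorm_eq_0_iff)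
    then have "mat_act m A v i = 0" for i by (simp add: mat_act_def)
    then show ?thesis using True by (simp add: sqnorm_def)
  next
    case False
    define \<nu> where "\<nu> = sqrt (sqnorm {..<m} v)"
    have \<nu>: "\<nu> > 0" "\<nu>\<^sup>2 = sqnorm {..<m} v" using False sqnorm_nonneg[of "{..<m}" v] by (auto simp: \<nu>_def)
    define w where "w = vec m (\<lambda>j. of_real (1 / \<nu>) * v j)"
    have wc: "w \<in> carrier_vec m" by (simp add: w_def)
    have cm: "(cmod (complex_of_real (1 / \<nu>)))\<^sup>2 = 1 / \<nu>\<^sup>2" using \<nu>(1) by (simp add: norm_divide power_divide)
    have "sqnorm {..<m} (\<lambda>j. w $ j) = sqnorm {..<m} (\<lambda>j. of_real (1 / \<nu>) * v j)"
      by (intro sqnorm_cong) (simp add: w_def)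
    also have "\<dots> = 1" unfolding sqnorm_scale cm \<nu>(2)[symmetric] using \<nu>(1) by simp
    finally have "l2_norm w \<le> 1" using wc by (simp add: l2_norm_sqnorm)
    then have "sqrt (sqnorm {..<n} (mat_act m A (\<lambda>j. w $ j))) \<le> op_norm A"
      using op[OF wc] l2_norm_mult_mat_vec[OF A wc] by simp
    then have "sqnorm {..<n} (mat_act m A (\<lambda>j. w $ j)) \<le> (op_norm A)\<^sup>2"
      using op0 by (simp add: sqrt_le_D)
    moreover have "mat_act m A (\<lambda>j. w $ j) = (\<lambda>i. of_real (1 / \<nu>) * mat_act m A v i)"
      unfolding mat_act_def sum_distrib_left by (intro ext sum.cong refl) (simp add: w_def)
    then have "sqnorm {..<n} (mat_act m A (\<lambda>j. w $ j)) = 1 / \<nu>\<^sup>2 * sqnorm {..<n} (mat_act m A v)"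
      by (simp only: sqnorm_scale cm)
    ultimately show ?thesis unfolding \<nu>(2)[symmetric] using \<nu>(1) by (simp add: field_simps)
  qed
qed

lemma tuple_of_mem_polydisc:
  assumes d: "1 \<le> d" and con: "\<And>c v. c < d \<Longrightarrow> sqnorm {..<n} (\<lambda>i. \<Sum>j<n. z c i j * v j) \<le> sqnorm {..<n} v"
    and s: "0 \<le> s" "s < 1"
  shows "tuple_of d n (\<lambda>c i j. of_real s * z c i j) \<in> nc_polydisc d n"
proof -
  let ?Z = "tuple_of d n (\<lambda>c i j. of_real s * z c i j)"
  have "op_norm (?Z ! c) \<le> s" if c: "c < d" for c
  proof (rule op_norm_le[of _ n n])
    show "?Z ! c \<in> carrier_mat n n" using c by (simp add: tuple_of_nth)
    show "0 \<le> s" by fact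
    fix v
    have "sqnorm {..<n} (mat_act n (?Z ! c) v) = sqnorm {..<n} (\<lambda>i. of_real s * (\<Sum>j<n. z c i j * v j))"
      using c by (intro sqnorm_cong) (simp add: mat_act_def tuple_of_nth sum_distrib_left mult.assoc)
    also have "\<dots> = s\<^sup>2 * sqnorm {..<n} (\<lambda>i. \<Sum>j<n. z c i j * v j)" by (simp add: sqnorm_scale)
    also have "\<dots> \<le> s\<^sup>2 * sqnorm {..<n} v" using con[OF c] by (intro mult_left_mono) auto
    finally show "sqnorm {..<n} (mat_act n (?Z ! c) v) \<le> s\<^sup>2 * sqnorm {..<n} v" .
  qed
  then have "\<forall>x\<in>op_norm ` set ?Z. x < 1" using s(2)
    by (auto simp: in_set_conv_nth) (metis diff_zero length_map length_upt order_le_less_trans tuple_of_def)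
  moreover have "op_norm ` set ?Z \<noteq> {}" using d by (simp add: tuple_of_def)
  ultimately have "tuple_norm ?Z < 1" unfolding tuple_norm_def by (subst Max_less_iff) auto
  then show ?thesis by (simp add: nc_polydisc_def tuple_of_mat_tuples)
qed

lemma mat_adjoint_carrier: "V \<in> carrier_mat n m \<Longrightarrow> mat_adjoint V \<in> carrier_mat m n"
  unfolding mat_adjoint_def by (auto simp: mat_of_rows_def)

lemma psd_defect_imp_contractive:
  assumes V: "V \<in> carrier_mat n n" and psd: "psd (1\<^sub>m n - mat_adjoint V * V)"
  shows "sqnorm {..<n} (mat_act n V x) \<le> sqnorm {..<n} x"
proof -
  define v where "v = vec n x"
  have v: "v \<in> carrier_vec n" by (simp add: v_def)
  have V': "mat_adjoint V \<in> carrier_mat n n" using V mat_adjoint_carrier by blast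
  have adj: "mat_adjoint V $$ (i, j) = cnj (V $$ (j, i))" if "i < n" "j < n" for i j
    using that V unfolding mat_adjoint_def by (simp add: mat_of_rows_def)
  let ?y = "mat_act n V x"
  have Vv: "(V *\<^sub>v v) $ i = ?y i" if "i < n" for i
    using that V by (simp add: mat_act_def v_def scalar_prod_def atLeast0LessThan)
  have ent: "((1\<^sub>m n - mat_adjoint V * V) *\<^sub>v v) $ i = x i - (\<Sum>j<n. cnj (V $$ (j, i)) * ?y j)" if i: "i < n" for i
  proof -
    have "(1\<^sub>m n - mat_adjoint V * V) *\<^sub>v v = 1\<^sub>m n *\<^sub>v v - (mat_adjoint V * V) *\<^sub>v v"
      by (rule minus_mult_distrib_mat_vec) (use V V' v in auto)
    also have "(mat_adjoint V * V) *\<^sub>v v = mat_adjoint V *\<^sub>v (V *\<^sub>v v)"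
      by (rule assoc_mult_mat_vec[OF V' V v])
    finally have "((1\<^sub>m n - mat_adjoint V * V) *\<^sub>v v) $ i = x i - (mat_adjoint V *\<^sub>v (V *\<^sub>v v)) $ i"
      using i v V' V by (simp add: v_def)
    also have "(mat_adjoint V *\<^sub>v (V *\<^sub>v v)) $ i = (\<Sum>j<n. mat_adjoint V $$ (i, j) * (V *\<^sub>v v) $ j)"
      using i V' V v by (simp add: scalar_prod_def atLeast0LessThan)
    also have "\<dots> = (\<Sum>j<n. cnj (V $$ (j, i)) * ?y j)" using i by (intro sum.cong refl) (simp add: adj Vv)
    finally show ?thesis .
  qed
  have "0 \<le> ((1\<^sub>m n - mat_adjoint V * V) *\<^sub>v v) \<bullet>c v"
    using psd v V V' unfolding psd_def by auto
  also have "((1\<^sub>m n - mat_adjoint V * V) *\<^sub>v v) \<bullet>c v = (\<Sum>i<n. (x i - (\<Sum>j<n. cnj (V $$ (j, i)) * ?y j)) * cnj (x i))"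
    using V V' v unfolding scalar_prod_def
    by (simp add: atLeast0LessThan ent del: index_mult_mat_vec) (intro sum.cong refl, simp add: ent v_def del: index_mult_mat_vec)
  also have "\<dots> = inner_on {..<n} x x - inner_on {..<n} ?y ?y"
  proof -
    have "(\<Sum>i<n. (\<Sum>j<n. cnj (V $$ (j, i)) * ?y j) * cnj (x i)) = (\<Sum>i<n. \<Sum>j<n. ?y j * cnj (V $$ (j, i) * x i))"
      unfolding sum_distrib_right by (intro sum.cong refl) (simp add: ac_simps)
    also have "\<dots> = (\<Sum>j<n. \<Sum>i<n. ?y j * cnj (V $$ (j, i) * x i))" by (rule sum.swap)
    also have "\<dots> = (\<Sum>j<n. ?y j * cnj (?y j))" by (simp only: mat_act_def cnj_sum sum_distrib_left)
    finally show ?thesis unfolding inner_on_def left_diff_distrib sum_subtractf by (simp only:)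
  qed
  also have "\<dots> = of_real (sqnorm {..<n} x - sqnorm {..<n} ?y)" by (simp add: inner_on_self)
  finally show ?thesis by (simp add: less_eq_complex_def)
qed

lemma sqnorm_prod_index: "sqnorm {..<N * n} w = (\<Sum>a<N. sqnorm {..<n} (\<lambda>i. w (a * n + i)))"
  for w :: "nat \<Rightarrow> complex"
  unfolding sqnorm_def by (rule sum_prod_index[where f = "\<lambda>j. (cmod (w j))\<^sup>2"])

section \<open>Nilpotent test tuples\<close>

lemma psd_form_signals:
  fixes I :: "nat set"
  assumes "finite I" "psd_form I P" "I \<subseteq> {..<n}"
  shows "\<exists>y. \<forall>a\<in>I. \<forall>b\<in>I. P a b = (\<Sum>c<n. y a c * cnj (y b c))"
proof -
  obtain x where x: "\<And>a b. a \<in> I \<Longrightarrow> b \<in> I \<Longrightarrow> P a b = (\<Sum>c\<in>I. x a c * cnj (x b c))"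
    using psd_form_factorization[OF assms(1,2), of "\<lambda>_. ()"] by blast
  define y where "y = (\<lambda>a c. if c \<in> I then x a c else 0)"
  have "P a b = (\<Sum>c<n. y a c * cnj (y b c))" if "a \<in> I" "b \<in> I" for a b
    unfolding x[OF that] using assms(3) by (intro sum.mono_neutral_cong_left) (auto simp: y_def)
  then show ?thesis by blast
qed

text \<open>The matrix with blocks \<open>Zb t\<close> in position \<open>(Suc t, t)\<close> moves a signal one step ahead in time. Blocks with
  different \<open>t\<close> act on different parts of the signal and have different targets, so energies add up.\<close>

lemma nilpotent_shift_tuple_contractive:
  fixes Zb :: "nat \<Rightarrow> nat \<Rightarrow> nat \<Rightarrow> complex"
  assumes con: "\<And>t v. t < m \<Longrightarrow> sqnorm {..<l} (\<lambda>i. \<Sum>j<l. Zb t i j * v j) \<le> sqnorm {..<l} v"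
  defines "z \<equiv> (\<lambda>p q. if p div l = Suc (q div l) then Zb (q div l) (p mod l) (q mod l) else 0)"
  shows "sqnorm {..<Suc m * l} (\<lambda>p. \<Sum>q<Suc m * l. z p q * v q) \<le> sqnorm {..<Suc m * l} v"
proof -
  have zv: "(\<Sum>q<Suc m * l. z (\<tau> * l + i) q * v q) =
     (case \<tau> of 0 \<Rightarrow> 0 | Suc t \<Rightarrow> \<Sum>j<l. Zb t i j * v (t * l + j))" if "\<tau> < Suc m" "i < l" for \<tau> i
  proof -
    have "(\<Sum>q<Suc m * l. z (\<tau> * l + i) q * v q) =
        (\<Sum>t<Suc m. if \<tau> = Suc t then \<Sum>j<l. Zb t i j * v (t * l + j) else 0)"
      unfolding sum_prod_index
    proof (intro sum.cong refl)
      fix t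
      have "z (\<tau> * l + i) (t * l + j) = (if \<tau> = Suc t then Zb t i j else 0)" if "j < l" for j
      proof -
        have dm: "(\<tau> * l + i) div l = \<tau>" "(\<tau> * l + i) mod l = i" "(t * l + j) div l = t" "(t * l + j) mod l = j"
          using that \<open>i < l\<close> by auto
        show ?thesis unfolding z_def dm ..
      qed
      then show "(\<Sum>j<l. z (\<tau> * l + i) (t * l + j) * v (t * l + j)) =
          (if \<tau> = Suc t then \<Sum>j<l. Zb t i j * v (t * l + j) else 0)"
        by simp
    qed
    also have "\<dots> = (case \<tau> of 0 \<Rightarrow> 0 | Suc t \<Rightarrow> \<Sum>j<l. Zb t i j * v (t * l + j))"
    proof (cases \<tau>)
      case (Suc t)
      then have "(\<Sum>t'<Suc m. if \<tau> = Suc t' then \<Sum>j<l. Zb t' i j * v (t' * l + j) else 0) =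
        (\<Sum>t'<Suc m. if t' = t then \<Sum>j<l. Zb t' i j * v (t' * l + j) else 0)" by (intro sum.cong) auto
      then show ?thesis using Suc that by simp
    qed simp
    finally show ?thesis .
  qed
  have "sqnorm {..<Suc m * l} (\<lambda>p. \<Sum>q<Suc m * l. z p q * v q) =
     (\<Sum>\<tau><Suc m. sqnorm {..<l} (\<lambda>i. case \<tau> of 0 \<Rightarrow> 0 | Suc t \<Rightarrow> \<Sum>j<l. Zb t i j * v (t * l + j)))"
    unfolding sqnorm_prod_index using zv by (intro sum.cong refl sqnorm_cong) simp
  also have "\<dots> = (\<Sum>t<m. sqnorm {..<l} (\<lambda>i. \<Sum>j<l. Zb t i j * v (t * l + j)))"
    unfolding sum.lessThan_Suc_shift by (simp add: sqnorm_def)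
  also have "\<dots> \<le> (\<Sum>t<m. sqnorm {..<l} (\<lambda>i. v (t * l + i)))"
    using con by (intro sum_mono) auto
  also have "\<dots> \<le> (\<Sum>t<Suc m. sqnorm {..<l} (\<lambda>i. v (t * l + i)))" by (simp add: sqnorm_nonneg)
  also have "\<dots> = sqnorm {..<Suc m * l} v" unfolding sqnorm_prod_index ..
  finally show ?thesis .
qed

locale contractive_nc_function =
  fixes d :: nat and f :: "nat nc_expr set"
  assumes d: "1 \<le> d" and f: "f \<in> nc_rational_functions d"
    and dom: "\<And>n. 1 \<le> n \<Longrightarrow> nc_polydisc d n \<subseteq> nc_fun_dom d n f"
    and contr: "\<And>n Z. 1 \<le> n \<Longrightarrow> Z \<in> nc_polydisc d n \<Longrightarrow>
           psd (1\<^sub>m n - mat_adjoint (nc_fun_eval d n f Z) * nc_fun_eval d n f Z)"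
begin

lemma value_carrier:
  assumes "1 \<le> n" "Z \<in> nc_polydisc d n" shows "nc_fun_eval d n f Z \<in> carrier_mat n n"
proof -
  obtain s V where s: "s \<in> f" "Z \<in> mat_tuples d n" "nc_eval n Z s = Some V"
    using dom[OF assms(1)] assms(2) unfolding nc_fun_dom_def nc_dom_def by blast
  show ?thesis unfolding nc_fun_eval_eq[OF f s(1) assms(1) s(2,3)]
    by (rule nc_eval_carrier[OF s(2) nc_class_vars[OF f s(1)] s(3)])
qed

lemma regular_representative: "\<exists>r\<in>f. nc_eval 1 (tuple_of d 1 (\<lambda>_ _ _. 0)) r \<noteq> None"
proof -
  have "tuple_of d 1 (\<lambda>c i j. of_real 0 * 0) \<in> nc_polydisc d 1"
    using tuple_of_mem_polydisc[OF d, of 1 "\<lambda>_ _ _. 0" 0] by (simp add: sqnorm_def)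
  then have "tuple_of d 1 (\<lambda>_ _ _. 0) \<in> nc_fun_dom d 1 f" using dom[of 1] by auto
  then show ?thesis unfolding nc_fun_dom_def nc_dom_def by blast
qed

text \<open>The Gram matrices \<open>P t\<close> are factored into signals \<open>y t\<close>; the conditions on the colours provide the
  blocks of a nilpotent contractive tuple \<open>z\<close> for which \<open>y\<close>, stacked over time, solves the state equations.
  As \<open>z\<close> may have norm \<open>1\<close>, it is replaced by \<open>s z\<close> with \<open>s < 1\<close>. By nilpotency, scaling the signal at time
  \<open>t\<close> by \<open>s ^ t\<close> gives the new solution, a polynomial in \<open>s\<close>, and \<open>s\<close> tends to \<open>1\<close> at the end.\<close>

lemma finite_horizon:
  assumes r: "r \<in> f" and reg: "nc_eval 1 (tuple_of d 1 (\<lambda>_ _ _. 0)) r \<noteq> None"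
    and sys0: "is_system d S0 k0" and real: "realizes d r S0 T0 k0"
    and sys: "is_system d S k" and co: "\<And>w. word_coeff S T k w = word_coeff S0 T0 k0 w"
  shows "finite_horizon_contractive d S T k"
  unfolding finite_horizon_contractive_def
proof (intro allI impI)
  fix m :: nat and P
  let ?I = "insert 0 S"
  assume psd: "\<forall>t\<le>m. psd_form ?I (P t)"
    and init: "\<forall>\<xi>. \<xi> 0 = 0 \<longrightarrow> herm_form ?I (P 0) \<xi> = 0"
    and step: "\<forall>t<m. \<forall>c<d. \<forall>\<xi>. coloured S k c \<xi> \<longrightarrow>
        herm_form ?I (P (Suc t)) \<xi> \<le> herm_form ?I (P t) (coapply_sys S T \<xi>)"
  have S: "finite S" "0 \<notin> S" "k ` S \<subseteq> {..<d}" using sys by (auto simp: is_system_def)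
  define l where "l = Suc (Max ?I)"
  have Il: "?I \<subseteq> {..<l}" using S(1) by (auto simp: l_def less_Suc_eq_le)
  have l: "1 \<le> l" by (simp add: l_def)
  have "\<forall>t. \<exists>y. t \<le> m \<longrightarrow> (\<forall>a\<in>?I. \<forall>b\<in>?I. P t a b = (\<Sum>c<l. y a c * cnj (y b c)))"
    using psd_form_signals[OF _ _ Il] psd S(1) by blast
  then obtain y where y: "\<And>t a b. t \<le> m \<Longrightarrow> a \<in> ?I \<Longrightarrow> b \<in> ?I \<Longrightarrow> P t a b = (\<Sum>c<l. y t a c * cnj (y t b c))"
    by metis
  define y' where "y' = (\<lambda>t a c. apply_sys S T (\<lambda>b. y t b c) a)"
  have hy: "herm_form ?I (P t) \<xi> = sqnorm {..<l} (\<lambda>c. \<Sum>a\<in>?I. \<xi> a * y t a c)" if "t \<le> m" for t \<xi>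
    unfolding sqnorm_def by (rule herm_form_gram) (rule y[OF that])
  have hy': "herm_form ?I (P t) (coapply_sys S T \<xi>) = sqnorm {..<l} (\<lambda>c. \<Sum>a\<in>?I. \<xi> a * y' t a c)" if "t \<le> m" for t \<xi>
    unfolding y'_def by (rule herm_form_coapply[OF S(1,2)]) (rule y[OF that])
  have "\<exists>Z. (\<forall>a\<in>{a \<in> S. k a = c}. \<forall>i\<in>{..<l}. (\<Sum>j\<in>{..<l}. Z i j * y' t a j) = y (Suc t) a i) \<and>
    (\<forall>v. sqnorm {..<l} (\<lambda>i. \<Sum>j\<in>{..<l}. Z i j * v j) \<le> sqnorm {..<l} v)" if t: "t < m" and c: "c < d" for t c
  proof (rule contraction_from_gram_inequality)
    let ?F = "{a \<in> S. k a = c}"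
    show "finite {..<l}" "finite ?F" using S by auto
    fix \<xi> :: "nat \<Rightarrow> complex"
    define \<eta> where "\<eta> = (\<lambda>a. if a \<in> ?F then \<xi> a else 0)"
    have F: "(\<Sum>a\<in>?F. \<xi> a * g a) = (\<Sum>a\<in>?I. \<eta> a * g a)" for g :: "nat \<Rightarrow> complex"
      using S by (intro sum.mono_neutral_cong_left) (auto simp: \<eta>_def)
    have "coloured S k c \<eta>" by (auto simp: coloured_def \<eta>_def split: if_splits)
    then have "herm_form ?I (P (Suc t)) \<eta> \<le> herm_form ?I (P t) (coapply_sys S T \<eta>)" using step t c by blast
    then show "sqnorm {..<l} (\<lambda>j. \<Sum>a\<in>?F. \<xi> a * y (Suc t) a j) \<le> sqnorm {..<l} (\<lambda>j. \<Sum>a\<in>?F. \<xi> a * y' t a j)"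
      unfolding F using hy[of "Suc t" \<eta>] hy'[of t \<eta>] t by simp
  qed
  then have "\<forall>t c. \<exists>Z. t < m \<longrightarrow> c < d \<longrightarrow> (\<forall>a\<in>{a \<in> S. k a = c}. \<forall>i\<in>{..<l}. (\<Sum>j\<in>{..<l}. Z i j * y' t a j) = y (Suc t) a i) \<and>
    (\<forall>v. sqnorm {..<l} (\<lambda>i. \<Sum>j\<in>{..<l}. Z i j * v j) \<le> sqnorm {..<l} v)" by blast
  then obtain Zb where Zb0: "\<forall>t c. t < m \<longrightarrow> c < d \<longrightarrow>
    (\<forall>a\<in>{a \<in> S. k a = c}. \<forall>i\<in>{..<l}. (\<Sum>j\<in>{..<l}. Zb t c i j * y' t a j) = y (Suc t) a i) \<and>
    (\<forall>v. sqnorm {..<l} (\<lambda>i. \<Sum>j\<in>{..<l}. Zb t c i j * v j) \<le> sqnorm {..<l} v)"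
    unfolding choice_iff by blast
  have Zb: "(\<Sum>j<l. Zb t (k a) i j * y' t a j) = y (Suc t) a i" if "t < m" "a \<in> S" "i < l" for t a i
  proof -
    have "k a < d" using that(2) S(3) by auto
    then show ?thesis using Zb0 that by blast
  qed
  have Zcon: "sqnorm {..<l} (\<lambda>i. \<Sum>j<l. Zb t c i j * v j) \<le> sqnorm {..<l} v" if "t < m" "c < d" for t c v
    using Zb0 that by blast
  define n where "n = Suc m * l"
  have n: "1 \<le> n" using l by (simp add: n_def)
  define z where "z = (\<lambda>c p q. if p div l = Suc (q div l) then Zb (q div l) c (p mod l) (q mod l) else 0)"
  have zcon: "sqnorm {..<n} (\<lambda>i. \<Sum>j<n. z c i j * v j) \<le> sqnorm {..<n} v" if "c < d" for c v
    unfolding n_def z_def using nilpotent_shift_tuple_contractive[of m l "\<lambda>t. Zb t c"] Zcon[OF _ that] by blast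
  define p where "p = (\<lambda>a i. monom (y (i div l) a (i mod l)) (i div l))"
  have pe: "poly (p a i) t = t ^ (i div l) * y (i div l) a (i mod l)" for a i t
    by (simp add: p_def poly_monom mult.commute)
  have out: "apply_sys S T (\<lambda>b. poly (p b i) t) a = t ^ (i div l) * y' (i div l) a (i mod l)" for a i t
    unfolding pe y'_def apply_sys_def sum_distrib_left by (simp only: ac_simps)
  have y0: "y 0 a j = 0" if "a \<in> S" "j < l" for a j
  proof -
    define e where "e = (\<lambda>b. if b = a then 1 else 0 :: complex)"
    have "a \<noteq> 0" using that(1) S(2) by metis
    then have "e 0 = 0" by (simp add: e_def)
    then have "sqnorm {..<l} (\<lambda>c. \<Sum>b\<in>?I. e b * y 0 b c) = 0" using init hy[of 0 e] by simp
    moreover have "(\<Sum>b\<in>?I. e b * y 0 b c) = y 0 a c" for c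
    proof -
      have "(\<Sum>b\<in>?I. e b * y 0 b c) = (\<Sum>b\<in>?I. if b = a then y 0 b c else 0)"
        by (intro sum.cong) (auto simp: e_def)
      then show ?thesis using that(1) S(1) by simp
    qed
    ultimately show ?thesis using that(2) by (simp add: sqnorm_eq_0_iff)
  qed
  have sol: "state_eqs S T k n (\<lambda>c i j. t * z c i j) (\<lambda>a i. poly (p a i) t / poly 1 t)" for t
    unfolding state_eqs_def
  proof (intro ballI allI impI)
    fix a i assume a: "a \<in> S" and i: "i < n"
    define \<tau> where "\<tau> = i div l"
    define j where "j = i mod l"
    have tj: "\<tau> < Suc m" "j < l" using i l div_less_mult[of i "Suc m" l] by (auto simp: \<tau>_def j_def n_def)
    have "(\<Sum>q<n. t * z (k a) i q * apply_sys S T (\<lambda>b. poly (p b q) t / poly 1 t) a) =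
      (\<Sum>\<sigma><Suc m. if \<tau> = Suc \<sigma> then t ^ Suc \<sigma> * (\<Sum>h<l. Zb \<sigma> (k a) j h * y' \<sigma> a h) else 0)"
      unfolding n_def sum_prod_index sum_distrib_left
      by (intro sum.cong refl) (auto simp: z_def out sum_distrib_left \<tau>_def[symmetric] j_def[symmetric] ac_simps intro!: sum.cong)
    also have "\<dots> = t ^ \<tau> * y \<tau> a j"
    proof (cases \<tau>)
      case 0
      then show ?thesis using y0[OF a tj(2)] by simp
    next
      case (Suc \<sigma>)
      then have s: "\<sigma> < m" using tj by simp
      have "(\<Sum>\<sigma>'<Suc m. if \<tau> = Suc \<sigma>' then t ^ Suc \<sigma>' * (\<Sum>h<l. Zb \<sigma>' (k a) j h * y' \<sigma>' a h) else 0) =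
          (\<Sum>\<sigma>'<Suc m. if \<sigma>' = \<sigma> then t ^ Suc \<sigma>' * (\<Sum>h<l. Zb \<sigma>' (k a) j h * y' \<sigma>' a h) else 0)"
        using Suc by (intro sum.cong) auto
      also have "\<dots> = t ^ Suc \<sigma> * (\<Sum>h<l. Zb \<sigma> (k a) j h * y' \<sigma> a h)" using s by simp
      finally show ?thesis unfolding Zb[OF s a tj(2)] Suc .
    qed
    finally show "poly (p a i) t / poly 1 t =
        (\<Sum>q<n. t * z (k a) i q * apply_sys S T (\<lambda>b. poly (p b q) t / poly 1 t) a)"
      by (simp add: pe \<tau>_def j_def)
  qed
  have ineq: "(\<Sum>t\<le>m. (s\<^sup>2) ^ t * herm_form ?I (P t) (T 0)) \<le> (\<Sum>t\<le>m. (s\<^sup>2) ^ t * herm_form ?I (P t) input_vec)"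
    if s: "0 \<le> s" "s < 1" for s
  proof -
    let ?Z = "tuple_of d n (\<lambda>c i j. of_real s * z c i j)"
    have Z: "?Z \<in> nc_polydisc d n" by (rule tuple_of_mem_polydisc[OF d zcon s])
    let ?V = "nc_fun_eval d n f ?Z"
    define U where "U = (\<lambda>i. poly (p 0 i) (of_real s) / poly 1 (of_real s))"
    define Y where "Y = (\<lambda>i. apply_sys S T (\<lambda>b. poly (p b i) (of_real s) / poly 1 (of_real s)) 0)"
    have "mat_act n ?V U i = Y i" if "i < n" for i
      unfolding U_def Y_def
      by (rule value_equals_output[OF f r reg sys0 real sys co n sol _ _ that]) (use Z dom[OF n] in auto)
    then have "sqnorm {..<n} Y = sqnorm {..<n} (mat_act n ?V U)" by (intro sqnorm_cong) simp
    also have "\<dots> \<le> sqnorm {..<n} U"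
      by (rule psd_defect_imp_contractive[OF value_carrier[OF n Z] contr[OF n Z]])
    finally have le: "sqnorm {..<n} Y \<le> sqnorm {..<n} U" .
    have cs: "(cmod (of_real s ^ t :: complex))\<^sup>2 = (s\<^sup>2) ^ t" for t
      using s by (simp add: norm_power power_even_abs power_mult[symmetric] mult.commute flip: power_mult)
    have "sqnorm {..<n} Y = (\<Sum>t<Suc m. (s\<^sup>2) ^ t * sqnorm {..<l} (y' t 0))"
      unfolding n_def sqnorm_prod_index
    proof (intro sum.cong refl)
      fix t
      have "sqnorm {..<l} (\<lambda>i. Y (t * l + i)) = sqnorm {..<l} (\<lambda>i. of_real s ^ t * y' t 0 i)"
        by (intro sqnorm_cong) (simp add: Y_def out)
      then show "sqnorm {..<l} (\<lambda>i. Y (t * l + i)) = (s\<^sup>2) ^ t * sqnorm {..<l} (y' t 0)"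
        by (simp only: sqnorm_scale cs)
    qed
    moreover have "sqnorm {..<n} U = (\<Sum>t<Suc m. (s\<^sup>2) ^ t * sqnorm {..<l} (y t 0))"
      unfolding n_def sqnorm_prod_index
    proof (intro sum.cong refl)
      fix t
      have "sqnorm {..<l} (\<lambda>i. U (t * l + i)) = sqnorm {..<l} (\<lambda>i. of_real s ^ t * y t 0 i)"
        by (intro sqnorm_cong) (simp add: U_def pe)
      then show "sqnorm {..<l} (\<lambda>i. U (t * l + i)) = (s\<^sup>2) ^ t * sqnorm {..<l} (y t 0)"
        by (simp only: sqnorm_scale cs)
    qed
    moreover have "herm_form ?I (P t) (T 0) = sqnorm {..<l} (y' t 0)" if "t \<le> m" for t
    proof -
      have "(\<Sum>a\<in>?I. T 0 a * y t a c) = y' t 0 c" for c by (simp only: y'_def apply_sys_def)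
      then show ?thesis using hy[OF that, of "T 0"] by simp
    qed
    moreover have "herm_form ?I (P t) input_vec = sqnorm {..<l} (y t 0)" if "t \<le> m" for t
    proof -
      have "(\<Sum>a\<in>S. input_vec a * y t a c) = 0" for c
        using S(2) by (intro sum.neutral) (auto simp: input_vec_def)
      then have "(\<Sum>a\<in>?I. input_vec a * y t a c) = y t 0 c" for c
        using S(1,2) by (simp add: input_vec_def[of 0])
      then show ?thesis using hy[OF that, of input_vec] by simp
    qed
    ultimately show ?thesis using le by (simp add: lessThan_Suc_atMost)
  qed
  define s where "s = (\<lambda>i. 1 - inverse (real (Suc (Suc i))))"
  have s01: "0 \<le> s i" "s i < 1" for i
    unfolding s_def by (simp_all add: inverse_le_1_iff)
  have "(\<lambda>i. inverse (real (Suc (Suc i)))) \<longlonglongrightarrow> 0"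
    using LIMSEQ_Suc[OF LIMSEQ_inverse_real_of_nat] .
  then have "s \<longlonglongrightarrow> 1 - 0" unfolding s_def by (intro tendsto_diff tendsto_const)
  then have s1: "s \<longlonglongrightarrow> 1" by simp
  have lim: "(\<lambda>i. \<Sum>t\<le>m. ((s i)\<^sup>2) ^ t * g t) \<longlonglongrightarrow> (\<Sum>t\<le>m. (1\<^sup>2) ^ t * g t)" for g :: "nat \<Rightarrow> real"
    by (intro tendsto_intros s1)
  have "(\<Sum>t\<le>m. (1\<^sup>2) ^ t * herm_form ?I (P t) (T 0)) \<le> (\<Sum>t\<le>m. (1\<^sup>2) ^ t * herm_form ?I (P t) input_vec)"
    by (rule LIMSEQ_le[OF lim lim]) (use ineq s01 in auto)
  then show "(\<Sum>t\<le>m. herm_form ?I (P t) (T 0)) \<le> (\<Sum>t\<le>m. herm_form ?I (P t) input_vec)" by simp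
qed

end

section \<open>The transfer formula on the polydisc\<close>

text \<open>The state equations with zero input do not increase the total energy \<open>E\<close> in the step through \<open>T\<close> and
  shrink it by \<open>\<sigma>\<close> in the step through \<open>Z\<close>.\<close>

lemma contractive_system_unique_solution:
  assumes sys: "is_system d S k"
    and con: "\<And>v. sqnorm (insert 0 S) (apply_sys S T v) \<le> sqnorm (insert 0 S) v"
    and \<sigma>: "\<sigma> < 1" and z: "\<And>c v. c < d \<Longrightarrow> sqnorm {..<n} (\<lambda>i. \<Sum>j<n. z c i j * v j) \<le> \<sigma> * sqnorm {..<n} v"
    and \<sigma>0: "0 \<le> \<sigma>"
    and X0: "\<And>i. i < n \<Longrightarrow> X 0 i = 0" and X: "state_eqs S T k n z X" and a: "a \<in> S" and i: "i < n"
  shows "X a i = 0"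
proof -
  have S: "finite S" "0 \<notin> S" "k ` S \<subseteq> {..<d}" using sys by (auto simp: is_system_def)
  let ?Y = "\<lambda>a j. apply_sys S T (\<lambda>b. X b j) a"
  define E where "E = (\<Sum>a\<in>S. sqnorm {..<n} (X a))"
  have "E \<le> (\<Sum>a\<in>S. \<sigma> * sqnorm {..<n} (?Y a))"
    unfolding E_def
  proof (intro sum_mono)
    fix a assume a: "a \<in> S"
    have "sqnorm {..<n} (X a) = sqnorm {..<n} (\<lambda>i. \<Sum>j<n. z (k a) i j * ?Y a j)"
      using X a by (intro sqnorm_cong) (simp add: state_eqs_def)
    also have "\<dots> \<le> \<sigma> * sqnorm {..<n} (?Y a)" using z[of "k a" "?Y a"] a S(3) by auto
    finally show "sqnorm {..<n} (X a) \<le> \<sigma> * sqnorm {..<n} (?Y a)" .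
  qed
  also have "\<dots> = \<sigma> * (\<Sum>a\<in>S. sqnorm {..<n} (?Y a))" by (simp add: sum_distrib_left)
  also have "(\<Sum>a\<in>S. sqnorm {..<n} (?Y a)) \<le> E"
  proof -
    have "(\<Sum>a\<in>S. sqnorm {..<n} (?Y a)) = (\<Sum>j<n. \<Sum>a\<in>S. (cmod (?Y a j))\<^sup>2)"
      unfolding sqnorm_def by (rule sum.swap)
    also have "\<dots> \<le> (\<Sum>j<n. sqnorm (insert 0 S) (\<lambda>a. ?Y a j))"
      unfolding sqnorm_def using S by (intro sum_mono sum_mono2) auto
    also have "\<dots> \<le> (\<Sum>j<n. sqnorm (insert 0 S) (\<lambda>b. X b j))"
      using con[of "\<lambda>b. X b j" for j] by (intro sum_mono) (simp add: eta_contract_eq)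
    also have "\<dots> = (\<Sum>j<n. \<Sum>a\<in>S. (cmod (X a j))\<^sup>2)"
      using X0 S by (intro sum.cong refl) (simp add: sqnorm_def)
    also have "\<dots> = E" unfolding E_def sqnorm_def by (rule sum.swap)
    finally show ?thesis .
  qed
  finally have "E \<le> \<sigma> * E" using \<sigma>0 by (simp add: mult_left_mono)
  moreover have E0: "E \<ge> 0" unfolding E_def by (intro sum_nonneg sqnorm_nonneg)
  ultimately have "E = 0" using \<sigma> by (metis mult_left_le_one_le mult_le_cancel_right1 not_less order_antisym order_le_less)
  then have "sqnorm {..<n} (X a) = 0" using a S(1) unfolding E_def
    by (subst (asm) sum_nonneg_eq_0_iff) (auto simp: sqnorm_nonneg)
  then show ?thesis using i by (simp add: sqnorm_eq_0_iff)
qed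

lemma state_eqs_diff:
  assumes "state_eqs S T k n z X" "state_eqs S T k n z Y"
  shows "state_eqs S T k n z (\<lambda>a i. X a i - Y a i)"
proof -
  have "apply_sys S T (\<lambda>b. X b j - Y b j) a = apply_sys S T (\<lambda>b. X b j) a - apply_sys S T (\<lambda>b. Y b j) a" for j a
    unfolding apply_sys_def by (simp add: right_diff_distrib sum_subtractf)
  then show ?thesis using assms unfolding state_eqs_def by (simp add: right_diff_distrib sum_subtractf)
qed

lemma polydisc_contraction_factor:
  assumes d: "1 \<le> d" and Z: "Z \<in> nc_polydisc d n"
  shows "\<exists>\<sigma>. 0 \<le> \<sigma> \<and> \<sigma> < 1 \<and> (\<forall>c<d. \<forall>v. sqnorm {..<n} (mat_act n (Z ! c) v) \<le> \<sigma> * sqnorm {..<n} v)"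
proof -
  have Zt: "length Z = d" "set Z \<subseteq> carrier_mat n n" and tn: "tuple_norm Z < 1"
    using Z by (auto simp: nc_polydisc_def mat_tuples_def)
  have Zc: "Z ! c \<in> carrier_mat n n" "op_norm (Z ! c) \<le> tuple_norm Z" if "c < d" for c
    using that Zt by (auto simp: tuple_norm_def)
  have t0: "0 \<le> tuple_norm Z" using Zc[of 0] op_norm_bound(2)[OF Zc(1)[of 0]] d by simp
  show ?thesis
  proof (intro exI[of _ "(tuple_norm Z)\<^sup>2"] conjI allI impI)
    show "(tuple_norm Z)\<^sup>2 < 1" using t0 tn by (simp add: power_less_one_iff)
    fix c v assume c: "c < d"
    have "(op_norm (Z ! c))\<^sup>2 \<le> (tuple_norm Z)\<^sup>2"
      using Zc[OF c] op_norm_bound(2)[OF Zc(1)[OF c]] by (intro power_mono) auto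
    then have "(op_norm (Z ! c))\<^sup>2 * sqnorm {..<n} v \<le> (tuple_norm Z)\<^sup>2 * sqnorm {..<n} v"
      by (intro mult_right_mono sqnorm_nonneg)
    then show "sqnorm {..<n} (mat_act n (Z ! c) v) \<le> (tuple_norm Z)\<^sup>2 * sqnorm {..<n} v"
      using op_norm_bound(1)[OF Zc(1)[OF c], of v] by linarith
  qed simp
qed

context contractive_nc_function begin

text \<open>Uniqueness of solutions means that the denominator \<open>q\<close> of the rational family of solutions at \<open>t Z\<close> does
  not vanish at \<open>t = 1\<close>, so the identity between \<open>f\<close> and the output extends to \<open>Z\<close> itself.\<close>

lemma value_from_state_solution:
  assumes r: "r \<in> f" and reg: "nc_eval 1 (tuple_of d 1 (\<lambda>_ _ _. 0)) r \<noteq> None"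
    and sys0: "is_system d S0 k0" and real: "realizes d r S0 T0 k0"
    and sys: "is_system d S k" and co: "\<And>w. word_coeff S T k w = word_coeff S0 T0 k0 w"
    and con: "\<And>v. sqnorm (insert 0 S) (apply_sys S T v) \<le> sqnorm (insert 0 S) v"
    and n: "1 \<le> n" and Z: "Z \<in> nc_polydisc d n"
    and X: "state_eqs S T k n (\<lambda>c i j. (Z ! c) $$ (i, j)) X" and i: "i < n"
  shows "mat_act n (nc_fun_eval d n f Z) (X 0) i = apply_sys S T (\<lambda>b. X b i) 0"
proof -
  let ?z = "\<lambda>c i j. (Z ! c) $$ (i, j)"
  have S: "finite S" "0 \<notin> S" "k ` S \<subseteq> {..<d}" using sys by (auto simp: is_system_def)
  obtain \<sigma> where \<sigma>: "0 \<le> \<sigma>" "\<sigma> < 1" "\<And>c v. c < d \<Longrightarrow> sqnorm {..<n} (mat_act n (Z ! c) v) \<le> \<sigma> * sqnorm {..<n} v"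
    using polydisc_contraction_factor[OF d Z] by blast
  have zc: "sqnorm {..<n} (\<lambda>i. \<Sum>j<n. ?z c i j * v j) \<le> \<sigma> * sqnorm {..<n} v" if "c < d" for c v
  proof -
    have "mat_act n (Z ! c) v = (\<lambda>i. \<Sum>j<n. ?z c i j * v j)" by (rule ext) (simp add: mat_act_def)
    then show ?thesis using \<sigma>(3)[OF that, of v] by simp
  qed
  have Zt: "tuple_of d n ?z = Z" using mat_tuple_eq_tuple_of[of Z d n] Z by (simp add: nc_polydisc_def)
  obtain q where fam: "\<And>U. \<exists>p. (\<forall>i. p 0 i = smult (U i) q) \<and> (\<forall>t. poly q t \<noteq> 0 \<longrightarrow>
       state_eqs S T k n (\<lambda>c i j. t * ?z c i j) (\<lambda>a i. poly (p a i) t / poly q t))"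
    and sing: "\<And>t. poly q t = 0 \<Longrightarrow> \<exists>X. (\<forall>i. X 0 i = 0) \<and> state_eqs S T k n (\<lambda>c i j. t * ?z c i j) X \<and>
       (\<exists>a\<in>S. \<exists>i<n. X a i \<noteq> 0)"
    using solution_family[OF S(1,2), of T k n ?z] by blast
  have q1: "poly q 1 \<noteq> 0"
  proof
    assume "poly q 1 = 0"
    from sing[OF this] obtain Y a j where Y: "\<And>i. Y 0 i = 0" "state_eqs S T k n ?z Y" "a \<in> S" "j < n" "Y a j \<noteq> 0"
      by auto
    have "Y a j = 0"
      by (rule contractive_system_unique_solution[OF sys con \<sigma>(2) zc \<sigma>(1) Y(1,2,3,4)])
    then show False using Y(5) by simp
  qed
  obtain p where p0: "\<And>i. p 0 i = smult (X 0 i) q" and p: "\<And>t. poly q t \<noteq> 0 \<Longrightarrow>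
       state_eqs S T k n (\<lambda>c i j. t * ?z c i j) (\<lambda>a i. poly (p a i) t / poly q t)"
    using fam[of "X 0"] by blast
  define Y where "Y = (\<lambda>a i. poly (p a i) 1 / poly q 1)"
  have Y0: "Y 0 = X 0" using q1 by (auto simp: Y_def p0)
  have Ys: "state_eqs S T k n ?z Y" using p[OF q1] by (simp add: Y_def)
  have "X a j - Y a j = 0" if "a \<in> S" "j < n" for a j
    by (rule contractive_system_unique_solution[OF sys con \<sigma>(2) zc \<sigma>(1) _ state_eqs_diff[OF X Ys] that])
      (simp_all only: fun_cong[OF Y0] diff_self)
  then have XY: "X b i = Y b i" if "b \<in> insert 0 S" for b using that i Y0 by auto
  have "mat_act n (nc_fun_eval d n f (tuple_of d n (\<lambda>c i j. 1 * ?z c i j))) (\<lambda>i. poly (p 0 i) 1 / poly q 1) i =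
      apply_sys S T (\<lambda>b. poly (p b i) 1 / poly q 1) 0"
    by (rule value_equals_output[OF f r reg sys0 real sys co n p q1 _ i]) (use Zt Z dom[OF n] in auto)
  then have "mat_act n (nc_fun_eval d n f Z) (Y 0) i = apply_sys S T (\<lambda>b. Y b i) 0"
    using Zt by (simp add: Y_def)
  also have "\<dots> = apply_sys S T (\<lambda>b. X b i) 0" unfolding apply_sys_def using XY by simp
  finally show ?thesis unfolding Y0 .
qed

lemma contractive_state_space:
  "\<exists>S T k. is_system d S k \<and> (\<forall>v. sqnorm (insert 0 S) (apply_sys S T v) \<le> sqnorm (insert 0 S) v) \<and>
    (\<forall>n Z X i. 1 \<le> n \<longrightarrow> Z \<in> nc_polydisc d n \<longrightarrow> state_eqs S T k n (\<lambda>c i j. (Z ! c) $$ (i, j)) X \<longrightarrow> i < n \<longrightarrow>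
      mat_act n (nc_fun_eval d n f Z) (X 0) i = apply_sys S T (\<lambda>b. X b i) 0)"
proof -
  obtain r where r: "r \<in> f" "nc_eval 1 (tuple_of d 1 (\<lambda>_ _ _. 0)) r \<noteq> None" using regular_representative by blast
  have "has_realization_above d 0 r" by (rule realization_exists[OF nc_class_vars[OF f r(1)] r(2)])
  then obtain S0 k0 T0 where S0: "finite S0" "\<And>a. a \<in> S0 \<Longrightarrow> 0 < a" "k0 ` S0 \<subseteq> {..<d}" "realizes d r S0 T0 k0"
    by (rule has_realization_aboveE) (rule that)
  have sys0: "is_system d S0 k0" using S0(1-3) by (auto simp: is_system_def)
  have "\<exists>S T k. is_system d S k \<and> (\<forall>w. word_coeff S T k w = word_coeff S0 T0 k0 w) \<and>
    (\<forall>v. sqnorm (insert 0 S) (apply_sys S T v) \<le> sqnorm (insert 0 S) v)"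
    by (rule contractive_realization[OF sys0], rule finite_horizon[OF r sys0 S0(4)]) auto
  then obtain S T k where S: "is_system d S k" "\<And>w. word_coeff S T k w = word_coeff S0 T0 k0 w"
    "\<And>v. sqnorm (insert 0 S) (apply_sys S T v) \<le> sqnorm (insert 0 S) v" by blast
  show ?thesis
    using value_from_state_solution[OF r sys0 S0(4) S] S(1,3) by blast
qed

end

section \<open>The block matrix formula\<close>

lemma diag_block_mat_carrier:
  "set Xs \<subseteq> carrier_mat n n \<Longrightarrow> diag_block_mat Xs \<in> carrier_mat (length Xs * n) (length Xs * n)"
proof (induction Xs)
  case (Cons A As)
  then show ?case by (auto simp: Let_def)
qed simp

lemma diag_block_mat_entry:
  assumes "set Xs \<subseteq> carrier_mat n n" "\<alpha> < length Xs" "\<beta> < length Xs" "i < n" "j < n"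
  shows "diag_block_mat Xs $$ (\<alpha> * n + i, \<beta> * n + j) = (if \<alpha> = \<beta> then (Xs ! \<alpha>) $$ (i, j) else 0)"
  using assms
proof (induction Xs arbitrary: \<alpha> \<beta>)
  case (Cons A As)
  have A: "A \<in> carrier_mat n n" and As: "set As \<subseteq> carrier_mat n n" using Cons.prems by auto
  have D: "diag_block_mat As \<in> carrier_mat (length As * n) (length As * n)" by (rule diag_block_mat_carrier[OF As])
  have e: "diag_block_mat (A # As) $$ (p, q) = (if p < n then if q < n then A $$ (p, q) else 0
      else if q < n then 0 else diag_block_mat As $$ (p - n, q - n))"
    if "p < length (A # As) * n" "q < length (A # As) * n" for p q
    using that A D by (auto simp: Let_def)
  have e': "diag_block_mat (A # As) $$ (\<alpha> * n + i, \<beta> * n + j) = (if \<alpha> * n + i < n then if \<beta> * n + j < n then A $$ (\<alpha> * n + i, \<beta> * n + j) else 0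
      else if \<beta> * n + j < n then 0 else diag_block_mat As $$ (\<alpha> * n + i - n, \<beta> * n + j - n))"
    using Cons.prems by (intro e index_less_mult) auto
  have IH: "diag_block_mat As $$ (\<alpha>' * n + i, \<beta>' * n + j) = (if \<alpha>' = \<beta>' then (As ! \<alpha>') $$ (i, j) else 0)"
    if "\<alpha>' < length As" "\<beta>' < length As" for \<alpha>' \<beta>'
    using Cons.IH[OF As that Cons.prems(4,5)] .
  show ?case
    unfolding e' using IH Cons.prems
    by (cases \<alpha>; cases \<beta>) (simp_all add: add.assoc del: diag_block_mat.simps)
qed simp

lemma kron_one_times_entry:
  assumes A: "A \<in> carrier_mat a N" and Y: "Y \<in> carrier_mat (N * n) c" and "\<alpha> < a" "i < n" "l < c"
  shows "(kron A (1\<^sub>m n) * Y) $$ (\<alpha> * n + i, l) = (\<Sum>\<beta><N. A $$ (\<alpha>, \<beta>) * Y $$ (\<beta> * n + i, l))"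
proof -
  have "(kron A (1\<^sub>m n) * Y) $$ (\<alpha> * n + i, l) = (\<Sum>h<N * n. kron A (1\<^sub>m n) $$ (\<alpha> * n + i, h) * Y $$ (h, l))"
    by (rule mat_mult_entry[OF kron_one_carrier[OF A] Y index_less_mult assms(5)]) fact+
  also have "\<dots> = (\<Sum>\<beta><N. \<Sum>j<n. if j = i then A $$ (\<alpha>, \<beta>) * Y $$ (\<beta> * n + j, l) else 0)"
    unfolding sum_prod_index
  proof (intro sum.cong refl)
    fix \<beta> j assume "\<beta> \<in> {..<N}" "j \<in> {..<n}"
    then show "kron A (1\<^sub>m n) $$ (\<alpha> * n + i, \<beta> * n + j) * Y $$ (\<beta> * n + j, l) =
        (if j = i then A $$ (\<alpha>, \<beta>) * Y $$ (\<beta> * n + j, l) else 0)"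
      using kron_one_entry[OF A index_less_mult[OF assms(3,4)] index_less_mult[of \<beta> N j n]] assms(4) by auto
  qed
  also have "\<dots> = (\<Sum>\<beta><N. A $$ (\<alpha>, \<beta>) * Y $$ (\<beta> * n + i, l))" using assms(4) by simp
  finally show ?thesis .
qed

lemma diag_block_mat_times_entry:
  assumes Xs: "set Xs \<subseteq> carrier_mat n n" "length Xs = N" and Y: "Y \<in> carrier_mat (N * n) c"
    and "\<alpha> < N" "i < n" "l < c"
  shows "(diag_block_mat Xs * Y) $$ (\<alpha> * n + i, l) = (\<Sum>j<n. (Xs ! \<alpha>) $$ (i, j) * Y $$ (\<alpha> * n + j, l))"
proof -
  have D: "diag_block_mat Xs \<in> carrier_mat (N * n) (N * n)" using diag_block_mat_carrier[OF Xs(1)] Xs(2) by simp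
  have "(diag_block_mat Xs * Y) $$ (\<alpha> * n + i, l) = (\<Sum>h<N * n. diag_block_mat Xs $$ (\<alpha> * n + i, h) * Y $$ (h, l))"
    by (rule mat_mult_entry[OF D Y index_less_mult[OF assms(4,5)] assms(6)])
  also have "\<dots> = (\<Sum>\<beta><N. if \<beta> = \<alpha> then \<Sum>j<n. (Xs ! \<alpha>) $$ (i, j) * Y $$ (\<beta> * n + j, l) else 0)"
    unfolding sum_prod_index
  proof (intro sum.cong refl)
    fix \<beta> assume "\<beta> \<in> {..<N}"
    then have "diag_block_mat Xs $$ (\<alpha> * n + i, \<beta> * n + j) = (if \<alpha> = \<beta> then (Xs ! \<alpha>) $$ (i, j) else 0)" if "j < n" for j
      using diag_block_mat_entry[OF Xs(1), of \<alpha> \<beta> i j] assms that by simp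
    then show "(\<Sum>j<n. diag_block_mat Xs $$ (\<alpha> * n + i, \<beta> * n + j) * Y $$ (\<beta> * n + j, l)) =
        (if \<beta> = \<alpha> then \<Sum>j<n. (Xs ! \<alpha>) $$ (i, j) * Y $$ (\<beta> * n + j, l) else 0)"
      by (cases "\<beta> = \<alpha>") auto
  qed
  also have "\<dots> = (\<Sum>j<n. (Xs ! \<alpha>) $$ (i, j) * Y $$ (\<alpha> * n + j, l))" using assms(4) by simp
  finally show ?thesis .
qed

lemma minus_entry:
  "X \<in> carrier_mat n m \<Longrightarrow> i < n \<Longrightarrow> j < m \<Longrightarrow> (Y - X) $$ (i, j) = Y $$ (i, j) - X $$ (i, j)"
  by auto

lemma plus_entry:
  "X \<in> carrier_mat n m \<Longrightarrow> i < n \<Longrightarrow> j < m \<Longrightarrow> (Y + X) $$ (i, j) = Y $$ (i, j) + X $$ (i, j)"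
  by auto

theorem theorem2:
  fixes d :: nat and f :: "nat nc_expr set"
  assumes "d \<ge> 1"
    and "f \<in> nc_rational_functions d"
    and "\<And>n. n \<ge> 1 \<Longrightarrow> nc_polydisc d n \<subseteq> nc_fun_dom d n f"
    and "\<And>n Z. n \<ge> 1 \<Longrightarrow> Z \<in> nc_polydisc d n \<Longrightarrow>
           psd (1\<^sub>m n - mat_adjoint (nc_fun_eval d n f Z) * nc_fun_eval d n f Z)"
  shows "\<exists>(N :: nat) (A :: complex mat) (B :: complex mat) (C :: complex mat) (D :: complex mat)
           (k :: nat \<Rightarrow> nat).
           A \<in> carrier_mat 1 1 \<and> B \<in> carrier_mat 1 N \<and> C \<in> carrier_mat N 1 \<and> D \<in> carrier_mat N N \<and>
           contraction (four_block_mat A B C D) \<and>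
           (\<forall>j<N. k j < d) \<and>
           (\<forall>n\<ge>1. \<forall>Z \<in> nc_polydisc d n.
              let \<Delta> = diag_block_mat (map (\<lambda>j. Z ! k j) [0..<N]);
                  M = kron (1\<^sub>m N) (1\<^sub>m n) - kron D (1\<^sub>m n) * \<Delta>
              in invertible_mat M \<and>
                 nc_fun_eval d n f Z =
                   kron A (1\<^sub>m n) + kron B (1\<^sub>m n) * \<Delta> * the (mat_inverse M) * kron C (1\<^sub>m n))"
proof -
  interpret contractive_nc_function d f by unfold_locales (use assms in auto)
  obtain S T k where sys: "is_system d S k"
    and con: "\<And>v. sqnorm (insert 0 S) (apply_sys S T v) \<le> sqnorm (insert 0 S) v"
    and val: "\<And>n Z X i. 1 \<le> n \<Longrightarrow> Z \<in> nc_polydisc d n \<Longrightarrow>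
      state_eqs S T k n (\<lambda>c i j. (Z ! c) $$ (i, j)) X \<Longrightarrow> i < n \<Longrightarrow>
      mat_act n (nc_fun_eval d n f Z) (X 0) i = apply_sys S T (\<lambda>b. X b i) 0"
    using contractive_state_space by blast
  have S: "finite S" "0 \<notin> S" "k ` S \<subseteq> {..<d}" using sys by (auto simp: is_system_def)
  have S0: "a \<noteq> 0" if "a \<in> S" for a using that S(2) by metis
  define N where "N = card S"
  obtain h where h: "bij_betw h {..<N} S"
    using ex_bij_betw_nat_finite[OF S(1)] unfolding N_def atLeast0LessThan by blast
  have hS: "h \<alpha> \<in> S" if "\<alpha> < N" for \<alpha> using that h by (auto simp: bij_betw_def)
  have hz: "h \<alpha> = 0 \<longleftrightarrow> False" if "\<alpha> < N" for \<alpha> using S0[OF hS[OF that]] by simp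
  define g where "g = inv_into {..<N} h"
  have gh: "g (h \<alpha>) = \<alpha>" if "\<alpha> < N" for \<alpha> using that h unfolding g_def by (auto simp: bij_betw_def)
  have hg: "h (g a) = a" "g a < N" if "a \<in> S" for a
    using that h bij_betw_inv_into_right[OF h] unfolding g_def
    by (auto simp: bij_betw_def intro: inv_into_into[of _ h "{..<N}", simplified])
  have sumS: "(\<Sum>b\<in>S. F b) = (\<Sum>\<beta><N. F (h \<beta>))" for F :: "nat \<Rightarrow> complex"
    by (rule sum.reindex_bij_betw[OF h, symmetric])
  have sumS_real: "(\<Sum>b\<in>S. F b) = (\<Sum>\<beta><N. F (h \<beta>))" for F :: "nat \<Rightarrow> real"
    by (rule sum.reindex_bij_betw[OF h, symmetric])
  have app: "apply_sys S T x a = T a 0 * x 0 + (\<Sum>\<beta><N. T a (h \<beta>) * x (h \<beta>))" for x a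
    using S by (simp add: apply_sys_insert sumS)
  define A where "A = mat 1 1 (\<lambda>_. T 0 0)"
  define B where "B = mat 1 N (\<lambda>(_, \<beta>). T 0 (h \<beta>))"
  define C where "C = mat N 1 (\<lambda>(\<alpha>, _). T (h \<alpha>) 0)"
  define D where "D = mat N N (\<lambda>(\<alpha>, \<beta>). T (h \<alpha>) (h \<beta>))"
  have car: "A \<in> carrier_mat 1 1" "B \<in> carrier_mat 1 N" "C \<in> carrier_mat N 1" "D \<in> carrier_mat N N"
    by (simp_all add: A_def B_def C_def D_def)
  define hh where "hh = (\<lambda>i. case i of 0 \<Rightarrow> 0 | Suc \<alpha> \<Rightarrow> h \<alpha>)"
  have four: "four_block_mat A B C D \<in> carrier_mat (Suc N) (Suc N)" using car by auto
  have four_entry: "four_block_mat A B C D $$ (i, j) = T (hh i) (hh j)" if "i < Suc N" "j < Suc N" for i j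
    using that car by (cases i; cases j) (auto simp: A_def B_def C_def D_def hh_def)
  have contr: "contraction (four_block_mat A B C D)"
    unfolding contraction_def
  proof (rule op_norm_le[OF four])
    fix v :: "nat \<Rightarrow> complex"
    define x where "x = (\<lambda>a. if a = 0 then v 0 else v (Suc (g a)))"
    have xh: "x (h \<beta>) = v (Suc \<beta>)" if "\<beta> < N" for \<beta> using that by (simp only: x_def hz gh if_False)
    have x0: "x 0 = v 0" by (simp add: x_def)
    have mvx: "mat_act (Suc N) (four_block_mat A B C D) v i = apply_sys S T x (hh i)" if "i < Suc N" for i
      unfolding mat_act_def app sum.lessThan_Suc_shift using that
      by (simp add: four_entry hh_def xh x0)
    have norm: "sqnorm {..<Suc N} (\<lambda>i. y (hh i)) = sqnorm (insert 0 S) y" for y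
      unfolding sqnorm_def sum.lessThan_Suc_shift using S by (simp add: hh_def sumS_real)
    have "sqnorm {..<Suc N} (mat_act (Suc N) (four_block_mat A B C D) v) = sqnorm (insert 0 S) (apply_sys S T x)"
      unfolding norm[symmetric] using mvx by (intro sqnorm_cong) simp
    also have "\<dots> \<le> sqnorm (insert 0 S) x" by (rule con)
    also have "\<dots> = sqnorm {..<Suc N} v"
      unfolding norm[symmetric]
    proof (intro sqnorm_cong)
      fix i assume "i \<in> {..<Suc N}"
      then show "x (hh i) = v i" using xh x0 by (cases i) (auto simp: hh_def)
    qed
    finally show "sqnorm {..<Suc N} (mat_act (Suc N) (four_block_mat A B C D) v) \<le> 1\<^sup>2 * sqnorm {..<Suc N} v" by simp
  qed simp
  define K where "K = (\<lambda>\<alpha>. k (h \<alpha>))"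
  have Kd: "K \<alpha> < d" if "\<alpha> < N" for \<alpha> using hS[OF that] S(3) by (auto simp: K_def)
  have main: "invertible_mat (kron (1\<^sub>m N) (1\<^sub>m n) - kron D (1\<^sub>m n) * \<Delta>) \<and>
      nc_fun_eval d n f Z = kron A (1\<^sub>m n) + kron B (1\<^sub>m n) * \<Delta> *
        the (mat_inverse (kron (1\<^sub>m N) (1\<^sub>m n) - kron D (1\<^sub>m n) * \<Delta>)) * kron C (1\<^sub>m n)"
    if n: "1 \<le> n" and Z: "Z \<in> nc_polydisc d n" and \<Delta>_eq: "\<Delta> = diag_block_mat (map (\<lambda>j. Z ! K j) [0..<N])" for n Z \<Delta>
  proof -
    define Xs where "Xs = map (\<lambda>j. Z ! K j) [0..<N]"
    have Zc: "Z ! c \<in> carrier_mat n n" if "c < d" for c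
      using Z that by (auto simp: nc_polydisc_def mat_tuples_def subset_iff)
    have Xs: "set Xs \<subseteq> carrier_mat n n" "length Xs = N" "\<And>\<alpha>. \<alpha> < N \<Longrightarrow> Xs ! \<alpha> = Z ! k (h \<alpha>)"
      using Zc Kd by (auto simp: Xs_def K_def)
    have De: "\<Delta> = diag_block_mat Xs" by (simp add: \<Delta>_eq Xs_def)
    have Dc: "\<Delta> \<in> carrier_mat (N * n) (N * n)" unfolding De using diag_block_mat_carrier[OF Xs(1)] Xs(2) by simp
    note kA = kron_one_carrier[OF car(1), of n] and kB = kron_one_carrier[OF car(2), of n]
      and kC = kron_one_carrier[OF car(3), of n] and kD = kron_one_carrier[OF car(4), of n]
    define M where "M = kron (1\<^sub>m N) (1\<^sub>m n) - kron D (1\<^sub>m n) * \<Delta>"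
    have M1: "M = 1\<^sub>m (N * n) - kron D (1\<^sub>m n) * \<Delta>" by (simp add: M_def kron_one_one)
    have DD: "kron D (1\<^sub>m n) * \<Delta> \<in> carrier_mat (N * n) (N * n)" using kD Dc by simp
    have Mc: "M \<in> carrier_mat (N * n) (N * n)" unfolding M1 by (rule minus_carrier_mat[OF DD])
    have MY: "M * Y = Y - kron D (1\<^sub>m n) * (\<Delta> * Y)" if Y: "Y \<in> carrier_mat (N * n) c" for Y c
    proof -
      have "M * Y = 1\<^sub>m (N * n) * Y - (kron D (1\<^sub>m n) * \<Delta>) * Y"
        unfolding M1 by (rule minus_mult_distrib_mat[OF _ DD Y]) simp
      also have "(kron D (1\<^sub>m n) * \<Delta>) * Y = kron D (1\<^sub>m n) * (\<Delta> * Y)"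
        by (rule assoc_mult_mat[OF kD Dc Y])
      finally show ?thesis using Y by simp
    qed
    obtain \<sigma> where \<sigma>: "0 \<le> \<sigma>" "\<sigma> < 1" "\<And>c v. c < d \<Longrightarrow> sqnorm {..<n} (mat_act n (Z ! c) v) \<le> \<sigma> * sqnorm {..<n} v"
      using polydisc_contraction_factor[OF d Z] by blast
    have zc: "sqnorm {..<n} (\<lambda>i. \<Sum>j<n. (Z ! c) $$ (i, j) * v j) \<le> \<sigma> * sqnorm {..<n} v" if "c < d" for c v
    proof -
      have "mat_act n (Z ! c) v = (\<lambda>i. \<Sum>j<n. (Z ! c) $$ (i, j) * v j)" by (rule ext) (simp add: mat_act_def)
      then show ?thesis using \<sigma>(3)[OF that, of v] by simp
    qed
    \<comment> \<open>if \<open>Y = C U + D \<Delta> Y\<close>, the columns of \<open>\<Delta> Y\<close> are the states that solve the state equations with input \<open>U\<close>\<close>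
    define st where "st = (\<lambda>(U :: nat \<Rightarrow> complex) (Y :: complex mat) l a i. if a = 0 then U i else (\<Delta> * Y) $$ (g a * n + i, l))"
    have sth: "st U Y l (h \<beta>) i = (\<Delta> * Y) $$ (\<beta> * n + i, l)" if "\<beta> < N" for U Y l \<beta> i
      using that by (simp only: st_def hz gh if_False)
    have st_eqs: "state_eqs S T k n (\<lambda>c i j. (Z ! c) $$ (i, j)) (st U Y l)"
      if Y: "Y \<in> carrier_mat (N * n) c" "l < c"
        and eq: "\<And>\<alpha> i. \<alpha> < N \<Longrightarrow> i < n \<Longrightarrow> Y $$ (\<alpha> * n + i, l) = T (h \<alpha>) 0 * U i + (kron D (1\<^sub>m n) * (\<Delta> * Y)) $$ (\<alpha> * n + i, l)"
      for U Y c l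
      unfolding state_eqs_def
    proof (intro ballI allI impI)
      fix a i assume a: "a \<in> S" and i: "i < n"
      define \<alpha> where "\<alpha> = g a"
      have \<alpha>: "\<alpha> < N" "a = h \<alpha>" using hg[OF a] by (simp_all add: \<alpha>_def)
      have DY: "\<Delta> * Y \<in> carrier_mat (N * n) c" using Dc Y by simp
      have in_eq: "apply_sys S T (\<lambda>b. st U Y l b j) a = Y $$ (\<alpha> * n + j, l)" if j: "j < n" for j
      proof -
        have "apply_sys S T (\<lambda>b. st U Y l b j) a = T a 0 * U j + (\<Sum>\<beta><N. T a (h \<beta>) * (\<Delta> * Y) $$ (\<beta> * n + j, l))"
          unfolding app by (simp add: sth) (simp add: st_def)
        also have "(\<Sum>\<beta><N. T a (h \<beta>) * (\<Delta> * Y) $$ (\<beta> * n + j, l)) = (kron D (1\<^sub>m n) * (\<Delta> * Y)) $$ (\<alpha> * n + j, l)"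
          unfolding kron_one_times_entry[OF car(4) DY \<alpha>(1) j Y(2)] using \<alpha> by (intro sum.cong refl) (simp add: D_def)
        also have "T a 0 * U j + \<dots> = Y $$ (\<alpha> * n + j, l)" using eq[OF \<alpha>(1) j] \<alpha>(2) by simp
        finally show ?thesis .
      qed
      have "st U Y l a i = (\<Sum>j<n. (Xs ! \<alpha>) $$ (i, j) * Y $$ (\<alpha> * n + j, l))"
        unfolding \<alpha>(2) sth[OF \<alpha>(1)] De by (rule diag_block_mat_times_entry[OF Xs(1,2) Y(1) \<alpha>(1) i Y(2)])
      then show "st U Y l a i = (\<Sum>j<n. (Z ! k a) $$ (i, j) * apply_sys S T (\<lambda>b. st U Y l b j) a)"
        using in_eq Xs(3)[OF \<alpha>(1)] \<alpha>(2) by simp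
    qed
    have split: "\<exists>\<alpha> i. \<alpha> < N \<and> i < n \<and> q = \<alpha> * n + i" if "q < N * n" for q
      using that n by (intro exI[of _ "q div n"] exI[of _ "q mod n"]) (auto simp: div_less_mult)
    have "det M \<noteq> 0"
    proof
      assume "det M = 0"
      then obtain w where w: "w \<in> carrier_vec (N * n)" "w \<noteq> 0\<^sub>v (N * n)" "M *\<^sub>v w = 0\<^sub>v (N * n)"
        using det_0_iff_vec_prod_zero[OF Mc] by blast
      \<comment> \<open>a kernel vector is a column that satisfies \<open>Y = D \<Delta> Y\<close>, so its states solve the equations with zero input\<close>
      define Y where "Y = mat (N * n) 1 (\<lambda>(q, _). w $ q)"
      have Y: "Y \<in> carrier_mat (N * n) 1" by (simp add: Y_def)
      have "M * Y = 0\<^sub>m (N * n) 1"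
      proof (rule eq_matI)
        fix q l assume "q < dim_row (0\<^sub>m (N * n) 1 :: complex mat)" "l < dim_col (0\<^sub>m (N * n) 1 :: complex mat)"
        then have ql: "q < N * n" "l < 1" by auto
        have "(M * Y) $$ (q, l) = (\<Sum>p<N * n. M $$ (q, p) * w $ p)"
          unfolding mat_mult_entry[OF Mc Y ql] using ql by (intro sum.cong) (auto simp: Y_def)
        also have "\<dots> = (M *\<^sub>v w) $ q" using ql Mc w(1) by (simp add: scalar_prod_def atLeast0LessThan)
        finally show "(M * Y) $$ (q, l) = 0\<^sub>m (N * n) 1 $$ (q, l)" using w(3) ql by simp
      qed (use Mc Y in auto)
      then have Y0: "Y - kron D (1\<^sub>m n) * (\<Delta> * Y) = 0\<^sub>m (N * n) 1" using MY[OF Y] by simp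
      have DDY: "kron D (1\<^sub>m n) * (\<Delta> * Y) \<in> carrier_mat (N * n) 1" using kD Dc Y by simp
      have eqY: "Y $$ (q, 0) = (kron D (1\<^sub>m n) * (\<Delta> * Y)) $$ (q, 0)" if q: "q < N * n" for q
        using arg_cong[OF Y0, of "\<lambda>M. M $$ (q, 0)"] q minus_entry[OF DDY q, of 0 Y] by simp
      have X: "state_eqs S T k n (\<lambda>c i j. (Z ! c) $$ (i, j)) (st (\<lambda>_. 0) Y 0)"
        by (rule st_eqs[OF Y]) (simp_all only: mult_zero_right add_0 eqY index_less_mult less_one)
      have "(\<Delta> * Y) $$ (\<beta> * n + i, 0) = 0" if "\<beta> < N" "i < n" for \<beta> i
        using contractive_system_unique_solution[OF sys con \<sigma>(2) zc \<sigma>(1) _ X hS[OF that(1)] that(2)]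
        unfolding sth[OF that(1)] by (simp add: st_def)
      then have "(\<Delta> * Y) $$ (q, 0) = 0" if "q < N * n" for q using split[OF that] by blast
      then have "\<Delta> * Y = 0\<^sub>m (N * n) 1" using Dc Y by (intro eq_matI) (simp_all del: index_mult_mat(1))
      then have "Y = 0\<^sub>m (N * n) 1" using eqY Y kD by (intro eq_matI) auto
      then have "Y $$ (q, 0) = 0" if "q < N * n" for q using that by simp
      then have "w $ q = 0" if "q < N * n" for q using that by (simp add: Y_def)
      then have "w = 0\<^sub>v (N * n)" using w(1) by (intro eq_vecI) auto
      then show False using w(2) by simp
    qed
    then have "M \<in> Units (ring_mat TYPE(complex) (N * n) ())" by (rule det_non_zero_imp_unit[OF Mc])
    then obtain R where R: "mat_inverse M = Some R" using mat_inverse(1)[OF Mc, where b = "()"] by (cases "mat_inverse M") auto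
    note inv = mat_inverse_Some[OF Mc R]
    have invM: "invertible_mat M"
      unfolding invertible_mat_def inverts_mat_def using inv Mc by (auto intro!: exI[of _ R])
    \<comment> \<open>\<open>V\<close> satisfies \<open>V = C + D \<Delta> V\<close>; its column \<open>l\<close> belongs to the input \<open>e\<^sub>l\<close>\<close>
    define V where "V = R * kron C (1\<^sub>m n)"
    have kC': "kron C (1\<^sub>m n) \<in> carrier_mat (N * n) n" using kC by simp
    have V: "V \<in> carrier_mat (N * n) n" unfolding V_def using inv(3) kC' by simp
    have "M * V = kron C (1\<^sub>m n)"
      unfolding V_def assoc_mult_mat[OF Mc inv(3) kC', symmetric] inv(1) using kC' by simp
    then have Vm: "V - kron D (1\<^sub>m n) * (\<Delta> * V) = kron C (1\<^sub>m n)" using MY[OF V] by simp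
    have DDV: "kron D (1\<^sub>m n) * (\<Delta> * V) \<in> carrier_mat (N * n) n" using kD Dc V by simp
    have Vent: "V $$ (\<alpha> * n + i, l) = T (h \<alpha>) 0 * (if i = l then 1 else 0) + (kron D (1\<^sub>m n) * (\<Delta> * V)) $$ (\<alpha> * n + i, l)"
      if "\<alpha> < N" "i < n" "l < n" for \<alpha> i l
    proof -
      have lt: "\<alpha> * n + i < N * n" using that by (intro index_less_mult)
      have "V $$ (\<alpha> * n + i, l) - (kron D (1\<^sub>m n) * (\<Delta> * V)) $$ (\<alpha> * n + i, l) = kron C (1\<^sub>m n) $$ (\<alpha> * n + i, l)"
        using arg_cong[OF Vm, of "\<lambda>M. M $$ (\<alpha> * n + i, l)"] minus_entry[OF DDV lt that(3), of V] by simp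
      also have "\<dots> = T (h \<alpha>) 0 * (if i = l then 1 else 0)"
        using kron_one_entry[OF car(3) lt, of l] that by (simp add: C_def)
      finally show ?thesis by (simp add: algebra_simps)
    qed
    have DV: "\<Delta> * V \<in> carrier_mat (N * n) n" using Dc V by simp
    have "nc_fun_eval d n f Z $$ (i, l) = (kron A (1\<^sub>m n) + kron B (1\<^sub>m n) * (\<Delta> * V)) $$ (i, l)"
      if il: "i < n" "l < n" for i l
    proof -
      let ?U = "\<lambda>i. if i = l then 1 else 0 :: complex"
      have "mat_act n (nc_fun_eval d n f Z) (st ?U V l 0) i = apply_sys S T (\<lambda>b. st ?U V l b i) 0"
        by (rule val[OF n Z st_eqs[OF V il(2)] il(1)]) (rule Vent[OF _ _ il(2)])
      moreover have "mat_act n (nc_fun_eval d n f Z) (st ?U V l 0) i = nc_fun_eval d n f Z $$ (i, l)"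
      proof -
        have "mat_act n (nc_fun_eval d n f Z) (st ?U V l 0) i = (\<Sum>j<n. if j = l then nc_fun_eval d n f Z $$ (i, j) else 0)"
          unfolding mat_act_def by (intro sum.cong) (auto simp: st_def)
        then show ?thesis using il by simp
      qed
      moreover have "apply_sys S T (\<lambda>b. st ?U V l b i) 0 = T 0 0 * ?U i + (\<Sum>\<beta><N. T 0 (h \<beta>) * (\<Delta> * V) $$ (\<beta> * n + i, l))"
        unfolding app by (simp add: sth) (simp add: st_def)
      moreover have "(kron B (1\<^sub>m n) * (\<Delta> * V)) $$ (i, l) = (\<Sum>\<beta><N. T 0 (h \<beta>) * (\<Delta> * V) $$ (\<beta> * n + i, l))"
        using kron_one_times_entry[OF car(2) DV, of 0 i l] il by (simp add: B_def del: index_mult_mat(1))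
      moreover have "kron A (1\<^sub>m n) $$ (i, l) = T 0 0 * ?U i"
        using kron_one_entry[OF car(1), of i n l] il by (simp add: A_def)
      moreover have "kron B (1\<^sub>m n) * (\<Delta> * V) \<in> carrier_mat n n" using kB DV by simp
      from plus_entry[OF this il, of "kron A (1\<^sub>m n)"]
      have "(kron A (1\<^sub>m n) + kron B (1\<^sub>m n) * (\<Delta> * V)) $$ (i, l) =
        kron A (1\<^sub>m n) $$ (i, l) + (kron B (1\<^sub>m n) * (\<Delta> * V)) $$ (i, l)" .
      ultimately show ?thesis by (simp only:)
    qed
    moreover have "nc_fun_eval d n f Z \<in> carrier_mat n n" by (rule value_carrier[OF n Z])
    ultimately have "nc_fun_eval d n f Z = kron A (1\<^sub>m n) + kron B (1\<^sub>m n) * (\<Delta> * V)"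
      using kA kB DV by (intro eq_matI) auto
    also have "kron B (1\<^sub>m n) * (\<Delta> * V) = kron B (1\<^sub>m n) * \<Delta> * R * kron C (1\<^sub>m n)"
    proof -
      have BD: "kron B (1\<^sub>m n) * \<Delta> \<in> carrier_mat (1 * n) (N * n)" using kB Dc by simp
      show ?thesis unfolding V_def assoc_mult_mat[OF BD inv(3) kC'] assoc_mult_mat[OF kB Dc V[unfolded V_def]] ..
    qed
    finally show ?thesis using invM R unfolding M_def by simp
  qed
  show ?thesis
  proof (intro exI conjI ballI allI impI)
    show "A \<in> carrier_mat 1 1" "B \<in> carrier_mat 1 N" "C \<in> carrier_mat N 1" "D \<in> carrier_mat N N"
      by (rule car)+
    show "contraction (four_block_mat A B C D)" by (rule contr)
    show "K \<alpha> < d" if "\<alpha> < N" for \<alpha> by (rule Kd[OF that])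
    fix n Z assume n: "1 \<le> n" and Z: "Z \<in> nc_polydisc d n"
    show "let \<Delta> = diag_block_mat (map (\<lambda>j. Z ! K j) [0..<N]);
              M = kron (1\<^sub>m N) (1\<^sub>m n) - kron D (1\<^sub>m n) * \<Delta>
          in invertible_mat M \<and> nc_fun_eval d n f Z =
            kron A (1\<^sub>m n) + kron B (1\<^sub>m n) * \<Delta> * the (mat_inverse M) * kron C (1\<^sub>m n)"
      unfolding Let_def by (rule main[OF n Z refl])
  qed
qed

end
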